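(* Let $\mathbb{F}$ be a finite field, $D\ge 1$, and let $T\in\mathbb{F}^{n_0\times\dots\times n_{D-1}}$ be a concise tensor with $n_0\ge n_1\ge\dots\ge n_{D-1}$, and let $R\ge n_0$ be an integer. Then there is an algorithm that, given $T$ and $R$, either returns a rank-$R$ CPD of $T$ or correctly determines that no rank-$R$ CPD of $T$ exists, running in time $$O^*\!\left(|\mathbb{F}|^{\min\{R,\ \sum_{d\ge 2} n_d\} + (R-n_0)\left(\sum_{d\ne 0} n_d\right)}\right)$$ and using $O^*(1)$ space.
   Context: A rank-$R$ canonical polyadic decomposition (CPD) of $T\in\mathbb{F}^{n_0\times\dots\times n_{D-1}}$ is a list of matrices $A_d\in\mathbb{F}^{n_d\times R}$, $0\le d<D$, such that $T_{i_0,\dots,i_{D-1}}=\sum_{0\le r<R}\prod_{0\le d<D}(A_d)_{i_d,r}$ for all indices. $T$ is axis-$d$ concise if the $n_d$ slices $\{T_{:,\dots,:,i_d,:,\dots,:}:0\le i_d<n_d\}$ (obtained by fixing the index in axis $d$) are linearly independent, and concise if it is axis-$d$ concise for every $0\le d<D$. The notation $O^*(\cdot)$ suppresses factors polynomial in $n_0,\dots,n_{D-1},D,R,|\mathbb{F}|$; in particular $O^*(1)$ space means space polynomial in these quantities. *)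

theory Defs
  imports "HOL-Algebra.Coset" "HOL-Algebra.Ring" "HOL-Library.Log_Nat" "HOL-Library.FuncSet"
begin

section \<open>Tensors and canonical polyadic decompositions\<close>

text \<open>
  A tensor of shape \<open>ns = [n\<^sub>0, \<dots>, n\<^sub>D\<^sub>-\<^sub>1]\<close> over \<open>F\<close> is a function on index lists; only its
  values on \<open>indices ns\<close> matter.
\<close>

definition indices :: "nat list \<Rightarrow> nat list set" where
  "indices ns = {js. length js = length ns \<and> (\<forall>d<length ns. js ! d < ns ! d)}"

text \<open>
  \<open>A d i r\<close> is the entry of the matrix \<open>A\<^sub>d\<close> in row \<open>i\<close> and column \<open>r\<close>.
\<close>

definition is_cpd ::
    "'a ring \<Rightarrow> nat list \<Rightarrow> (nat list \<Rightarrow> 'a) \<Rightarrow> nat \<Rightarrow> (nat \<Rightarrow> nat \<Rightarrow> nat \<Rightarrow> 'a) \<Rightarrow> bool" where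
  "is_cpd F ns T R A \<longleftrightarrow>
     (\<forall>d<length ns. \<forall>i<ns ! d. \<forall>r<R. A d i r \<in> carrier F) \<and>
     (\<forall>js\<in>indices ns.
        T js = (\<Oplus>\<^bsub>F\<^esub>r\<in>{..<R}. \<Otimes>\<^bsub>F\<^esub>d\<in>{..<length ns}. A d (js ! d) r))"

text \<open>
  Linear independence is stated for families rather than sets, so that repeated slices count as
  dependent.
\<close>

definition lin_indep_family ::
    "'a ring \<Rightarrow> 'b set \<Rightarrow> nat \<Rightarrow> (nat \<Rightarrow> 'b \<Rightarrow> 'a) \<Rightarrow> bool" where
  "lin_indep_family F X m v \<longleftrightarrow>
     (\<forall>a\<in>{..<m} \<rightarrow> carrier F.
        (\<forall>x\<in>X. (\<Oplus>\<^bsub>F\<^esub>i\<in>{..<m}. a i \<otimes>\<^bsub>F\<^esub> v i x) = \<zero>\<^bsub>F\<^esub>) \<longrightarrow> (\<forall>i<m. a i = \<zero>\<^bsub>F\<^esub>))"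

definition slice :: "(nat list \<Rightarrow> 'a) \<Rightarrow> nat \<Rightarrow> nat \<Rightarrow> nat list \<Rightarrow> 'a" where
  "slice T d i js = T (take d js @ i # drop d js)"

definition axis_concise :: "'a ring \<Rightarrow> nat list \<Rightarrow> (nat list \<Rightarrow> 'a) \<Rightarrow> nat \<Rightarrow> bool" where
  "axis_concise F ns T d \<longleftrightarrow>
     lin_indep_family F (indices (take d ns @ drop (Suc d) ns)) (ns ! d) (slice T d)"

definition concise :: "'a ring \<Rightarrow> nat list \<Rightarrow> (nat list \<Rightarrow> 'a) \<Rightarrow> bool" where
  "concise F ns T \<longleftrightarrow> (\<forall>d<length ns. axis_concise F ns T d)"


section \<open>Machine model\<close>

text \<open>
  A random access machine with finitely many arrays of natural numbers (finitely many, because a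
  program only mentions array names as constants) and logarithmic cost: every elementary operation
  is charged the bit lengths of the numbers it touches. Cells not yet written to contain 0.
\<close>

type_synonym mem = "nat \<Rightarrow> nat \<Rightarrow> nat"

datatype binop = OpAdd | OpSub | OpMul | OpDiv | OpMod | OpLess | OpEq

datatype expr = Lit nat | Get nat expr | Bin binop expr expr

datatype com =
    Skip
  | Put nat expr expr
  | Seq com com
  | Cond expr com com
  | While expr com

fun bin_val :: "binop \<Rightarrow> nat \<Rightarrow> nat \<Rightarrow> nat" where
  "bin_val OpAdd x y = x + y"
| "bin_val OpSub x y = x - y"
| "bin_val OpMul x y = x * y"
| "bin_val OpDiv x y = x div y"
| "bin_val OpMod x y = x mod y"
| "bin_val OpLess x y = of_bool (x < y)"
| "bin_val OpEq x y = of_bool (x = y)"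

fun val :: "mem \<Rightarrow> expr \<Rightarrow> nat" where
  "val s (Lit n) = n"
| "val s (Get a e) = s a (val s e)"
| "val s (Bin f e1 e2) = bin_val f (val s e1) (val s e2)"

abbreviation bits :: "nat \<Rightarrow> nat" where
  "bits n \<equiv> floorlog 2 n"

fun cost :: "mem \<Rightarrow> expr \<Rightarrow> nat" where
  "cost s (Lit n) = 1 + bits n"
| "cost s (Get a e) = 1 + cost s e + bits (val s (Get a e))"
| "cost s (Bin f e1 e2) = 1 + cost s e1 + cost s e2 + bits (val s (Bin f e1 e2))"

text \<open>
  The number of bits needed to store the nonzero cells together with their addresses. All memories
  reachable from an input have only finitely many nonzero cells, so the sum is never a sum over an
  infinite set.
\<close>

definition mem_size :: "mem \<Rightarrow> nat" where
  "mem_size s = (\<Sum>(a, i)\<in>{(a, i). s a i \<noteq> 0}. 1 + bits i + bits (s a i))"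

text \<open>
  \<open>exec p s t w s'\<close>: started in memory \<open>s\<close>, the program \<open>p\<close> halts in memory \<open>s'\<close> after time \<open>t\<close>, and
  \<open>w\<close> is the maximal space in use during the run. The space in use counts the whole memory,
  including the input and the output, and the intermediate values of the current elementary step;
  as the cost of a step bounds the size of the cell it writes, it also covers the memory after the
  step.
\<close>

inductive exec :: "com \<Rightarrow> mem \<Rightarrow> nat \<Rightarrow> nat \<Rightarrow> mem \<Rightarrow> bool" where
  Skip: "exec Skip s 1 (mem_size s + 1) s"
| Put: "k = 1 + cost s e1 + cost s e2 \<Longrightarrow>
    exec (Put a e1 e2) s k (mem_size s + k) (s(a := (s a)(val s e1 := val s e2)))"
| Seq: "exec p1 s t1 w1 s1 \<Longrightarrow> exec p2 s1 t2 w2 s2 \<Longrightarrow>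
    exec (Seq p1 p2) s (t1 + t2) (max w1 w2) s2"
| CondTrue: "val s e \<noteq> 0 \<Longrightarrow> k = 1 + cost s e \<Longrightarrow> exec p1 s t w s1 \<Longrightarrow>
    exec (Cond e p1 p2) s (k + t) (max (mem_size s + k) w) s1"
| CondFalse: "val s e = 0 \<Longrightarrow> k = 1 + cost s e \<Longrightarrow> exec p2 s t w s1 \<Longrightarrow>
    exec (Cond e p1 p2) s (k + t) (max (mem_size s + k) w) s1"
| WhileTrue: "val s e \<noteq> 0 \<Longrightarrow> k = 1 + cost s e \<Longrightarrow> exec p s t1 w1 s1 \<Longrightarrow>
    exec (While e p) s1 t2 w2 s2 \<Longrightarrow>
    exec (While e p) s (k + t1 + t2) (max (mem_size s + k) (max w1 w2)) s2"
| WhileFalse: "val s e = 0 \<Longrightarrow> k = 1 + cost s e \<Longrightarrow>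
    exec (While e p) s k (mem_size s + k) s"

lemma exec_deterministic:
  "exec p s t w s1 \<Longrightarrow> exec p s t' w' s2 \<Longrightarrow> t' = t \<and> w' = w \<and> s2 = s1"
proof (induction arbitrary: t' w' s2 rule: exec.induct)
  case (Seq p1 s t1 w1 s1 p2 t2 w2 s2)
  from Seq.prems show ?case by (cases) (use Seq.IH in blast)
next
  case (WhileTrue s e k p t1 w1 s1 t2 w2 s2)
  from WhileTrue.prems show ?case by (cases) (use WhileTrue in blast)+
next
  case (CondTrue s e k p1 t w s1 p2)
  from CondTrue.prems show ?case by (cases) (use CondTrue in blast)+
next
  case (CondFalse s e k p2 t w s1 p1)
  from CondFalse.prems show ?case by (cases) (use CondFalse in blast)+
qed (auto elim: exec.cases)


section \<open>Input, output and resource bounds\<close>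

definition mem_of :: "nat list list \<Rightarrow> mem" where
  "mem_of xss a i = (if a < length xss \<and> i < length (xss ! a) then xss ! a ! i else 0)"

text \<open>
  The elements of the field are the numbers below \<open>order F\<close>; the field is given to the machine by
  its addition and multiplication tables. The entries of the tensor are listed in row-major
  order.
\<close>

definition input :: "nat ring \<Rightarrow> nat list \<Rightarrow> (nat list \<Rightarrow> nat) \<Rightarrow> nat \<Rightarrow> mem" where
  "input F ns T R = mem_of
     [[order F, \<zero>\<^bsub>F\<^esub>, \<one>\<^bsub>F\<^esub>, length ns, R],
      ns,
      [x \<oplus>\<^bsub>F\<^esub> y. x \<leftarrow> [0..<order F], y \<leftarrow> [0..<order F]],
      [x \<otimes>\<^bsub>F\<^esub> y. x \<leftarrow> [0..<order F], y \<leftarrow> [0..<order F]],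
      map T (product_lists (map (\<lambda>n. [0..<n]) ns))]"

text \<open>
  A halting memory answers "yes" or "no" by the value 1 or 0 in cell 0 of array 5. In the former
  case array 6 contains the matrices \<open>A\<^sub>0, A\<^sub>1, \<dots>\<close> one after another, each in row-major order.
\<close>

definition out_factors :: "nat list \<Rightarrow> nat \<Rightarrow> mem \<Rightarrow> nat \<Rightarrow> nat \<Rightarrow> nat \<Rightarrow> nat" where
  "out_factors ns R s d i r = s 6 ((sum_list (take d ns) + i) * R + r)"

definition correct_output :: "nat ring \<Rightarrow> nat list \<Rightarrow> (nat list \<Rightarrow> nat) \<Rightarrow> nat \<Rightarrow> mem \<Rightarrow> bool" where
  "correct_output F ns T R s \<longleftrightarrow>
     s 5 0 = 1 \<and> is_cpd F ns T R (out_factors ns R s) \<or>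
     s 5 0 = 0 \<and> (\<nexists>A. is_cpd F ns T R A)"

text \<open>
  The factors suppressed by \<open>O\<^sup>*\<close> are those bounded by \<open>c * (params F ns R) ^ k\<close> with absolute
  constants \<open>c\<close> and \<open>k\<close>. The summand \<open>prod_list ns\<close> is the monomial \<open>n\<^sub>0 n\<^sub>1 \<cdots> n\<^sub>D\<^sub>-\<^sub>1\<close>, the number of
  entries of the tensor. It cannot be dropped when \<open>D\<close> varies: the algorithm has to read all entries,
  and their number is not bounded by a polynomial in \<open>D + n\<^sub>0 + \<dots> + n\<^sub>D\<^sub>-\<^sub>1\<close> of degree independent of
  \<open>D\<close>. For each fixed \<open>D\<close> it is at most \<open>(n\<^sub>0 + \<dots> + n\<^sub>D\<^sub>-\<^sub>1) ^ D\<close>.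
\<close>

definition params :: "nat ring \<Rightarrow> nat list \<Rightarrow> nat \<Rightarrow> nat" where
  "params F ns R = order F + R + length ns + sum_list ns + prod_list ns"

end

theory Submission
  imports Defs "HOL-Library.Sublist" "HOL-Combinatorics.Transposition"
begin

text \<open>
  By conciseness the factor \<open>A\<^sub>0\<close> of a decomposition has full row rank, so after a permutation of the
  columns (Steinitz exchange) the span \<open>V\<close> of the \<open>n\<^sub>0\<close> slices of \<open>T\<close> along axis 0 and of the rank-one
  tensors \<open>u\<^sub>r\<close>, \<open>r \<ge> n\<^sub>0\<close>, formed by the columns of the other factors contains all \<open>u\<^sub>r\<close>. The algorithm
  guesses \<open>u\<^sub>r\<close> for \<open>r \<ge> n\<^sub>0\<close> and starts from the frame of \<open>V\<close> consisting of the slices and these \<open>u\<^sub>r\<close>.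
  It replaces the slices one by one by rank-one tensors \<open>v \<otimes> w\<close> (\<open>v\<close> in axis 1, \<open>w\<close> of rank one in the
  axes \<open>\<ge> 2\<close>) that involve the slice to be replaced. For given \<open>w\<close> the vector \<open>v\<close> is found by solving
  a linear system. The candidates for \<open>w\<close> are either all lists of factors, or the lists of fibers
  of the \<open>|F| ^ R\<close> elements of \<open>V\<close> through a fixed entry, because these determine the factors of a
  rank-one tensor up to scalars. The coefficients of the slices with respect to the frame are
  updated along the way and end up as \<open>A\<^sub>0\<close>.

  For the machine, vectors and matrices over \<open>F\<close> are encoded as numbers in base \<open>|F|\<close>, and the
  algorithm is written as an expression with bounded iteration as its only control structure. Such
  expressions are compiled to programs once and for all, with a bound on the running time that is
  read off from the nesting of the iterations and a space bound that follows from a bound on the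
  values.
\<close>

section \<open>Fold expressions and their compilation\<close>

text \<open>The exchange of a slice must never be revised: a search branching over the exchanges
  would multiply the exponent by the number of stages. Greedy choices are safe because only the span
  of the frame matters. For a suitable guess this span equals the span of all rank-one terms of a
  decomposition, and every successful exchange preserves it, whichever one is found. At each stage
  the slice to be replaced is thus a combination of the terms, and each term a combination of the
  frame. Either some term involves the slice, or the slice is redundant and may be exchanged for the
  zero tensor, which therefore counts as a rank-one tensor. Once every stage has succeeded the frame
  consists of rank-one tensors, so soundness needs no property of the guess. The stages contribute a
  factor \<open>n0\<close> instead of a power, and the exponent is that of the guess plus that of a
  single enumeration of \<open>w\<close>. Space stays polynomial since an enumeration is a counter
  of polynomially many bits and all scratch cells are reused.\<close>

text \<open>
  The tag of a fold has no effect on its value: it selects the bound on the number of iterations.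
  Tag 0 is used for the loops of polynomial length and the tags 1 and 2 for the two enumerations of
  exponential length.
\<close>

datatype xe =
    XLit nat
  | XVar nat
  | XGet nat xe
  | XBin binop xe xe
  | XIf xe xe xe
  | XFold nat xe xe xe

primrec itr :: "(nat \<Rightarrow> 'a \<Rightarrow> 'a) \<Rightarrow> nat \<Rightarrow> 'a \<Rightarrow> 'a" where
  "itr f 0 x = x"
| "itr f (Suc n) x = f n (itr f n x)"

primrec den :: "mem \<Rightarrow> xe \<Rightarrow> nat list \<Rightarrow> nat" where
  "den s (XLit n) vs = n"
| "den s (XVar v) vs = vs ! v"
| "den s (XGet a e) vs = s a (den s e vs)"
| "den s (XBin f e1 e2) vs = bin_val f (den s e1 vs) (den s e2 vs)"
| "den s (XIf e e1 e2) vs = (if den s e vs \<noteq> 0 then den s e1 vs else den s e2 vs)"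
| "den s (XFold k n e1 e2) vs = itr (\<lambda>i x. den s e2 (vs @ [x, i])) (den s n vs) (den s e1 vs)"

text \<open>Side conditions along the actual evaluation only: the branch that is taken and the
  accumulators that really occur. Apart from truth values, only sums and products can exceed their
  operands, so only these and literals need a bound. Iteration counts are bounded separately because
  they determine the time. Reads are confined to the input arrays, which compiled expressions never
  write.\<close>

primrec good :: "mem \<Rightarrow> (nat \<Rightarrow> nat) \<Rightarrow> nat \<Rightarrow> xe \<Rightarrow> nat list \<Rightarrow> bool" where
  "good s Nb B (XLit n) vs \<longleftrightarrow> n < 2 ^ B"
| "good s Nb B (XVar v) vs \<longleftrightarrow> v < length vs"
| "good s Nb B (XGet a e) vs \<longleftrightarrow> a < 5 \<and> good s Nb B e vs"
| "good s Nb B (XBin f e1 e2) vs \<longleftrightarrow>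
     good s Nb B e1 vs \<and> good s Nb B e2 vs \<and>
     (f \<in> {OpAdd, OpMul} \<longrightarrow> bin_val f (den s e1 vs) (den s e2 vs) < 2 ^ B)"
| "good s Nb B (XIf e e1 e2) vs \<longleftrightarrow>
     good s Nb B e vs \<and> (if den s e vs \<noteq> 0 then good s Nb B e1 vs else good s Nb B e2 vs)"
| "good s Nb B (XFold k n e1 e2) vs \<longleftrightarrow>
     good s Nb B n vs \<and> good s Nb B e1 vs \<and> den s n vs \<le> Nb k \<and>
     (\<forall>j<den s n vs. good s Nb B e2
        (vs @ [itr (\<lambda>i x. den s e2 (vs @ [x, i])) j (den s e1 vs), j]))"

text \<open>
  Variables live in array 7 (at level \<open>L\<close> the cells below \<open>L\<close> are bound) and intermediate results on
  a stack in array 8, whose cells below \<open>K\<close> are in use; the result is left in cell \<open>K\<close>.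
\<close>

primrec compile :: "xe \<Rightarrow> nat \<Rightarrow> nat \<Rightarrow> com" where
  "compile (XLit n) L K = Put 8 (Lit K) (Lit n)"
| "compile (XVar v) L K = Put 8 (Lit K) (Get 7 (Lit v))"
| "compile (XGet a e) L K = Seq (compile e L K) (Put 8 (Lit K) (Get a (Get 8 (Lit K))))"
| "compile (XBin f e1 e2) L K =
     Seq (compile e1 L K) (Seq (compile e2 L (K + 1))
       (Put 8 (Lit K) (Bin f (Get 8 (Lit K)) (Get 8 (Lit (K + 1))))))"
| "compile (XIf e e1 e2) L K =
     Seq (compile e L K) (Cond (Get 8 (Lit K)) (compile e1 L K) (compile e2 L K))"
| "compile (XFold k n e1 e2) L K =
     Seq (compile e1 L K) (Seq (compile n L (K + 1))
       (Seq (Put 7 (Lit L) (Get 8 (Lit K))) (Seq (Put 7 (Lit (L + 1)) (Lit 0))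
       (Seq (While (Bin OpLess (Get 7 (Lit (L + 1))) (Get 8 (Lit (K + 1))))
              (Seq (compile e2 (L + 2) (K + 2))
              (Seq (Put 7 (Lit L) (Get 8 (Lit (K + 2))))
                   (Put 7 (Lit (L + 1)) (Bin OpAdd (Get 7 (Lit (L + 1))) (Lit 1))))))
            (Put 8 (Lit K) (Get 7 (Lit L)))))))"

primrec sz :: "xe \<Rightarrow> nat" where
  "sz (XLit n) = 1"
| "sz (XVar v) = 1"
| "sz (XGet a e) = sz e + 1"
| "sz (XBin f e1 e2) = sz e1 + sz e2 + 1"
| "sz (XIf e e1 e2) = sz e + sz e1 + sz e2 + 1"
| "sz (XFold k n e1 e2) = sz n + sz e1 + sz e2 + 1"

text \<open>Counts elementary steps, not their cost. A fold needs two assignments that initialise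
  the loop variables, the failing test and the copy of the result (4), and in each iteration a test
  and two assignments (3).\<close>

primrec tb :: "(nat \<Rightarrow> nat) \<Rightarrow> xe \<Rightarrow> nat" where
  "tb Nb (XLit n) = 1"
| "tb Nb (XVar v) = 1"
| "tb Nb (XGet a e) = tb Nb e + 1"
| "tb Nb (XBin f e1 e2) = tb Nb e1 + tb Nb e2 + 1"
| "tb Nb (XIf e e1 e2) = tb Nb e + tb Nb e1 + tb Nb e2 + 1"
| "tb Nb (XFold k n e1 e2) = tb Nb n + tb Nb e1 + 4 + Nb k * (tb Nb e2 + 3)"

text \<open>Nesting depth of the loops with tag \<open>j\<close>, hence the exponent of
  \<open>Nb j\<close> in the running time. Loops that run one after the other only enter through the
  maximum.\<close>

primrec deg :: "nat \<Rightarrow> xe \<Rightarrow> nat" where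
  "deg j (XLit n) = 0"
| "deg j (XVar v) = 0"
| "deg j (XGet a e) = deg j e"
| "deg j (XBin f e1 e2) = max (deg j e1) (deg j e2)"
| "deg j (XIf e e1 e2) = max (deg j e) (max (deg j e1) (deg j e2))"
| "deg j (XFold k n e1 e2) = max (max (deg j n) (deg j e1)) (deg j e2 + of_bool (j = k))"

primrec kinds :: "xe \<Rightarrow> bool" where
  "kinds (XLit n) = True"
| "kinds (XVar v) = True"
| "kinds (XGet a e) = kinds e"
| "kinds (XBin f e1 e2) = (kinds e1 \<and> kinds e2)"
| "kinds (XIf e e1 e2) = (kinds e \<and> kinds e1 \<and> kinds e2)"
| "kinds (XFold k n e1 e2) = (k < 3 \<and> kinds n \<and> kinds e1 \<and> kinds e2)"

text \<open>The overheads 4 and 3 of a fold stay below 8, the allowance of one node. Multiplying the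
  bound of the body by \<open>Nb j\<close> raises exactly the exponent of tag
  \<open>j\<close>.\<close>

lemma tb_le:
  assumes Nb: "\<And>k. Nb k \<ge> 1" and "kinds e"
  shows "tb Nb e \<le> 8 * sz e * (\<Prod>k<3. Nb k ^ deg k e)"
  using assms(2)
proof (induction e)
  let ?P = "\<lambda>d. \<Prod>k<3. Nb k ^ d k"
  have P1: "1 \<le> ?P d" for d using Nb by (intro prod_ge_1) auto
  have P: "a * ?P d \<le> a * ?P d'" if "\<And>k. d k \<le> d' k" for a d d'
    using that Nb by (intro mult_le_mono2 prod_mono) (auto intro!: power_increasing)
  {
    case (XGet a e)
    then have "tb Nb e \<le> 8 * sz e * ?P (\<lambda>k. deg k e)" by simp
    then show ?case using P1[of "\<lambda>k. deg k e"] unfolding tb.simps sz.simps deg.simps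
      by (simp only: add_mult_distrib add_mult_distrib2)
  next
    case (XBin f e1 e2)
    let ?M = "?P (\<lambda>k. deg k (XBin f e1 e2))"
    have "tb Nb e1 \<le> 8 * sz e1 * ?M" "tb Nb e2 \<le> 8 * sz e2 * ?M"
      using XBin by (auto intro: order_trans[OF _ P])
    then show ?case using P1[of "\<lambda>k. deg k (XBin f e1 e2)"] unfolding tb.simps sz.simps
      by (simp only: add_mult_distrib add_mult_distrib2)
  next
    case (XIf e e1 e2)
    let ?M = "?P (\<lambda>k. deg k (XIf e e1 e2))"
    have "tb Nb e \<le> 8 * sz e * ?M" "tb Nb e1 \<le> 8 * sz e1 * ?M" "tb Nb e2 \<le> 8 * sz e2 * ?M"
      using XIf by (auto intro: order_trans[OF _ P])
    then show ?case using P1[of "\<lambda>k. deg k (XIf e e1 e2)"] unfolding tb.simps sz.simps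
      by (simp only: add_mult_distrib add_mult_distrib2)
  next
    case (XFold j e e1 e2)
    let ?M = "?P (\<lambda>k. deg k (XFold j e e1 e2))"
    have "tb Nb e \<le> 8 * sz e * ?M" "tb Nb e1 \<le> 8 * sz e1 * ?M"
      using XFold by (auto intro: order_trans[OF _ P])
    moreover have "Nb j * (tb Nb e2 + 3) \<le> 8 * sz e2 * ?M + 3 * ?M"
    proof -
      have "(\<Prod>k<3. Nb k ^ of_bool (k = j)) = (\<Prod>k<3. if k = j then Nb k else 1)"
        by (rule prod.cong) auto
      also have "\<dots> = Nb j" using XFold.prems by (subst prod.delta) auto
      finally have "Nb j * ?P (\<lambda>k. deg k e2) = ?P (\<lambda>k. deg k e2 + of_bool (k = j))"
        by (simp add: power_add prod.distrib)
      then have m: "a * (Nb j * ?P (\<lambda>k. deg k e2)) \<le> a * ?M" for a by (simp only:) (rule P, simp)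
      have "tb Nb e2 + 3 \<le> (8 * sz e2 + 3) * ?P (\<lambda>k. deg k e2)"
        using XFold P1[of "\<lambda>k. deg k e2"] by (simp add: add_mult_distrib)
      then have "Nb j * (tb Nb e2 + 3) \<le> Nb j * ((8 * sz e2 + 3) * ?P (\<lambda>k. deg k e2))" by (rule mult_le_mono2)
      also have "\<dots> = (8 * sz e2 + 3) * (Nb j * ?P (\<lambda>k. deg k e2))" by (simp only: ac_simps)
      also have "\<dots> \<le> (8 * sz e2 + 3) * ?M" by (rule m)
      finally show ?thesis by (simp only: add_mult_distrib)
    qed
    ultimately show ?case using P1[of "\<lambda>k. deg k (XFold j e e1 e2)"] unfolding tb.simps sz.simps
      by (simp only: add_mult_distrib add_mult_distrib2)
  }
qed simp_all

section \<open>Uniform step costs and correctness of compiled expressions\<close>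

lemma bits_le: "n < 2 ^ B \<Longrightarrow> bits n \<le> B"
  by (simp add: floorlog_le_iff)

lemma bits_le_self: "bits n \<le> n"
  by (rule bits_le) simp

locale space =
  fixes S B :: nat
begin

definition fits :: "mem \<Rightarrow> bool" where
  "fits s \<longleftrightarrow> (\<forall>a i. s a i \<noteq> 0 \<longrightarrow> a < 9 \<and> i < S \<and> s a i < 2 ^ B)"

text \<open>A crude uniform charge for one elementary step: it involves a bounded number of
  addresses, whose bit lengths are at most the addresses themselves and thus at most
  \<open>S\<close>, and of values below \<open>2 ^ B\<close>. \<open>W\<close> adds this charge to
  the size of nine full arrays of \<open>S\<close> cells.\<close>

definition U :: nat where "U = 10 * (S + B + 1)"
definition W :: nat where "W = 9 * S * (1 + S + B) + U"

definition runs :: "com \<Rightarrow> mem \<Rightarrow> nat \<Rightarrow> mem \<Rightarrow> bool" where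
  "runs p s n s' \<longleftrightarrow> (\<exists>t w. exec p s t w s' \<and> t \<le> n * U \<and> w \<le> W)"

lemma fits_val: "fits s \<Longrightarrow> s a i < 2 ^ B"
  by (cases "s a i = 0") (auto simp: fits_def)

lemma fits_bits: "fits s \<Longrightarrow> bits (s a i) \<le> B"
  by (intro bits_le fits_val)

lemma fits_put: "fits s \<Longrightarrow> a < 9 \<Longrightarrow> i < S \<Longrightarrow> v < 2 ^ B \<Longrightarrow> fits (s(a := (s a)(i := v)))"
  by (auto simp: fits_def split: if_splits)

lemma mem_size_le:
  assumes "fits s"
  shows "mem_size s \<le> 9 * S * (1 + S + B)"
proof -
  have sub: "{(a, i). s a i \<noteq> 0} \<subseteq> {..<9} \<times> {..<S}" using assms by (auto simp: fits_def)
  have "mem_size s \<le> (\<Sum>x\<in>{(a, i). s a i \<noteq> 0}. 1 + S + B)"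
    unfolding mem_size_def
  proof (rule sum_mono)
    fix x assume "x \<in> {(a, i). s a i \<noteq> 0}"
    then obtain a i where x: "x = (a, i)" "s a i \<noteq> 0" by auto
    then have "i < S" using assms by (auto simp: fits_def)
    then have "bits i \<le> S" using bits_le_self[of i] by linarith
    then show "(case x of (a, i) \<Rightarrow> 1 + bits i + bits (s a i)) \<le> 1 + S + B"
      using x fits_bits[OF assms, of a i] by simp
  qed
  also have "\<dots> \<le> (\<Sum>x\<in>{..<9::nat} \<times> {..<S}. 1 + S + B)"
    by (rule sum_mono2) (use sub in auto)
  also have "\<dots> = 9 * S * (1 + S + B)" by (simp add: card_cartesian_product)
  finally show ?thesis .
qed

lemma runs_Put:
  assumes "fits s" "1 + cost s e1 + cost s e2 \<le> U"
  shows "runs (Put a e1 e2) s 1 (s(a := (s a)(val s e1 := val s e2)))"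
  unfolding runs_def
  using exec.Put[OF refl, where s = s and ?e1.0 = e1 and ?e2.0 = e2 and a = a] assms mem_size_le[OF assms(1)]
  by (force simp: W_def)

lemma runs_Seq:
  assumes "runs p1 s n1 s1" "runs p2 s1 n2 s2"
  shows "runs (Seq p1 p2) s (n1 + n2) s2"
proof -
  obtain t1 w1 t2 w2 where "exec p1 s t1 w1 s1" "t1 \<le> n1 * U" "w1 \<le> W"
    "exec p2 s1 t2 w2 s2" "t2 \<le> n2 * U" "w2 \<le> W"
    using assms by (auto simp: runs_def)
  then show ?thesis unfolding runs_def
    by (intro exI[of _ "t1 + t2"] exI[of _ "max w1 w2"] conjI exec.Seq)
      (auto simp: add_mult_distrib)
qed

lemma runs_mono: "runs p s n s' \<Longrightarrow> n \<le> n' \<Longrightarrow> runs p s n' s'"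
  unfolding runs_def by (meson le_trans mult_le_mono1)

lemma runs_Cond:
  assumes "fits s" "1 + cost s e \<le> U" "runs (if val s e \<noteq> 0 then p1 else p2) s n s'"
  shows "runs (Cond e p1 p2) s (n + 1) s'"
proof -
  obtain t w where e: "exec (if val s e \<noteq> 0 then p1 else p2) s t w s'" "t \<le> n * U" "w \<le> W"
    using assms(3) by (auto simp: runs_def)
  let ?k = "1 + cost s e"
  have "exec (Cond e p1 p2) s (?k + t) (max (mem_size s + ?k) w) s'"
    using exec.CondTrue[OF _ refl, of s e p1 t w s' p2] exec.CondFalse[OF _ refl, of s e p2 t w s' p1] e(1)
    by (cases "val s e = 0") auto
  then show ?thesis unfolding runs_def
    using e assms mem_size_le[OF assms(1)]
    by (intro exI[of _ "?k + t"] exI[of _ "max (mem_size s + ?k) w"]) (auto simp: W_def)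
qed

text \<open>The number of iterations is known in advance, so the invariant is indexed by the
  iteration and the induction runs over the iterations that remain.\<close>

lemma runs_While:
  assumes step: "\<And>i s. i < n \<Longrightarrow> I i s \<Longrightarrow>
      fits s \<and> 1 + cost s e \<le> U \<and> val s e \<noteq> 0 \<and> (\<exists>s'. runs p s nb s' \<and> I (Suc i) s')"
    and fin: "\<And>s. I n s \<Longrightarrow> fits s \<and> 1 + cost s e \<le> U \<and> val s e = 0"
    and "I 0 s"
  shows "\<exists>s'. runs (While e p) s (n * (nb + 1) + 1) s' \<and> I n s'"
proof -
  have "\<exists>s'. runs (While e p) s (j * (nb + 1) + 1) s' \<and> I n s'" if "j \<le> n" "I (n - j) s" for j s
    using that
  proof (induction j arbitrary: s)
    case 0
    then have f: "fits s" "1 + cost s e \<le> U" "val s e = 0" using fin[of s] by auto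
    have "exec (While e p) s (1 + cost s e) (mem_size s + (1 + cost s e)) s"
      by (rule exec.WhileFalse[OF f(3) refl])
    then have "runs (While e p) s 1 s"
      using f mem_size_le[OF f(1)] by (force simp: runs_def W_def)
    then show ?case using 0 by auto
  next
    case (Suc j)
    then have j: "n - Suc j < n" "Suc (n - Suc j) = n - j" by auto
    from step[OF j(1) Suc.prems(2)] obtain s1 where f: "fits s" "1 + cost s e \<le> U" "val s e \<noteq> 0"
      and r: "runs p s nb s1" and I: "I (n - j) s1" unfolding j by blast
    from Suc.IH[OF _ I] Suc.prems obtain s2 where
      r2: "runs (While e p) s1 (j * (nb + 1) + 1) s2" and I2: "I n s2" by auto
    obtain t1 w1 t2 w2 where b: "exec p s t1 w1 s1" "t1 \<le> nb * U" "w1 \<le> W"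
      "exec (While e p) s1 t2 w2 s2" "t2 \<le> (j * (nb + 1) + 1) * U" "w2 \<le> W"
      using r r2 by (auto simp: runs_def)
    let ?k = "1 + cost s e"
    have "exec (While e p) s (?k + t1 + t2) (max (mem_size s + ?k) (max w1 w2)) s2"
      by (rule exec.WhileTrue[OF f(3) refl b(1) b(4)])
    moreover have "?k + t1 + t2 \<le> (Suc j * (nb + 1) + 1) * U"
      using b f by (simp add: algebra_simps)
    moreover have "max (mem_size s + ?k) (max w1 w2) \<le> W"
      using b f mem_size_le[OF f(1)] by (simp add: W_def)
    ultimately show ?case using I2 unfolding runs_def by blast
  qed
  from this[of n s] assms(3) show ?thesis by simp
qed

lemma cost_Lit: "cost s (Lit n) \<le> 1 + n"
  using bits_le_self[of n] by simp

lemma cost_Get: "fits s \<Longrightarrow> cost s (Get a (Lit n)) \<le> 2 + n + B"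
  using bits_le_self[of n] fits_bits[of s a n] by auto

text \<open>Subexpressions compose because the cells below \<open>length vs\<close> in array 7 and
  those below \<open>K\<close> in array 8 survive. The room \<open>4 * sz e\<close> is consumed by
  folds, whose body is compiled two cells higher in both arrays.\<close>

lemma compile_correct:
  assumes "good s0 Nb B e vs" and "fits s" and "\<forall>a<5. s a = s0 a"
    and "\<forall>v<length vs. s 7 v = vs ! v" and "length vs + K + 4 * sz e \<le> S" and "1 \<le> B"
  shows "\<exists>s'. runs (compile e (length vs) K) s (tb Nb e) s' \<and> fits s' \<and>
    (\<forall>a. a \<noteq> 7 \<and> a \<noteq> 8 \<longrightarrow> s' a = s a) \<and> (\<forall>v<length vs. s' 7 v = vs ! v) \<and>
    (\<forall>j<K. s' 8 j = s 8 j) \<and> s' 8 K = den s0 e vs"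
  using assms
proof (induction e arbitrary: vs s K)
  case (XLit n)
  have "1 + cost s (Lit K) + cost s (Lit n) \<le> U"
    using XLit.prems cost_Lit[of s K] bits_le[of n B] by (simp add: U_def)
  from runs_Put[OF XLit.prems(2) this, of 8] show ?case
    using XLit.prems by (auto intro!: exI fits_put)
next
  case (XVar v)
  have "1 + cost s (Lit K) + cost s (Get 7 (Lit v)) \<le> U"
    using XVar.prems cost_Lit[of s K] cost_Get[of s 7 v] by (simp add: U_def)
  from runs_Put[OF XVar.prems(2) this, of 8] show ?case
    using XVar.prems fits_val[OF XVar.prems(2), of 7 v] by (auto intro!: exI fits_put)
next
  case (XGet a e)
  from XGet.prems XGet.IH[of vs s K] obtain s1 where
    1: "runs (compile e (length vs) K) s (tb Nb e) s1" "fits s1"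
    "\<And>a. a \<noteq> 7 \<Longrightarrow> a \<noteq> 8 \<Longrightarrow> s1 a = s a" "\<And>v. v < length vs \<Longrightarrow> s1 7 v = vs ! v"
    "\<And>j. j < K \<Longrightarrow> s1 8 j = s 8 j" "s1 8 K = den s0 e vs"
    by auto
  have "1 + cost s1 (Lit K) + cost s1 (Get a (Get 8 (Lit K))) \<le> U"
    using XGet.prems cost_Lit[of s1 K] cost_Get[of s1 8 K] 1(2) fits_bits[OF 1(2), of a "s1 8 K"]
    by (simp add: U_def)
  from runs_Seq[OF 1(1) runs_Put[OF 1(2) this, of 8]] show ?case
    using XGet.prems 1 fits_val[OF 1(2), of a "s1 8 K"] by (auto intro!: exI fits_put)
next
  case (XBin f e1 e2)
  from XBin.prems XBin.IH(1)[of vs s K] obtain s1 where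
    1: "runs (compile e1 (length vs) K) s (tb Nb e1) s1" "fits s1"
    "\<And>a. a \<noteq> 7 \<Longrightarrow> a \<noteq> 8 \<Longrightarrow> s1 a = s a" "\<And>v. v < length vs \<Longrightarrow> s1 7 v = vs ! v"
    "\<And>j. j < K \<Longrightarrow> s1 8 j = s 8 j" "s1 8 K = den s0 e1 vs"
    by auto
  from XBin.prems 1 XBin.IH(2)[of vs s1 "K + 1"] obtain s2 where
    2: "runs (compile e2 (length vs) (K + 1)) s1 (tb Nb e2) s2" "fits s2"
    "\<And>a. a \<noteq> 7 \<Longrightarrow> a \<noteq> 8 \<Longrightarrow> s2 a = s1 a" "\<And>v. v < length vs \<Longrightarrow> s2 7 v = vs ! v"
    "\<And>j. j < K + 1 \<Longrightarrow> s2 8 j = s1 8 j" "s2 8 (K + 1) = den s0 e2 vs"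
    by auto
  have K: "s2 8 K = den s0 e1 vs" using 1(6) 2(5)[of K] by simp
  \<comment> \<open>Subtraction, division and remainder never exceed the first operand, truth values
    fit since \<open>1 \<le> B\<close>, and \<open>good\<close> covers the rest.\<close>
  have v: "bin_val f (den s0 e1 vs) (den s0 e2 vs) < 2 ^ B"
  proof -
    have a: "den s0 e1 vs < 2 ^ B"
      using K fits_val[OF 2(2), of 8 K] by simp
    have "of_bool c < (2 :: nat) ^ B" for c
      using \<open>1 \<le> B\<close> one_less_power[of "2 :: nat" B] by simp
    then show ?thesis using XBin.prems(1) a
        le_less_trans[OF div_le_dividend a] le_less_trans[OF mod_less_eq_dividend a]
      by (cases f) (auto simp: less_imp_diff_less)
  qed
  let ?e = "Bin f (Get 8 (Lit K)) (Get 8 (Lit (K + 1)))"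
  have "1 + cost s2 (Lit K) + cost s2 ?e \<le> U"
    using XBin.prems cost_Lit[of s2 K] cost_Get[of s2 8 K] cost_Get[of s2 8 "K + 1"] 2(2)
      bits_le[OF v] K 2(6)
    by (simp add: U_def)
  from runs_Seq[OF 1(1) runs_Seq[OF 2(1) runs_Put[OF 2(2) this, of 8]]] show ?case
    using XBin.prems 1 2 K v by (auto intro!: exI fits_put simp: add.assoc)
next
  case (XIf e e1 e2)
  from XIf.prems XIf.IH(1)[of vs s K] obtain s1 where
    1: "runs (compile e (length vs) K) s (tb Nb e) s1" "fits s1"
    "\<And>a. a \<noteq> 7 \<Longrightarrow> a \<noteq> 8 \<Longrightarrow> s1 a = s a" "\<And>v. v < length vs \<Longrightarrow> s1 7 v = vs ! v"
    "\<And>j. j < K \<Longrightarrow> s1 8 j = s 8 j" "s1 8 K = den s0 e vs"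
    by auto
  have c: "1 + cost s1 (Get 8 (Lit K)) \<le> U"
    using XIf.prems cost_Get[of s1 8 K] 1(2) by (simp add: U_def)
  define e' where "e' = (if den s0 e vs \<noteq> 0 then e1 else e2)"
  have "\<exists>s'. runs (compile e' (length vs) K) s1 (tb Nb e') s' \<and> fits s' \<and>
    (\<forall>a. a \<noteq> 7 \<and> a \<noteq> 8 \<longrightarrow> s' a = s1 a) \<and> (\<forall>v<length vs. s' 7 v = vs ! v) \<and>
    (\<forall>j<K. s' 8 j = s1 8 j) \<and> s' 8 K = den s0 e' vs"
    using XIf.prems 1 XIf.IH(2)[of vs s1 K] XIf.IH(3)[of vs s1 K] by (simp add: e'_def)
  then obtain s2 where
    2: "runs (compile e' (length vs) K) s1 (tb Nb e') s2" "fits s2"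
    "\<And>a. a \<noteq> 7 \<Longrightarrow> a \<noteq> 8 \<Longrightarrow> s2 a = s1 a" "\<And>v. v < length vs \<Longrightarrow> s2 7 v = vs ! v"
    "\<And>j. j < K \<Longrightarrow> s2 8 j = s1 8 j" "s2 8 K = den s0 e' vs"
    by blast
  have "runs (Cond (Get 8 (Lit K)) (compile e1 (length vs) K) (compile e2 (length vs) K)) s1 (tb Nb e' + 1) s2"
    using 2(1) 1(6) by (intro runs_Cond[OF 1(2) c]) (auto simp: e'_def split: if_splits)
  from runs_Seq[OF 1(1) this] have "runs (compile (XIf e e1 e2) (length vs) K) s (tb Nb (XIf e e1 e2)) s2"
    unfolding compile.simps by (rule runs_mono) (simp add: e'_def)
  then show ?case using 1 2 by (intro exI[of _ s2]) (auto simp: e'_def)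
next
  case (XFold k n e1 e2)
  define L where "L = length vs"
  have sp: "L + K + 4 * sz n + 4 * sz e1 + 4 * sz e2 + 4 \<le> S" using XFold.prems by (simp add: L_def)
  from XFold.prems XFold.IH(2)[of vs s K] obtain s1 where
    1: "runs (compile e1 L K) s (tb Nb e1) s1" "fits s1"
    "\<And>a. a \<noteq> 7 \<Longrightarrow> a \<noteq> 8 \<Longrightarrow> s1 a = s a" "\<And>v. v < length vs \<Longrightarrow> s1 7 v = vs ! v"
    "\<And>j. j < K \<Longrightarrow> s1 8 j = s 8 j" "s1 8 K = den s0 e1 vs"
    by (auto simp: L_def)
  from XFold.prems 1 XFold.IH(1)[of vs s1 "K + 1"] obtain s2 where
    2: "runs (compile n L (K + 1)) s1 (tb Nb n) s2" "fits s2"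
    "\<And>a. a \<noteq> 7 \<Longrightarrow> a \<noteq> 8 \<Longrightarrow> s2 a = s1 a" "\<And>v. v < length vs \<Longrightarrow> s2 7 v = vs ! v"
    "\<And>j. j < K + 1 \<Longrightarrow> s2 8 j = s1 8 j" "s2 8 (K + 1) = den s0 n vs"
    by (auto simp: L_def)
  have K: "s2 8 K = den s0 e1 vs" using 1(6) 2(5)[of K] by simp
  have c3: "1 + cost s2 (Lit L) + cost s2 (Get 8 (Lit K)) \<le> U"
    using sp cost_Lit[of s2 L] cost_Get[of s2 8 K] 2(2) by (simp add: U_def)
  define s3 where "s3 = s2(7 := (s2 7)(L := den s0 e1 vs))"
  have r3: "runs (Put 7 (Lit L) (Get 8 (Lit K))) s2 1 s3"
    using runs_Put[OF 2(2) c3, of 7] K by (simp add: s3_def)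
  have i3: "fits s3" unfolding s3_def K[symmetric]
    by (rule fits_put) (use 2(2) sp fits_val in auto)
  have c4: "1 + cost s3 (Lit (L + 1)) + cost s3 (Lit 0) \<le> U"
    using sp cost_Lit[of s3 "L + 1"] cost_Lit[of s3 0] by (simp add: U_def)
  define s4 where "s4 = s3(7 := (s3 7)(L + 1 := 0))"
  have r4: "runs (Put 7 (Lit (L + 1)) (Lit 0)) s3 1 s4"
    using runs_Put[OF i3 c4, of 7] by (simp add: s4_def)
  have i4: "fits s4" unfolding s4_def by (rule fits_put) (use i3 sp in auto)
  define m where "m = den s0 n vs"
  define x where "x = (\<lambda>j. itr (\<lambda>i x. den s0 e2 (vs @ [x, i])) j (den s0 e1 vs))"
  define I where "I = (\<lambda>j s'. fits s' \<and> (\<forall>a. a \<noteq> 7 \<and> a \<noteq> 8 \<longrightarrow> s' a = s a) \<and>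
    (\<forall>v<L. s' 7 v = vs ! v) \<and> s' 7 L = x j \<and> s' 7 (L + 1) = j \<and> (\<forall>j<K. s' 8 j = s 8 j) \<and>
    s' 8 (K + 1) = m)"
  let ?c = "Bin OpLess (Get 7 (Lit (L + 1))) (Get 8 (Lit (K + 1)))"
  let ?b = "Seq (compile e2 (L + 2) (K + 2)) (Seq (Put 7 (Lit L) (Get 8 (Lit (K + 2))))
                   (Put 7 (Lit (L + 1)) (Bin OpAdd (Get 7 (Lit (L + 1))) (Lit 1))))"
  have m: "m < 2 ^ B" using 2(6) fits_val[OF 2(2), of 8 "K + 1"] by (simp add: m_def)
  have cc: "1 + cost s ?c \<le> U" if "fits s" for s
  proof -
    have "bits (of_bool (s 7 (L + 1) < s 8 (K + 1))) \<le> 1"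
      using bits_le_self[of "of_bool (s 7 (L + 1) < s 8 (K + 1))"] by (auto split: if_splits)
    then show ?thesis using that sp cost_Get[of s 7 "L + 1"] cost_Get[of s 8 "K + 1"]
      by (simp add: U_def)
  qed
  have "\<exists>s'. runs (While ?c ?b) s4 (m * ((tb Nb e2 + 2) + 1) + 1) s' \<and> I m s'"
    (is "\<exists>s'. runs _ _ ?n s' \<and> _")
  proof (rule runs_While)
    show "I 0 s4" unfolding I_def
      using i4 1 2 by (auto simp: s4_def s3_def x_def m_def L_def)
  next
    fix s' assume "I m s'"
    then show "fits s' \<and> 1 + cost s' ?c \<le> U \<and> val s' ?c = 0"
      using cc[of s'] by (auto simp: I_def)
  next
    fix i t assume i: "i < m" and I: "I i t"
    let ?vs = "vs @ [x i, i]"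
    have g: "good s0 Nb B e2 ?vs" using XFold.prems(1) i by (simp add: x_def m_def)
    have tv: "\<forall>v<length ?vs. t 7 v = ?vs ! v"
      using I by (auto simp: I_def L_def nth_append less_Suc_eq)
    have ts: "\<forall>a<5. t a = s0 a" using I XFold.prems(3) by (auto simp: I_def)
    have "\<exists>s'. runs (compile e2 (length ?vs) (K + 2)) t (tb Nb e2) s' \<and> fits s' \<and>
       (\<forall>a. a \<noteq> 7 \<and> a \<noteq> 8 \<longrightarrow> s' a = t a) \<and> (\<forall>v<length ?vs. s' 7 v = ?vs ! v) \<and>
       (\<forall>j<K + 2. s' 8 j = t 8 j) \<and> s' 8 (K + 2) = den s0 e2 ?vs"
      by (rule XFold.IH(3)[OF g _ ts tv]) (use I sp \<open>1 \<le> B\<close> in \<open>auto simp: I_def L_def\<close>)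
    then obtain t1 where
      t1: "runs (compile e2 (L + 2) (K + 2)) t (tb Nb e2) t1" "fits t1"
       "\<And>a. a \<noteq> 7 \<Longrightarrow> a \<noteq> 8 \<Longrightarrow> t1 a = t a" "\<And>v. v < length ?vs \<Longrightarrow> t1 7 v = ?vs ! v"
       "\<And>j. j < K + 2 \<Longrightarrow> t1 8 j = t 8 j" "t1 8 (K + 2) = x (Suc i)"
      by (auto simp: L_def x_def)
    have d1: "1 + cost t1 (Lit L) + cost t1 (Get 8 (Lit (K + 2))) \<le> U"
      using sp cost_Lit[of t1 L] cost_Get[of t1 8 "K + 2"] t1(2) by (simp add: U_def)
    define t2 where "t2 = t1(7 := (t1 7)(L := x (Suc i)))"
    have r2: "runs (Put 7 (Lit L) (Get 8 (Lit (K + 2)))) t1 1 t2"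
      using runs_Put[OF t1(2) d1, of 7] t1(6) by (simp add: t2_def)
    have i2: "fits t2" unfolding t2_def t1(6)[symmetric]
      by (rule fits_put) (use t1(2) sp fits_val in auto)
    have v2: "t2 7 (L + 1) = i" using t1(4)[of "L + 1"] by (simp add: t2_def L_def nth_append)
    have si: "Suc i < 2 ^ B" using i m by simp
    have "S \<ge> 1" "B \<ge> 1" using sp i m by (cases B; simp)+
    then have d2: "1 + cost t2 (Lit (L + 1)) + cost t2 (Bin OpAdd (Get 7 (Lit (L + 1))) (Lit 1)) \<le> U"
      using sp cost_Lit[of t2 "L + 1"] cost_Get[of t2 7 "L + 1"] i2 bits_le[OF si] bits_le_self[of 1] v2
      by (simp add: U_def)
    define t3 where "t3 = t2(7 := (t2 7)(L + 1 := Suc i))"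
    have r3: "runs (Put 7 (Lit (L + 1)) (Bin OpAdd (Get 7 (Lit (L + 1))) (Lit 1))) t2 1 t3"
      using runs_Put[OF i2 d2, of 7] v2 by (simp add: t3_def)
    have i3: "fits t3" unfolding t3_def by (rule fits_put) (use i2 sp si in auto)
    have "runs ?b t (tb Nb e2 + 2) t3"
      using runs_Seq[OF t1(1) runs_Seq[OF r2 r3]] by simp
    moreover have "I (Suc i) t3" using I i3 t1 unfolding I_def
      by (auto simp: t3_def t2_def L_def nth_append)
    ultimately show "fits t \<and> 1 + cost t ?c \<le> U \<and> val t ?c \<noteq> 0 \<and>
        (\<exists>s'. runs ?b t (tb Nb e2 + 2) s' \<and> I (Suc i) s')"
      using I cc[of t] i by (auto simp: I_def)
  qed
  then obtain s5 where r5: "runs (While ?c ?b) s4 ?n s5" and I5: "I m s5"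
    by blast
  have i5: "fits s5" using I5 by (simp add: I_def)
  have c6: "1 + cost s5 (Lit K) + cost s5 (Get 7 (Lit L)) \<le> U"
    using sp cost_Lit[of s5 K] cost_Get[of s5 7 L] i5 by (simp add: U_def)
  define s6 where "s6 = s5(8 := (s5 8)(K := s5 7 L))"
  have r6: "runs (Put 8 (Lit K) (Get 7 (Lit L))) s5 1 s6"
    using runs_Put[OF i5 c6, of 8] by (simp add: s6_def)
  have i6: "fits s6" unfolding s6_def by (rule fits_put) (use i5 sp fits_val in auto)
  have mN: "m \<le> Nb k" using XFold.prems(1) by (simp add: m_def)
  then have le: "m * ((tb Nb e2 + 2) + 1) \<le> Nb k * (tb Nb e2 + 3)" by (intro mult_le_mono) auto
  have "runs (compile (XFold k n e1 e2) L K) s (tb Nb (XFold k n e1 e2)) s6"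
    unfolding compile.simps
    by (rule runs_mono[OF runs_Seq[OF 1(1) runs_Seq[OF 2(1) runs_Seq[OF r3 runs_Seq[OF r4
          runs_Seq[OF r5 r6]]]]]], unfold tb.simps, use le in linarith)
  moreover have "\<forall>a. a \<noteq> 7 \<and> a \<noteq> 8 \<longrightarrow> s6 a = s a" "\<forall>v<L. s6 7 v = vs ! v" "\<forall>j<K. s6 8 j = s 8 j"
    "s6 8 K = den s0 (XFold k n e1 e2) vs"
    using I5 by (auto simp: I_def s6_def x_def m_def)
  ultimately show ?case using i6 unfolding L_def by blast
qed

end

section \<open>Linear algebra over a field\<close>

context field
begin

abbreviation lc :: "nat \<Rightarrow> (nat \<Rightarrow> 'a) \<Rightarrow> (nat \<Rightarrow> nat \<Rightarrow> 'a) \<Rightarrow> nat \<Rightarrow> 'a" where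
  "lc n y f p \<equiv> (\<Oplus>k\<in>{..<n}. y k \<otimes> f k p)"

lemma sm_Suc:
  "(\<And>k. k < Suc n \<Longrightarrow> f k \<in> carrier R) \<Longrightarrow>
    (\<Oplus>k\<in>{..<Suc n}. f k) = (\<Oplus>k\<in>{..<n::nat}. f k) \<oplus> f n"
  unfolding lessThan_Suc by (subst finsum_insert) (auto intro!: add.m_comm finsum_closed)

lemma sm_cong:
  "(\<And>k. k < n \<Longrightarrow> f k = g k) \<Longrightarrow> (\<And>k. k < n \<Longrightarrow> g k \<in> carrier R) \<Longrightarrow>
    (\<Oplus>k\<in>{..<n::nat}. f k) = (\<Oplus>k\<in>{..<n::nat}. g k)"
  by (rule finsum_cong') auto

lemma sm_closed [simp, intro]:
  "(\<And>k. k < n \<Longrightarrow> f k \<in> carrier R) \<Longrightarrow> (\<Oplus>k\<in>{..<n::nat}. f k) \<in> carrier R"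
  by (rule finsum_closed) auto

lemma sm_zero: "(\<And>k. k < n \<Longrightarrow> f k = \<zero>) \<Longrightarrow> (\<Oplus>k\<in>{..<n::nat}. f k) = \<zero>"
  by (rule add.finprod_one_eqI) auto

lemma sm_delta:
  assumes "i < n" "x \<in> carrier R"
  shows "(\<Oplus>k\<in>{..<n::nat}. if k = i then x else \<zero>) = x"
  using add.finprod_singleton[of i "{..<n}" "\<lambda>_. x"] assms
  by (simp add: eq_commute[of i])

lemma sm_add:
  "(\<And>k. f k \<in> carrier R) \<Longrightarrow> (\<And>k. g k \<in> carrier R) \<Longrightarrow>
    (\<Oplus>k\<in>{..<n::nat}. f k \<oplus> g k) = (\<Oplus>k\<in>{..<n::nat}. f k) \<oplus> (\<Oplus>k\<in>{..<n::nat}. g k)"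
  by (rule finsum_addf) auto

lemma sm_mult:
  "(\<And>k. f k \<in> carrier R) \<Longrightarrow> a \<in> carrier R \<Longrightarrow>
    a \<otimes> (\<Oplus>k\<in>{..<n::nat}. f k) = (\<Oplus>k\<in>{..<n::nat}. a \<otimes> f k)"
  by (rule finsum_rdistr) auto

lemma sm_mult_right:
  "(\<And>k. f k \<in> carrier R) \<Longrightarrow> a \<in> carrier R \<Longrightarrow>
    (\<Oplus>k\<in>{..<n::nat}. f k) \<otimes> a = (\<Oplus>k\<in>{..<n::nat}. f k \<otimes> a)"
  by (rule finsum_ldistr) auto

lemma sm_swap:
  assumes "\<And>i j. f i j \<in> carrier R"
  shows "(\<Oplus>i\<in>{..<m::nat}. \<Oplus>j\<in>{..<n::nat}. f i j) = (\<Oplus>j\<in>{..<n::nat}. \<Oplus>i\<in>{..<m::nat}. f i j)"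
proof (induction m)
  case 0
  then show ?case by (simp add: sm_zero)
next
  case (Suc m)
  have "(\<Oplus>j\<in>{..<n::nat}. \<Oplus>i\<in>{..<Suc m}. f i j) = (\<Oplus>j\<in>{..<n::nat}. (\<Oplus>i\<in>{..<m::nat}. f i j) \<oplus> f m j)"
    by (rule sm_cong) (auto simp: assms sm_Suc simp del: lessThan_Suc)
  then show ?case using Suc by (simp add: sm_Suc sm_add assms del: lessThan_Suc)
qed

text \<open>Associativity of vector times matrix times matrix, read in column \<open>p\<close>. It
  carries every substitution of one linear combination into another.\<close>

lemma lc_lc:
  fixes m :: nat
  assumes "\<And>k. y k \<in> carrier R" "\<And>k j. c k j \<in> carrier R" "\<And>j. g j p \<in> carrier R"
  shows "lc n (\<lambda>j. \<Oplus>k\<in>{..<m}. y k \<otimes> c k j) g p = (\<Oplus>k\<in>{..<m}. y k \<otimes> lc n (c k) g p)"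
proof -
  have "lc n (\<lambda>j. \<Oplus>k\<in>{..<m}. y k \<otimes> c k j) g p
      = (\<Oplus>j\<in>{..<n}. \<Oplus>k\<in>{..<m}. y k \<otimes> (c k j \<otimes> g j p))"
  proof (rule sm_cong)
    fix j
    show "(\<Oplus>k\<in>{..<m}. y k \<otimes> c k j) \<otimes> g j p = (\<Oplus>k\<in>{..<m}. y k \<otimes> (c k j \<otimes> g j p))"
      using sm_mult_right[of "\<lambda>k. y k \<otimes> c k j" "g j p" m] by (simp add: assms m_assoc)
  qed (auto simp: assms)
  also have "\<dots> = (\<Oplus>k\<in>{..<m}. \<Oplus>j\<in>{..<n}. y k \<otimes> (c k j \<otimes> g j p))"
    by (rule sm_swap) (auto simp: assms)
  also have "\<dots> = (\<Oplus>k\<in>{..<m}. y k \<otimes> lc n (c k) g p)"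
    by (rule sm_cong) (auto simp: assms sm_mult)
  finally show ?thesis .
qed

subsection \<open>Null spaces\<close>

definition null :: "nat \<Rightarrow> (nat \<Rightarrow> nat \<Rightarrow> 'a) \<Rightarrow> nat \<Rightarrow> (nat \<Rightarrow> 'a) \<Rightarrow> bool" where
  "null n g m y \<longleftrightarrow> (\<forall>p<m. lc n y g p = \<zero>)"

text \<open>\<open>Y\<close> is a projection of row vectors onto the common kernel of the first \<open>m\<close> functionals.\<close>

definition nproj :: "nat \<Rightarrow> (nat \<Rightarrow> nat \<Rightarrow> 'a) \<Rightarrow> nat \<Rightarrow> (nat \<Rightarrow> nat \<Rightarrow> 'a) \<Rightarrow> bool" where
  "nproj n g m Y \<longleftrightarrow> (\<forall>k<n. null n g m (Y k)) \<and>
     (\<forall>z. (\<forall>k. z k \<in> carrier R) \<longrightarrow> null n g m z \<longrightarrow>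
       (\<forall>j<n. (\<Oplus>k\<in>{..<n}. z k \<otimes> Y k j) = z j))"

lemma nproj_0:
  assumes "\<And>k j. k < n \<Longrightarrow> j < n \<Longrightarrow> Y k j = (if k = j then \<one> else \<zero>)"
  shows "nproj n g 0 Y"
proof -
  have "(\<Oplus>k\<in>{..<n}. z k \<otimes> Y k j) = z j" if "\<forall>k. z k \<in> carrier R" "j < n" for z j
  proof -
    have "(\<Oplus>k\<in>{..<n}. z k \<otimes> Y k j) = (\<Oplus>k\<in>{..<n}. if k = j then z j else \<zero>)"
      by (rule sm_cong) (use that assms in auto)
    then show ?thesis using that by (simp add: sm_delta)
  qed
  then show ?thesis by (auto simp: nproj_def null_def)
qed

lemma nproj_skip:
  assumes "nproj n g m Y" "\<And>k. k < n \<Longrightarrow> lc n (Y k) g m = \<zero>"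
  shows "nproj n g (Suc m) Y"
  using assms by (auto simp: nproj_def null_def less_Suc_eq)

text \<open>An elimination step that keeps all rows; the multiplier of the pivot row is minus one,
  so this row becomes zero. Weighting the equations for \<open>\<mu>\<close> by a vector
  \<open>z\<close> of the new kernel shows that the weighted sum of the \<open>\<mu> k\<close> times
  the nonzero pivot value vanishes. Hence that sum is zero, and the correction by the pivot row does
  not affect \<open>z\<close>.\<close>

lemma nproj_step:
  assumes Y: "nproj n g m Y"
    and c: "\<And>k j. Y k j \<in> carrier R" "\<And>k p. g k p \<in> carrier R" "\<And>k. \<mu> k \<in> carrier R"
    and k0: "k0 < n" "lc n (Y k0) g m \<noteq> \<zero>"
    and \<mu>: "\<And>k. k < n \<Longrightarrow> lc n (Y k) g m \<oplus> \<mu> k \<otimes> lc n (Y k0) g m = \<zero>"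
    and Y': "\<And>k j. k < n \<Longrightarrow> j < n \<Longrightarrow> Y' k j = Y k j \<oplus> \<mu> k \<otimes> Y k0 j"
  shows "nproj n g (Suc m) Y'"
proof -
  have l: "lc n (Y' k) g p = lc n (Y k) g p \<oplus> \<mu> k \<otimes> lc n (Y k0) g p" if "k < n" for k p
  proof -
    have "lc n (Y' k) g p = (\<Oplus>j\<in>{..<n}. Y k j \<otimes> g j p \<oplus> \<mu> k \<otimes> (Y k0 j \<otimes> g j p))"
      by (rule sm_cong) (use that in \<open>auto simp: Y' c l_distr m_assoc\<close>)
    also have "\<dots> = lc n (Y k) g p \<oplus> \<mu> k \<otimes> lc n (Y k0) g p"
      by (simp add: sm_add sm_mult c)
    finally show ?thesis .
  qed
  have "null n g (Suc m) (Y' k)" if "k < n" for k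
    unfolding null_def
  proof (intro allI impI)
    fix p assume "p < Suc m"
    then consider "p < m" | "p = m" by linarith
    then show "lc n (Y' k) g p = \<zero>"
    proof cases
      case 1
      then have "lc n (Y k) g p = \<zero>" "lc n (Y k0) g p = \<zero>"
        using Y that k0 by (auto simp: nproj_def null_def)
      then show ?thesis using that by (simp add: l c)
    qed (use that \<mu> l in simp)
  qed
  moreover have "(\<Oplus>k\<in>{..<n}. z k \<otimes> Y' k j) = z j"
    if z: "\<forall>k. z k \<in> carrier R" "null n g (Suc m) z" and j: "j < n" for z j
  proof -
    have nz: "null n g m z" and zm: "lc n z g m = \<zero>" using z by (auto simp: null_def)
    have zY: "(\<Oplus>k\<in>{..<n}. z k \<otimes> Y k j) = z j" if "j < n" for j
      using Y z nz that by (auto simp: nproj_def)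
    let ?l = "\<lambda>k. lc n (Y k) g m"
    have "(\<Oplus>k\<in>{..<n}. z k \<otimes> ?l k) = lc n (\<lambda>j. \<Oplus>k\<in>{..<n}. z k \<otimes> Y k j) g m"
      by (rule lc_lc[symmetric]) (use z c in auto)
    also have "\<dots> = lc n z g m" by (rule sm_cong) (use z c zY in auto)
    finally have 0: "(\<Oplus>k\<in>{..<n}. z k \<otimes> ?l k) = \<zero>" using zm by simp
    have "(\<Oplus>k\<in>{..<n}. z k \<otimes> \<mu> k) \<otimes> ?l k0 = (\<Oplus>k\<in>{..<n}. z k \<otimes> ?l k \<oplus> z k \<otimes> \<mu> k \<otimes> ?l k0)"
      by (subst sm_add) (use z c 0 in \<open>auto simp: sm_mult_right\<close>)
    also have "\<dots> = (\<Oplus>k\<in>{..<n}. \<zero>)"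
    proof (rule sm_cong)
      fix k assume "k < n"
      have "z k \<otimes> ?l k \<oplus> z k \<otimes> \<mu> k \<otimes> ?l k0 = z k \<otimes> (?l k \<oplus> \<mu> k \<otimes> ?l k0)"
        using z c by (simp add: r_distr m_assoc)
      then show "z k \<otimes> ?l k \<oplus> z k \<otimes> \<mu> k \<otimes> ?l k0 = \<zero>" using \<mu> \<open>k < n\<close> z by simp
    qed auto
    finally have "(\<Oplus>k\<in>{..<n}. z k \<otimes> \<mu> k) \<otimes> ?l k0 = \<zero>" by (simp add: sm_zero)
    then have zm: "(\<Oplus>k\<in>{..<n}. z k \<otimes> \<mu> k) = \<zero>"
      using k0(2) z c by (subst (asm) integral_iff) auto
    have "(\<Oplus>k\<in>{..<n}. z k \<otimes> Y' k j) = (\<Oplus>k\<in>{..<n}. z k \<otimes> Y k j \<oplus> z k \<otimes> \<mu> k \<otimes> Y k0 j)"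
      by (rule sm_cong) (use j z in \<open>auto simp: Y' c r_distr m_assoc\<close>)
    also have "\<dots> = z j \<oplus> (\<Oplus>k\<in>{..<n}. z k \<otimes> \<mu> k) \<otimes> Y k0 j"
      by (subst sm_add) (use z c zY j in \<open>auto simp: sm_mult_right\<close>)
    finally show ?thesis using zm z c by simp
  qed
  ultimately show ?thesis by (auto simp: nproj_def)
qed

subsection \<open>Spans and exchange\<close>

definition inspan :: "nat \<Rightarrow> (nat \<Rightarrow> nat \<Rightarrow> 'a) \<Rightarrow> nat \<Rightarrow> (nat \<Rightarrow> 'a) \<Rightarrow> bool" where
  "inspan n f m x \<longleftrightarrow> (\<exists>c. (\<forall>k. c k \<in> carrier R) \<and> (\<forall>p<m. x p = lc n c f p))"

lemma inspan_base:
  assumes "r < n" "\<And>k p. f k p \<in> carrier R"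
  shows "inspan n f m (f r)"
proof -
  have "lc n (\<lambda>k. if k = r then \<one> else \<zero>) f p = f r p" for p
  proof -
    have "lc n (\<lambda>k. if k = r then \<one> else \<zero>) f p = (\<Oplus>k\<in>{..<n}. if k = r then f r p else \<zero>)"
      by (rule sm_cong) (use assms in auto)
    then show ?thesis using assms by (simp add: sm_delta)
  qed
  then show ?thesis unfolding inspan_def
    by (intro exI[of _ "\<lambda>k. if k = r then \<one> else \<zero>"]) auto
qed

lemma inspan_trans:
  assumes "inspan n g m x" "\<And>k. k < n \<Longrightarrow> inspan l f m (g k)" "\<And>k p. f k p \<in> carrier R"
  shows "inspan l f m x"
proof -
  obtain y where y: "\<And>k. y k \<in> carrier R" "\<And>p. p < m \<Longrightarrow> x p = lc n y g p"
    using assms(1) by (auto simp: inspan_def)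
  have "\<forall>k. \<exists>c. (\<forall>j. c j \<in> carrier R) \<and> (k < n \<longrightarrow> (\<forall>p<m. g k p = lc l c f p))"
  proof
    fix k show "\<exists>c. (\<forall>j. c j \<in> carrier R) \<and> (k < n \<longrightarrow> (\<forall>p<m. g k p = lc l c f p))"
      using assms(2)[of k] unfolding inspan_def by (cases "k < n") (blast, force)
  qed
  then obtain c where c: "\<And>k j. c k j \<in> carrier R"
    "\<And>k p. k < n \<Longrightarrow> p < m \<Longrightarrow> g k p = lc l (c k) f p" by metis
  have "x p = lc l (\<lambda>j. \<Oplus>k\<in>{..<n}. y k \<otimes> c k j) f p" if "p < m" for p
  proof -
    have "x p = (\<Oplus>k\<in>{..<n}. y k \<otimes> lc l (c k) f p)"
      unfolding y(2)[OF that] by (rule sm_cong) (use y c that assms(3) in auto)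
    then show ?thesis by (subst lc_lc) (use y c assms(3) in auto)
  qed
  then show ?thesis unfolding inspan_def
    by (intro exI[of _ "\<lambda>j. \<Oplus>k\<in>{..<n}. y k \<otimes> c k j"]) (use y c in auto)
qed

text \<open>\<open>\<mu>\<close> is \<open>-1 / y i\<close>. Adding
  \<open>a i \<otimes> \<mu>\<close> times the vanishing combination to the one with coefficients
  \<open>a\<close> cancels the share of \<open>f i\<close> and brings in \<open>x\<close>. These are
  the formulas by which the coefficients of the slices are updated.\<close>

lemma exchange:
  assumes c: "\<And>k. a k \<in> carrier R" "\<And>k. y k \<in> carrier R" "\<And>k p. f k p \<in> carrier R"
      "\<And>p. x p \<in> carrier R" "\<mu> \<in> carrier R"
    and i: "i < n" "\<one> \<oplus> y i \<otimes> \<mu> = \<zero>"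
    and rel: "lc n y f p \<oplus> x p = \<zero>"
  shows "lc n (\<lambda>r. if r = i then a i \<otimes> \<mu> else a r \<oplus> a i \<otimes> \<mu> \<otimes> y r) (f(i := x)) p = lc n a f p"
proof -
  have di: "a i \<otimes> \<mu> \<otimes> x p = a i \<otimes> f i p \<oplus> a i \<otimes> \<mu> \<otimes> (y i \<otimes> f i p) \<oplus> a i \<otimes> \<mu> \<otimes> x p"
  proof -
    have "a i \<otimes> f i p \<oplus> a i \<otimes> \<mu> \<otimes> (y i \<otimes> f i p) = a i \<otimes> f i p \<otimes> (\<one> \<oplus> y i \<otimes> \<mu>)"
      using c by (simp add: r_distr m_ac)
    then show ?thesis using i c by simp
  qed
  have "lc n (\<lambda>r. if r = i then a i \<otimes> \<mu> else a r \<oplus> a i \<otimes> \<mu> \<otimes> y r) (f(i := x)) p =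
    (\<Oplus>r\<in>{..<n}. a r \<otimes> f r p \<oplus> a i \<otimes> \<mu> \<otimes> (y r \<otimes> f r p) \<oplus>
       (if r = i then a i \<otimes> \<mu> \<otimes> x p else \<zero>))"
    by (rule sm_cong) (use c di in \<open>auto simp: l_distr m_assoc\<close>)
  also have "\<dots> = lc n a f p \<oplus> a i \<otimes> \<mu> \<otimes> lc n y f p \<oplus> a i \<otimes> \<mu> \<otimes> x p"
    using c i by (simp add: sm_add sm_delta sm_mult)
  also have "\<dots> = lc n a f p \<oplus> a i \<otimes> \<mu> \<otimes> (lc n y f p \<oplus> x p)"
    using c by (simp add: r_distr a_assoc)
  finally show ?thesis using rel c by simp
qed

lemma inspan_exchange:
  assumes c: "\<And>k. y k \<in> carrier R" "\<And>k p. f k p \<in> carrier R" "\<And>p. x p \<in> carrier R"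
    and i: "i < n" "y i \<noteq> \<zero>"
    and rel: "\<And>p. p < m \<Longrightarrow> x p = lc n y f p"
    and r: "r < n"
  shows "inspan n (f(i := x)) m (f r)"
proof (cases "r = i")
  case False
  then have "f r = (f(i := x)) r" by simp
  then show ?thesis using inspan_base[OF r, of "f(i := x)" m] c by auto
next
  case True
  \<comment> \<open>The signs are flipped to bring the expansion of \<open>x\<close> into the form
    of a vanishing sum that \<open>exchange\<close> expects.\<close>
  let ?y = "\<lambda>k. \<ominus> y k"
  have U: "y i \<in> Units R" using i c by (simp add: field_Units)
  define \<mu> where "\<mu> = m_inv R (y i)"
  have \<mu>: "\<mu> \<in> carrier R" "y i \<otimes> \<mu> = \<one>" using U by (auto simp: \<mu>_def)
  let ?a = "\<lambda>k. if k = i then \<one> else \<zero>"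
  let ?b = "\<lambda>r. if r = i then ?a i \<otimes> \<mu> else ?a r \<oplus> ?a i \<otimes> \<mu> \<otimes> ?y r"
  have "f i p = lc n ?b (f(i := x)) p" if "p < m" for p
  proof -
    have "\<one> \<oplus> ?y i \<otimes> \<mu> = \<zero>" using \<mu> c by (simp add: l_minus r_neg)
    moreover have "lc n ?y f p \<oplus> x p = \<zero>"
    proof -
      have "lc n ?y f p \<oplus> x p = (\<Oplus>k\<in>{..<n}. ?y k \<otimes> f k p \<oplus> y k \<otimes> f k p)"
        unfolding rel[OF that] by (subst sm_add) (use c in auto)
      also have "\<dots> = \<zero>" by (rule sm_zero) (use c in \<open>auto simp: l_minus l_neg\<close>)
      finally show ?thesis .
    qed
    ultimately have "lc n ?b (f(i := x)) p = lc n ?a f p"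
      using exchange[of ?a ?y f x \<mu> i n p] c \<mu> i by fastforce
    also have "\<dots> = (\<Oplus>k\<in>{..<n}. if k = i then f i p else \<zero>)"
      by (rule sm_cong) (use c in auto)
    finally show ?thesis using i c by (simp add: sm_delta)
  qed
  moreover have "\<forall>k. ?b k \<in> carrier R" using c \<mu> by auto
  ultimately show ?thesis unfolding True inspan_def by (intro exI[of _ ?b] conjI allI impI) auto
qed

text \<open>Each independent \<open>T k\<close> displaces one member of \<open>u\<close>. The
  permutation collects the displaced members in the first \<open>n0\<close> positions, so that the
  survivors \<open>u (\<pi> r)\<close> with \<open>r \<ge> n0\<close> are precisely what the
  algorithm has to guess.\<close>

lemma steinitz:
  assumes c: "\<And>k p. u k p \<in> carrier R" "\<And>k p. T k p \<in> carrier R"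
    and T: "\<And>t. t < n0 \<Longrightarrow> inspan n u m (T t)"
    and indep: "\<And>a. (\<And>k. a k \<in> carrier R) \<Longrightarrow> (\<And>p. p < m \<Longrightarrow> lc n0 a T p = \<zero>) \<Longrightarrow>
      (\<And>k. k < n0 \<Longrightarrow> a k = \<zero>)"
    and n0: "n0 \<le> n"
  shows "\<exists>\<pi>. bij_betw \<pi> {..<n} {..<n} \<and>
    (\<forall>r<n. inspan n (\<lambda>r. if r < n0 then T r else u (\<pi> r)) m (u r))"
proof -
  have "\<exists>\<pi>. bij_betw \<pi> {..<n} {..<n} \<and>
      (\<forall>r<n. inspan n (\<lambda>r. if r < k then T r else u (\<pi> r)) m (u r))" if "k \<le> n0" for k
    using that
  proof (induction k)
    case 0
    have "inspan n u m (u r)" if "r < n" for r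
      using inspan_base[OF that, of u m] c by simp
    then show ?case by (intro exI[of _ "\<lambda>r. r"]) (auto simp: bij_betw_def)
  next
    case (Suc k)
    then obtain \<pi> where \<pi>: "bij_betw \<pi> {..<n} {..<n}"
      and sp: "\<And>r. r < n \<Longrightarrow> inspan n (\<lambda>r. if r < k then T r else u (\<pi> r)) m (u r)"
      by auto
    define g where "g = (\<lambda>r. if r < k then T r else u (\<pi> r))"
    have gc: "g j p \<in> carrier R" for j p using c by (auto simp: g_def)
    have "inspan n g m (T k)"
      by (rule inspan_trans[OF T]) (use Suc.prems sp c in \<open>auto simp: g_def\<close>)
    then obtain y where y: "\<And>j. y j \<in> carrier R" "\<And>p. p < m \<Longrightarrow> T k p = lc n y g p"
      by (auto simp: inspan_def)
    \<comment> \<open>If all coefficients beyond the vectors placed so far vanished,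
      \<open>T k\<close> would depend on the earlier ones.\<close>
    have "\<exists>r. k \<le> r \<and> r < n \<and> y r \<noteq> \<zero>"
    proof (rule ccontr)
      assume no: "\<not> ?thesis"
      define a where "a = (\<lambda>r. if r < k then y r else if r = k then \<ominus> \<one> else \<zero>)"
      have a: "a j \<in> carrier R" for j using y by (auto simp: a_def)
      have "lc n0 a T p = \<zero>" if p: "p < m" for p
      proof -
        have "lc n y g p = (\<Oplus>r\<in>{..<k}. y r \<otimes> T r p)"
          by (rule add.finprod_mono_neutral_cong_right)
            (use no y c gc Suc.prems n0 in \<open>auto simp: g_def\<close>)
        then have 1: "(\<Oplus>r\<in>{..<k}. a r \<otimes> T r p) = T k p"
          using y(2)[OF p] by (subst sm_cong[of k _ "\<lambda>r. y r \<otimes> T r p"]) (use y c in \<open>auto simp: a_def\<close>)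
        have "lc n0 a T p = (\<Oplus>r\<in>{..<Suc k}. a r \<otimes> T r p)"
          by (rule add.finprod_mono_neutral_cong_right)
            (use y c a Suc.prems in \<open>auto simp: a_def\<close>)
        also have "\<dots> = T k p \<oplus> a k \<otimes> T k p" by (subst sm_Suc) (use a c 1 in auto)
        also have "\<dots> = \<zero>" using c by (simp add: a_def l_minus r_neg)
        finally show ?thesis .
      qed
      from indep[OF a this, of k] have "a k = \<zero>" using Suc.prems by simp
      then have "\<one> = \<zero>" unfolding a_def by (metis add.inv_eq_1_iff one_closed less_irrefl)
      then show False by simp
    qed
    then obtain r where r: "k \<le> r" "r < n" "y r \<noteq> \<zero>" by blast
    \<comment> \<open>\<open>T k\<close> displaces the member at position \<open>r\<close> but has
      to sit at position \<open>k\<close>; the member that was at \<open>k\<close> moves to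
      \<open>r\<close>.\<close>
    let ?\<pi> = "\<lambda>j. if j = r then \<pi> k else if j = k then \<pi> r else \<pi> j"
    have "bij_betw (\<pi> \<circ> Transposition.transpose k r) {..<n} {..<n}"
      by (rule bij_betw_trans[OF _ \<pi>]) (use r in \<open>auto simp: bij_betw_transpose_iff\<close>)
    also have "\<pi> \<circ> Transposition.transpose k r = ?\<pi>"
      by (auto simp: fun_eq_iff Transposition.transpose_def)
    finally have bij: "bij_betw ?\<pi> {..<n} {..<n}" .
    define h where "h = (\<lambda>r. if r < Suc k then T r else u (?\<pi> r))"
    have hc: "h j p \<in> carrier R" for j p using c by (auto simp: h_def)
    have 1: "inspan n (g(r := T k)) m (g j)" if "j < n" for j
      by (rule inspan_exchange) (use y gc c r that in auto)
    have 2: "inspan n h m ((g(r := T k)) j)" if "j < n" for j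
    proof -
      have "(g(r := T k)) j = h (Transposition.transpose k r j)"
        using r that by (auto simp: g_def h_def Transposition.transpose_def)
      moreover have "Transposition.transpose k r j < n"
        using r that by (auto simp: Transposition.transpose_def)
      ultimately show ?thesis using inspan_base[of _ n h m] hc by metis
    qed
    have "inspan n h m (u j)" if "j < n" for j
      by (rule inspan_trans[OF sp[OF that, folded g_def] inspan_trans[OF 1 2]]) (use gc c hc in auto)
    then show ?case using bij unfolding h_def by blast
  qed
  then show ?thesis by blast
qed

text \<open>
  If the vectors \<open>f\<close> and \<open>u\<close> span each other, then \<open>f i\<close> can be replaced by some \<open>u r\<close>, or else
  it is redundant.
\<close>

lemma exists_exchange:
  assumes c: "\<And>k p. u k p \<in> carrier R" "\<And>k p. f k p \<in> carrier R"
    and i: "i < n" "inspan n u m (f i)"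
    and u: "\<And>r. r < n \<Longrightarrow> inspan n f m (u r)"
  shows "\<exists>a x. (\<forall>k. a k \<in> carrier R) \<and> a i \<noteq> \<zero> \<and> (\<forall>p<m. lc n a f p = x p) \<and>
    ((\<forall>p. x p = \<zero>) \<or> (\<exists>r<n. x = u r))"
proof -
  obtain y where y: "\<And>k. y k \<in> carrier R" "\<And>p. p < m \<Longrightarrow> f i p = lc n y u p"
    using i by (auto simp: inspan_def)
  have "\<forall>k. \<exists>d. (\<forall>j. d j \<in> carrier R) \<and> (k < n \<longrightarrow> (\<forall>p<m. u k p = lc n d f p))"
  proof
    fix k show "\<exists>d. (\<forall>j. d j \<in> carrier R) \<and> (k < n \<longrightarrow> (\<forall>p<m. u k p = lc n d f p))"
      using u[of k] unfolding inspan_def by (cases "k < n") (blast, force)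
  qed
  then obtain d where d: "\<And>k j. d k j \<in> carrier R"
    "\<And>k p. k < n \<Longrightarrow> p < m \<Longrightarrow> u k p = lc n (d k) f p" by metis
  show ?thesis
  proof (cases "\<exists>r<n. d r i \<noteq> \<zero>")
    case True
    then obtain r where "r < n" "d r i \<noteq> \<zero>" by blast
    then show ?thesis using d by (intro exI[of _ "d r"] exI[of _ "u r"]) auto
  next
    case False
    define b where "b = (\<lambda>j. \<Oplus>k\<in>{..<n}. y k \<otimes> d k j)"
    have b: "b j \<in> carrier R" for j unfolding b_def using y d by auto
    have bi: "b i = \<zero>" unfolding b_def by (rule sm_zero) (use False y in auto)
    have fb: "f i p = lc n b f p" if "p < m" for p
    proof -
      have "f i p = (\<Oplus>k\<in>{..<n}. y k \<otimes> lc n (d k) f p)"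
        unfolding y(2)[OF that] by (rule sm_cong) (use y d that c in auto)
      then show ?thesis unfolding b_def by (subst lc_lc) (use y d c in auto)
    qed
    \<comment> \<open>Here no \<open>u r\<close> involves \<open>f i\<close>, so substituting their
      expansions writes \<open>f i\<close> through the other members. Bringing \<open>f i\<close> to
      the other side gives a relation for the zero vector with coefficient minus one at
      \<open>i\<close>.\<close>
    let ?a = "\<lambda>j. if j = i then \<ominus> \<one> else b j"
    have "lc n ?a f p = \<zero>" if "p < m" for p
    proof -
      have "lc n ?a f p = (\<Oplus>j\<in>{..<n}. b j \<otimes> f j p \<oplus> (if j = i then \<ominus> f i p else \<zero>))"
        by (rule sm_cong) (use b c bi in \<open>auto simp: l_minus\<close>)
      also have "\<dots> = lc n b f p \<oplus> \<ominus> f i p" using b c i by (simp add: sm_add sm_delta)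
      finally show ?thesis using fb[OF that] c[of i p] by (metis r_neg)
    qed
    moreover have "\<ominus> \<one> \<noteq> \<zero>" by (metis add.inv_eq_1_iff one_closed one_not_zero)
    ultimately show ?thesis using b by (intro exI[of _ ?a] exI[of _ "\<lambda>_. \<zero>"]) auto
  qed
qed

subsection \<open>Rank-one tensors\<close>

text \<open>\<open>p\<close> is a flat position and \<open>\<pi> d p\<close> its coordinate in axis
  \<open>d\<close>. Leaving out the axes below \<open>d0\<close> lets the tensors on the axes from 1
  on and from 2 on share the same positions.\<close>

definition rk1 :: "nat \<Rightarrow> nat \<Rightarrow> (nat \<Rightarrow> nat \<Rightarrow> nat) \<Rightarrow> (nat \<Rightarrow> nat \<Rightarrow> 'a) \<Rightarrow> nat \<Rightarrow> 'a" where
  "rk1 d0 D \<pi> v p = (\<Otimes>d\<in>{d0..<D}. v d (\<pi> d p))"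

lemma rk1_closed [simp]:
  "(\<And>d j. v d j \<in> carrier R) \<Longrightarrow> rk1 d0 D \<pi> v p \<in> carrier R"
  unfolding rk1_def by (rule finprod_closed) auto

lemma rk1_split:
  "d0 < D \<Longrightarrow> (\<And>d j. v d j \<in> carrier R) \<Longrightarrow>
    rk1 d0 D \<pi> v p = v d0 (\<pi> d0 p) \<otimes> rk1 (Suc d0) D \<pi> v p"
proof -
  assume a: "d0 < D" "\<And>d j. v d j \<in> carrier R"
  then have "{d0..<D} = insert d0 {Suc d0..<D}" by auto
  then show ?thesis unfolding rk1_def by (simp add: a)
qed

lemma prod_nonzero:
  assumes "finite A" "\<And>d. d \<in> A \<Longrightarrow> f d \<in> carrier R" "(\<Otimes>d\<in>A. f d) \<noteq> \<zero>" "a \<in> A"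
  shows "f a \<noteq> \<zero>"
proof
  assume "f a = \<zero>"
  have "(\<Otimes>d\<in>A. f d) = (\<Otimes>d\<in>insert a (A - {a}). f d)" using assms by (simp add: insert_absorb)
  also have "\<dots> = f a \<otimes> (\<Otimes>d\<in>A - {a}. f d)" by (subst finprod_insert) (use assms in auto)
  also have "\<dots> = \<zero>" using \<open>f a = \<zero>\<close> assms by (auto intro!: l_null finprod_closed)
  finally show False using assms by simp
qed

lemma nonzero_prod:
  assumes "finite A" "\<And>d. d \<in> A \<Longrightarrow> f d \<in> carrier R - {\<zero>}"
  shows "(\<Otimes>d\<in>A. f d) \<in> carrier R - {\<zero>}"
  using assms
  by (induction A rule: finite_induct) (auto simp: Pi_def integral_iff intro!: finprod_closed)

text \<open>
  A nonzero rank-one tensor is determined up to a factor in its first axis by the fibers through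
  any nonzero entry.
\<close>

lemma rk1_fibers:
  assumes v: "\<And>d j. v d j \<in> carrier R" and D: "1 < D"
    and x: "\<And>p. p < m \<Longrightarrow> x p = rk1 1 D \<pi> v p"
    and upd: "\<And>d j. 2 \<le> d \<Longrightarrow> d < D \<Longrightarrow> j < n d \<Longrightarrow> upd q d j < m"
      "\<And>d j d'. 2 \<le> d \<Longrightarrow> d < D \<Longrightarrow> j < n d \<Longrightarrow> 1 \<le> d' \<Longrightarrow> d' < D \<Longrightarrow>
        \<pi> d' (upd q d j) = (if d' = d then j else \<pi> d' q)"
    and \<pi>: "\<And>d p. p < m \<Longrightarrow> d < D \<Longrightarrow> \<pi> d p < n d"
    and q: "q < m" "x q \<noteq> \<zero>"
    and w: "\<And>d j. 2 \<le> d \<Longrightarrow> d < D \<Longrightarrow> j < n d \<Longrightarrow> w d j = x (upd q d j)"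
  shows "\<exists>v1. (\<forall>l. v1 l \<in> carrier R) \<and> (\<forall>p<m. x p = v1 (\<pi> 1 p) \<otimes> rk1 2 D \<pi> w p)"
proof -
  define C where "C = (\<lambda>d. \<Otimes>d'\<in>{1..<D} - {d}. v d' (\<pi> d' q))"
  have vq: "v d (\<pi> d q) \<noteq> \<zero>" if "d \<in> {1..<D}" for d
    using prod_nonzero[of "{1..<D}" "\<lambda>d. v d (\<pi> d q)" d] x[OF q(1)] q(2) v that by (auto simp: rk1_def)
  have C: "C d \<in> carrier R - {\<zero>}" for d unfolding C_def
    by (rule nonzero_prod) (use v vq in auto)
  have w': "w d j = v d j \<otimes> C d" if "2 \<le> d" "d < D" "j < n d" for d j
  proof -
    have "{1..<D} = insert d ({1..<D} - {d})" using that by auto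
    then have "w d j = (\<Otimes>d'\<in>insert d ({1..<D} - {d}). v d' (\<pi> d' (upd q d j)))"
      using w[OF that] x[OF upd(1)[OF that]] unfolding rk1_def by simp
    also have "\<dots> = v d (\<pi> d (upd q d j)) \<otimes> (\<Otimes>d'\<in>{1..<D} - {d}. v d' (\<pi> d' (upd q d j)))"
      by (subst finprod_insert) (use v in auto)
    also have "(\<Otimes>d'\<in>{1..<D} - {d}. v d' (\<pi> d' (upd q d j))) = C d"
      unfolding C_def by (rule finprod_cong') (use that upd v in auto)
    also have "\<pi> d (upd q d j) = j" using that upd(2)[OF that, of d] by simp
    finally show ?thesis .
  qed
  define c where "c = (\<Otimes>d\<in>{2..<D}. C d)"
  have c: "c \<in> carrier R - {\<zero>}" unfolding c_def by (rule nonzero_prod) (use C in auto)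
  then have cU: "c \<in> Units R" by (simp add: field_Units)
  have ww: "rk1 2 D \<pi> w p = rk1 2 D \<pi> v p \<otimes> c" if "p < m" for p
  proof -
    have "rk1 2 D \<pi> w p = (\<Otimes>d\<in>{2..<D}. v d (\<pi> d p) \<otimes> C d)"
      unfolding rk1_def by (rule finprod_cong') (use w' v C \<pi> that in auto)
    then show ?thesis unfolding rk1_def c_def by (subst (asm) finprod_multf) (use v C in auto)
  qed
  \<comment> \<open>The scalars collected in the axes from 2 on are divided out of the factor in
    axis 1, which may be chosen freely.\<close>
  have "x p = v 1 (\<pi> 1 p) \<otimes> m_inv R c \<otimes> rk1 2 D \<pi> w p" if "p < m" for p
  proof -
    have "v 1 (\<pi> 1 p) \<otimes> m_inv R c \<otimes> (rk1 2 D \<pi> v p \<otimes> c) =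
        v 1 (\<pi> 1 p) \<otimes> rk1 2 D \<pi> v p \<otimes> (m_inv R c \<otimes> c)"
      using v c Units_inv_closed[OF cU] by (simp add: m_ac)
    also have "\<dots> = x p"
      using x[OF that] rk1_split[of 1 D v \<pi> p] v D cU by (simp add: numeral_2_eq_2 Units_l_inv)
    finally show ?thesis using ww[OF that] by simp
  qed
  then show ?thesis
    by (intro exI[of _ "\<lambda>l. v 1 l \<otimes> m_inv R c"]) (use v cU in auto)
qed

end

lemma is_cpd_cong:
  assumes "field F" and "is_cpd F ns T k A"
    and "\<And>d i r. d < length ns \<Longrightarrow> i < ns ! d \<Longrightarrow> r < k \<Longrightarrow> A d i r = A' d i r"
  shows "is_cpd F ns T k A'"
proof -
  interpret field F by fact
  have c: "A' d i r \<in> carrier F" if "d < length ns" "i < ns ! d" "r < k" for d i r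
    using assms that by (auto simp: is_cpd_def)
  have "(\<Oplus>\<^bsub>F\<^esub>r\<in>{..<k}. \<Otimes>\<^bsub>F\<^esub>d\<in>{..<length ns}. A d (js ! d) r) =
      (\<Oplus>\<^bsub>F\<^esub>r\<in>{..<k}. \<Otimes>\<^bsub>F\<^esub>d\<in>{..<length ns}. A' d (js ! d) r)" if "js \<in> indices ns" for js
  proof (rule sm_cong)
    fix r assume r: "r < k"
    show "(\<Otimes>\<^bsub>F\<^esub>d\<in>{..<length ns}. A d (js ! d) r) = (\<Otimes>\<^bsub>F\<^esub>d\<in>{..<length ns}. A' d (js ! d) r)"
      by (rule finprod_cong') (use r that c assms(3) in \<open>auto simp: indices_def\<close>)
    show "(\<Otimes>\<^bsub>F\<^esub>d\<in>{..<length ns}. A' d (js ! d) r) \<in> carrier F"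
      by (rule finprod_closed) (use r that c in \<open>auto simp: indices_def\<close>)
  qed
  then show ?thesis using assms(2) c by (auto simp: is_cpd_def)
qed

section \<open>A higher-order syntax for fold expressions\<close>

text \<open>
  A term of type \<open>lx\<close> yields an expression for each number of bound variables (de Bruijn level), so
  that binders are functions. \<open>EV E e v\<close> quantifies over all extensions of \<open>E\<close>, which makes it
  stable under going below further binders.
\<close>

type_synonym lx = "nat \<Rightarrow> xe"

definition lit :: "nat \<Rightarrow> lx" where "lit n L = XLit n"
definition get :: "nat \<Rightarrow> lx \<Rightarrow> lx" where "get a e L = XGet a (e L)"
definition bin :: "binop \<Rightarrow> lx \<Rightarrow> lx \<Rightarrow> lx" where "bin f a b L = XBin f (a L) (b L)"
definition ite :: "lx \<Rightarrow> lx \<Rightarrow> lx \<Rightarrow> lx" where "ite c a b L = XIf (c L) (a L) (b L)"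
definition xfold :: "nat \<Rightarrow> lx \<Rightarrow> lx \<Rightarrow> (lx \<Rightarrow> lx \<Rightarrow> lx) \<Rightarrow> lx" where
  "xfold k n e b L = XFold k (n L) (e L) (b (\<lambda>_. XVar L) (\<lambda>_. XVar (Suc L)) (Suc (Suc L)))"
text \<open>A let, encoded as a fold with one iteration: the value is computed once and named, and
  tag 0 keeps it out of the exponential part of the time bound.\<close>

definition bind :: "lx \<Rightarrow> (lx \<Rightarrow> lx) \<Rightarrow> lx" where
  "bind e b = xfold 0 (lit 1) e (\<lambda>X _. b X)"

abbreviation xadd (infixl "[+]" 65) where "xadd \<equiv> bin OpAdd"
abbreviation xsub (infixl "[-]" 65) where "xsub \<equiv> bin OpSub"
abbreviation xmul (infixl "[*]" 70) where "xmul \<equiv> bin OpMul"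
abbreviation xdiv (infixl "[div]" 70) where "xdiv \<equiv> bin OpDiv"
abbreviation xmod (infixl "[mod]" 70) where "xmod \<equiv> bin OpMod"
abbreviation xless (infix "[<]" 50) where "xless \<equiv> bin OpLess"
abbreviation xeq (infix "[=]" 50) where "xeq \<equiv> bin OpEq"

locale evaluation =
  fixes s0 :: mem and Nb :: "nat \<Rightarrow> nat" and B :: nat
begin

definition EV :: "nat list \<Rightarrow> lx \<Rightarrow> nat \<Rightarrow> bool" where
  "EV E e v \<longleftrightarrow> (\<forall>E'. prefix E E' \<longrightarrow>
     good s0 Nb B (e (length E')) E' \<and> den s0 (e (length E')) E' = v)"

lemma EV_mono: "EV E e v \<Longrightarrow> prefix E E' \<Longrightarrow> EV E' e v"
  unfolding EV_def by (meson prefix_order.trans)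

lemma EV_eq: "EV E e v' \<Longrightarrow> v' = v \<Longrightarrow> EV E e v"
  by simp

lemma EV_lit: "n < 2 ^ B \<Longrightarrow> EV E (lit n) n"
  by (simp add: EV_def lit_def)

lemma EV_get: "a < 5 \<Longrightarrow> EV E e v \<Longrightarrow> EV E (get a e) (s0 a v)"
  by (simp add: EV_def get_def)

lemma EV_add: "EV E a v \<Longrightarrow> EV E b w \<Longrightarrow> v + w < 2 ^ B \<Longrightarrow> EV E (a [+] b) (v + w)"
  and EV_mul: "EV E a v \<Longrightarrow> EV E b w \<Longrightarrow> v * w < 2 ^ B \<Longrightarrow> EV E (a [*] b) (v * w)"
  and EV_sub: "EV E a v \<Longrightarrow> EV E b w \<Longrightarrow> EV E (a [-] b) (v - w)"
  and EV_div: "EV E a v \<Longrightarrow> EV E b w \<Longrightarrow> EV E (a [div] b) (v div w)"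
  and EV_mod: "EV E a v \<Longrightarrow> EV E b w \<Longrightarrow> EV E (a [mod] b) (v mod w)"
  and EV_less: "EV E a v \<Longrightarrow> EV E b w \<Longrightarrow> EV E (a [<] b) (of_bool (v < w))"
  and EV_equal: "EV E a v \<Longrightarrow> EV E b w \<Longrightarrow> EV E (a [=] b) (of_bool (v = w))"
  by (simp_all add: EV_def bin_def)

lemma EV_ite:
  assumes "EV E c (of_bool P)" "P \<Longrightarrow> EV E a v" "\<not> P \<Longrightarrow> EV E b w"
  shows "EV E (ite c a b) (if P then v else w)"
  using assms by (cases P) (simp_all add: EV_def ite_def)

lemma EV_ite_pos:
  assumes "EV E c u" "u \<noteq> 0 \<Longrightarrow> EV E a v" "u = 0 \<Longrightarrow> EV E b w"
  shows "EV E (ite c a b) (if u \<noteq> 0 then v else w)"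
  using assms by (cases "u = 0") (simp_all add: EV_def ite_def)

text \<open>The body may assume that the accumulator is the true intermediate value, since bounds on
  the values it computes rest on that. \<open>E'\<close> ranges over extensions of \<open>E\<close>
  because the body is evaluated below two further binders.\<close>

lemma EV_xfold:
  assumes n: "EV E n vn" and e: "EV E e ve" and Nb: "vn \<le> Nb k"
    and b: "\<And>E' X I i x. prefix E E' \<Longrightarrow> EV E' X x \<Longrightarrow> EV E' I i \<Longrightarrow> i < vn \<Longrightarrow>
      x = itr f i ve \<Longrightarrow> EV E' (b X I) (f i x)"
  shows "EV E (xfold k n e b) (itr f vn ve)"
  unfolding EV_def
proof (intro allI impI)
  fix E' assume p: "prefix E E'"
  let ?L = "length E'"
  let ?b = "b (\<lambda>_. XVar ?L) (\<lambda>_. XVar (Suc ?L)) (Suc (Suc ?L))"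
  have 1: "good s0 Nb B ?b (E' @ [x, i]) \<and> den s0 ?b (E' @ [x, i]) = f i x"
    if "i < vn" "x = itr f i ve" for i x
  proof -
    have "EV (E' @ [x, i]) (\<lambda>_. XVar ?L) x" "EV (E' @ [x, i]) (\<lambda>_. XVar (Suc ?L)) i"
      by (auto simp: EV_def prefix_def nth_append)
    from b[OF _ this that] have "EV (E' @ [x, i]) (b (\<lambda>_. XVar ?L) (\<lambda>_. XVar (Suc ?L))) (f i x)"
      using p by (simp add: prefix_prefix)
    then show ?thesis unfolding EV_def by (auto dest: spec[of _ "E' @ [x, i]"])
  qed
  let ?g = "\<lambda>i x. den s0 ?b (E' @ [x, i])"
  have 2: "itr ?g j ve = itr f j ve" if "j \<le> vn" for j
    using that by (induction j) (auto simp: 1)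
  have "den s0 (n ?L) E' = vn" "den s0 (e ?L) E' = ve" "good s0 Nb B (n ?L) E'" "good s0 Nb B (e ?L) E'"
    using n e p by (auto simp: EV_def)
  then show "good s0 Nb B (xfold k n e b ?L) E' \<and> den s0 (xfold k n e b ?L) E' = itr f vn ve"
    using Nb 1 2 by (auto simp: xfold_def)
qed

lemma EV_bind:
  assumes "EV E e v" "1 \<le> Nb 0" "1 \<le> B"
    and "\<And>E' X. prefix E E' \<Longrightarrow> EV E' X v \<Longrightarrow> EV E' (b X) w"
  shows "EV E (bind e b) w"
proof -
  have "(1::nat) < 2 ^ B" using assms(3) by (intro one_less_power) auto
  then have "EV E (bind e b) (itr (\<lambda>_ _. w) 1 v)"
    unfolding bind_def by (intro EV_xfold EV_lit assms) (use assms in auto)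
  then show ?thesis by simp
qed

end

section \<open>Digits and mixed radix indices\<close>

definition digit :: "nat \<Rightarrow> nat \<Rightarrow> nat \<Rightarrow> nat" where
  "digit q x k = x div q ^ k mod q"

definition code :: "nat \<Rightarrow> nat \<Rightarrow> (nat \<Rightarrow> nat) \<Rightarrow> nat" where
  "code q n f = (\<Sum>h<n. f h * q ^ h)"

lemma code_less:
  assumes "\<And>h. h < n \<Longrightarrow> f h < q"
  shows "code q n f < q ^ n"
  using assms
proof (induction n)
  case (Suc n)
  have "code q n f < q ^ n" using Suc by simp
  moreover have "f n + 1 \<le> q" using Suc.prems[of n] by simp
  moreover from this have "(f n + 1) * q ^ n \<le> q * q ^ n" by (rule mult_le_mono1)
  ultimately show ?case by (simp add: code_def)
qed (simp add: code_def)

text \<open>The terms below \<open>k\<close> sum to less than \<open>q ^ k\<close> and disappear in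
  the division; the terms above \<open>k\<close> leave multiples of \<open>q\<close>.\<close>

lemma digit_code:
  assumes "\<And>h. h < n \<Longrightarrow> f h < q" "k < n"
  shows "digit q (code q n f) k = f k"
proof -
  have q: "0 < q" using assms by (metis gr0I less_nat_zero_code)
  have "(\<Sum>h\<in>{k..<n}. f h * q ^ h) = (\<Sum>h\<in>{k..<n}. f h * q ^ (h - k)) * q ^ k"
    by (simp add: sum_distrib_right mult.assoc flip: power_add)
  then have "code q n f = code q k f + (\<Sum>h\<in>{k..<n}. f h * q ^ (h - k)) * q ^ k"
    unfolding code_def lessThan_atLeast0
    using sum.atLeastLessThan_concat[of 0 k n "\<lambda>h. f h * q ^ h"] assms(2) by simp
  moreover have "code q k f < q ^ k" by (rule code_less) (use assms in auto)
  ultimately have "code q n f div q ^ k = (\<Sum>h\<in>{k..<n}. f h * q ^ (h - k))"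
    using q by simp
  also have "\<dots> = f k + (\<Sum>h\<in>{Suc k..<n}. f h * q ^ (h - k))"
    using assms(2) by (subst sum.atLeast_Suc_lessThan) auto
  also have "(\<Sum>h\<in>{Suc k..<n}. f h * q ^ (h - k)) = q * (\<Sum>h\<in>{Suc k..<n}. f h * q ^ (h - Suc k))"
    unfolding sum_distrib_left
    by (rule sum.cong) (auto simp: Suc_diff_le simp flip: power_Suc intro!: arg_cong2[of _ _ _ _ "\<lambda>a b. _ * q ^ b"] split: nat_diff_split)
  finally show ?thesis using assms by (simp add: digit_def)
qed

lemma digit_less: "0 < q \<Longrightarrow> digit q x k < q"
  by (simp add: digit_def)

text \<open>Row-major position. This is the order in which \<open>product_lists\<close> enumerates
  the indices, and hence the order of the tensor in the input.\<close>

fun enc :: "nat list \<Rightarrow> nat list \<Rightarrow> nat" where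
  "enc (n # ns) (j # js) = j * prod_list ns + enc ns js"
| "enc _ _ = 0"

lemma indices_Nil [simp]: "indices [] = {[]}"
  by (auto simp: indices_def)

lemma indices_Cons: "js \<in> indices (n # ns) \<longleftrightarrow> (\<exists>j js'. js = j # js' \<and> j < n \<and> js' \<in> indices ns)"
  by (cases js) (auto simp: indices_def nth_Cons split: nat.splits)

lemma enc_less: "js \<in> indices ns \<Longrightarrow> enc ns js < prod_list ns"
proof (induction ns arbitrary: js)
  case (Cons n ns)
  then obtain j js' where js: "js = j # js'" "j < n" "js' \<in> indices ns" by (auto simp: indices_Cons)
  have "(j + 1) * prod_list ns \<le> n * prod_list ns"
    using js by (intro mult_le_mono1) simp
  moreover have "enc ns js' < prod_list ns" using js Cons by blast
  ultimately have "enc ns js' < prod_list ns" "(j + 1) * prod_list ns \<le> n * prod_list ns" by auto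
  then show ?case using js by simp
qed simp

lemma enc_surj: "p < prod_list ns \<Longrightarrow> \<exists>js\<in>indices ns. enc ns js = p"
proof (induction ns arbitrary: p)
  case (Cons n ns)
  then have P: "0 < prod_list ns" by (auto intro: gr0I)
  then obtain js where js: "js \<in> indices ns" "enc ns js = p mod prod_list ns"
    using Cons.IH[of "p mod prod_list ns"] by auto
  have "p div prod_list ns < n" using Cons.prems P by (simp add: div_less_iff_less_mult)
  then have "p div prod_list ns # js \<in> indices (n # ns)" using js by (simp add: indices_Cons)
  moreover have "enc (n # ns) (p div prod_list ns # js) = p" using js by simp
  ultimately show ?case by blast
qed simp

definition stride :: "nat list \<Rightarrow> nat \<Rightarrow> nat" where
  "stride ns d = prod_list (drop (Suc d) ns)"

definition coord :: "nat list \<Rightarrow> nat \<Rightarrow> nat \<Rightarrow> nat" where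
  "coord ns d p = p div stride ns d mod ns ! d"

text \<open>Reducing modulo a multiple of \<open>a * b\<close> changes only what lies above the
  digit that is read.\<close>

lemma coord_mod:
  fixes a b K x :: nat
  shows "x mod (a * b * K) div a mod b = x div a mod b"
proof (cases "a = 0")
  case False
  have "x mod (a * (b * K)) = a * (x div a mod (b * K)) + x mod a" by (rule mod_mult2_eq)
  then have "x mod (a * b * K) div a = x div a mod (b * K)"
    using False by (simp add: mult.assoc)
  then show ?thesis by (simp add: mod_mod_cancel)
qed simp

lemma stride_split:
  "d < d' \<Longrightarrow> d' < length ns \<Longrightarrow>
    stride ns d = stride ns d' * ns ! d' * prod_list (drop (Suc d) (take d' ns))"
proof -
  assume a: "d < d'" "d' < length ns"
  have "drop (Suc d) ns = drop (Suc d) (take d' ns) @ ns ! d' # drop (Suc d') ns"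
  proof -
    have "drop (Suc d) (take d' ns) @ drop d' ns = drop (Suc d) (take d' ns @ drop d' ns)"
      using a by (subst drop_append) auto
    then show ?thesis using a by (simp add: Cons_nth_drop_Suc)
  qed
  then show ?thesis by (simp add: stride_def)
qed

lemma coord_enc:
  "js \<in> indices ns \<Longrightarrow> d < length ns \<Longrightarrow> coord ns d (enc ns js) = js ! d"
proof (induction ns arbitrary: js d)
  case (Cons n ns)
  then obtain j js' where js: "js = j # js'" "j < n" "js' \<in> indices ns" by (auto simp: indices_Cons)
  have e: "enc ns js' < prod_list ns" using js enc_less by blast
  show ?case
  proof (cases d)
    case 0
    then show ?thesis using js e by (simp add: coord_def stride_def)
  next
    case (Suc d')
    then have d': "d' < length ns" using Cons by simp
    have "prod_list ns = stride (n # ns) 0" by (simp add: stride_def)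
    also have "\<dots> = stride (n # ns) d * (n # ns) ! d * prod_list (drop (Suc 0) (take d (n # ns)))"
      using stride_split[of 0 d "n # ns"] Suc Cons.prems by simp
    finally have P: "prod_list ns = stride ns d' * ns ! d' * prod_list (drop (Suc 0) (take d (n # ns)))"
      using Suc by (simp add: stride_def)
    have "(j * prod_list ns + enc ns js') div stride ns d' mod ns ! d'
        = (j * prod_list ns + enc ns js') mod prod_list ns div stride ns d' mod ns ! d'"
      by (subst (2) P) (simp only: coord_mod)
    then show ?thesis using Cons.IH[OF js(3) d'] Suc js e
      by (simp add: coord_def stride_def)
  qed
qed simp

lemma product_lists_upt:
  "length (product_lists (map (\<lambda>n. [0..<n]) ns)) = prod_list ns"
  "js \<in> indices ns \<Longrightarrow> product_lists (map (\<lambda>n. [0..<n]) ns) ! enc ns js = js"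
proof (induction ns arbitrary: js)
  case (Cons n ns)
  let ?pl = "product_lists (map (\<lambda>n. [0..<n]) ns)"
  have len: "length (concat (map (\<lambda>x. map ((#) x) ?pl) [0..<k])) = k * prod_list ns" for k
    by (induction k) (auto simp: Cons.IH(1))
  {
    case 1
    then show ?case using len[of n] by (simp add: comp_def)
  next
    case 2
    then obtain j js' where js: "js = j # js'" "j < n" "js' \<in> indices ns" by (auto simp: indices_Cons)
    then have "[0..<n] = [0..<j] @ j # [Suc j..<n]"
      by (metis upt_conv_Cons upt_add_eq_append zero_le less_imp_le_nat le_add_diff_inverse)
    then have "product_lists (map (\<lambda>n. [0..<n]) (n # ns)) =
        concat (map (\<lambda>x. map ((#) x) ?pl) [0..<j]) @ map ((#) j) ?pl @
        concat (map (\<lambda>x. map ((#) x) ?pl) [Suc j..<n])"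
      by simp
    then show ?case using js enc_less[OF js(3)] Cons.IH len[of j]
      by (simp add: nth_append)
  }
qed simp_all

definition upd :: "nat list \<Rightarrow> nat \<Rightarrow> nat \<Rightarrow> nat \<Rightarrow> nat" where
  "upd ns p d j = p - coord ns d p * stride ns d + j * stride ns d"

lemma upd_facts:
  assumes s: "0 < stride ns d" and j: "j < ns ! d"
  shows "upd ns p d j div (stride ns d * ns ! d) = p div (stride ns d * ns ! d)"
    and "upd ns p d j mod stride ns d = p mod stride ns d"
    and "coord ns d (upd ns p d j) = j"
proof -
  define s where "s = stride ns d"
  define n where "n = ns ! d"
  define hi c lo where "hi = p div (s * n)" and "c = p div s mod n" and "lo = p mod s"
  have s0: "0 < s" and n0: "j < n" using s j by (auto simp: s_def n_def)
  have lo: "lo < s" using s0 by (simp add: lo_def)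
  have "p = s * (p div s) + lo" by (simp add: lo_def)
  moreover have "p div s = n * hi + c" by (simp add: hi_def c_def div_mult2_eq)
  ultimately have p: "p = s * (n * hi + c) + lo" by simp
  have "upd ns p d j = p - c * s + j * s"
    by (simp add: upd_def coord_def s_def n_def c_def)
  also have "\<dots> = s * (n * hi + j) + lo" unfolding p by (simp add: algebra_simps)
  finally have u: "upd ns p d j = s * (n * hi + j) + lo" .
  have ud: "upd ns p d j div s = n * hi + j" unfolding u using lo s0 by simp
  show "upd ns p d j div (stride ns d * ns ! d) = p div (stride ns d * ns ! d)"
    unfolding s_def[symmetric] n_def[symmetric] using ud n0 by (simp add: div_mult2_eq hi_def)
  show "upd ns p d j mod stride ns d = p mod stride ns d"
    unfolding s_def[symmetric] u using lo by (simp add: lo_def)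
  show "coord ns d (upd ns p d j) = j"
    unfolding coord_def s_def[symmetric] n_def[symmetric] ud using n0 by simp
qed

text \<open>The coordinates of later axes depend only on \<open>p mod stride ns d\<close>, those of
  earlier axes only on \<open>p div (stride ns d * ns ! d)\<close>, and \<open>upd\<close> preserves
  both.\<close>

lemma upd_coord:
  assumes pos: "\<And>d. d < length ns \<Longrightarrow> 1 \<le> ns ! d" and d: "d < length ns" "d' < length ns" "j < ns ! d"
  shows "coord ns d' (upd ns p d j) = (if d' = d then j else coord ns d' p)"
proof -
  have s: "0 < stride ns d" for d
  proof -
    have "0 \<notin> set (drop (Suc d) ns)"
      using pos by (metis in_set_conv_nth in_set_dropD not_one_le_zero)
    then show ?thesis by (auto simp: stride_def prod_list_zero_iff intro!: gr0I)
  qed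
  note u = upd_facts[OF s d(3)]
  consider "d' = d" | "d < d'" | "d' < d" by linarith
  then show ?thesis
  proof cases
    case 1
    then show ?thesis using u(3) by simp
  next
    case 2
    note sp = stride_split[OF 2 d(2)]
    have "coord ns d' x = x mod stride ns d div stride ns d' mod ns ! d'" for x
      unfolding sp coord_mod coord_def ..
    then show ?thesis using 2 u(2) by simp
  next
    case 3
    note sp = stride_split[OF 3 d(1)]
    show ?thesis unfolding coord_def sp div_mult2_eq[of _ "stride ns d * ns ! d"] u(1)
      using 3 by simp
  qed
qed

text \<open>A slice along axis 0 consists of whole blocks of length
  \<open>stride ns d * ns ! d\<close>, and \<open>upd\<close> stays within its block.\<close>

lemma upd_less:
  assumes pos: "\<And>d. d < length ns \<Longrightarrow> 1 \<le> ns ! d" and d: "0 < d" "d < length ns" "j < ns ! d"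
    and p: "p < stride ns 0"
  shows "upd ns p d j < stride ns 0"
proof -
  have s: "0 < stride ns d"
  proof -
    have "0 \<notin> set (drop (Suc d) ns)"
      using pos by (metis in_set_conv_nth in_set_dropD not_one_le_zero)
    then show ?thesis by (auto simp: stride_def prod_list_zero_iff intro!: gr0I)
  qed
  then have P: "0 < stride ns d * ns ! d" using d by simp
  note sp = stride_split[OF d(1,2)]
  have "p div (stride ns d * ns ! d) < prod_list (drop (Suc 0) (take d ns))"
    using p P unfolding sp by (subst div_less_iff_less_mult) (auto simp: mult.commute)
  then show ?thesis
    unfolding upd_facts(1)[OF s d(3), of p, symmetric] sp using P
    by (subst (asm) div_less_iff_less_mult) (auto simp: mult.commute)
qed

subsection \<open>Bounded search\<close>

text \<open>Folds cannot be left early: the last witness wins, and \<open>x\<close> is the value of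
  an unsuccessful search.\<close>

definition find :: "(nat \<Rightarrow> bool) \<Rightarrow> nat \<Rightarrow> nat \<Rightarrow> nat" where
  "find P n x = itr (\<lambda>i x. if P i then i else x) n x"

lemma find_cases:
  "(\<exists>i<n. P i) \<and> find P n x < n \<and> P (find P n x) \<or> (\<forall>i<n. \<not> P i) \<and> find P n x = x"
  by (induction n) (auto simp: find_def less_Suc_eq)

section \<open>The algorithm on codes\<close>

definition first :: "(nat \<Rightarrow> nat) \<Rightarrow> nat \<Rightarrow> nat" where
  "first g n = itr (\<lambda>i x. if x \<noteq> 0 then x else g i) n 0"

lemma first_cases: "first g n = 0 \<and> (\<forall>i<n. g i = 0) \<or> first g n \<noteq> 0 \<and> (\<exists>i<n. first g n = g i)"
  by (induction n) (auto simp: first_def less_Suc_eq)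

text \<open>The nondegenerate case. A single axis or a vanishing dimension is dealt with in
  \<open>main_correct\<close>.\<close>

locale cpd_instance = field F for F :: "nat ring" (structure) +
  fixes ns :: "nat list" and T :: "nat list \<Rightarrow> nat" and R :: nat
  assumes carrier_eq: "carrier F = {..<order F}"
    and D: "2 \<le> length ns" and pos: "\<And>d. d < length ns \<Longrightarrow> 1 \<le> ns ! d"
    and T: "T \<in> indices ns \<rightarrow> carrier F" and R: "ns ! 0 \<le> R"
begin

definition q :: nat where "q = order F"
abbreviation D :: nat where "D \<equiv> length ns"
definition n0 :: nat where "n0 = ns ! 0"
definition n1 :: nat where "n1 = ns ! 1"
definition m :: nat where "m = stride ns 0"
definition off :: "nat \<Rightarrow> nat" where "off d = (\<Sum>i<d. ns ! i)"
text \<open>The unknowns of the linear system: \<open>R\<close> coefficients of the frame and the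
  \<open>n1\<close> entries of \<open>v\<close>.\<close>

definition N :: nat where "N = R + n1"
definition H :: nat where "H = off D * R"
abbreviation dg :: "nat \<Rightarrow> nat \<Rightarrow> nat" where "dg \<equiv> digit q"
abbreviation \<pi> :: "nat \<Rightarrow> nat \<Rightarrow> nat" where "\<pi> \<equiv> coord ns"

text \<open>The default 0 is a number below \<open>q\<close> and thus a field element, so membership
  in the carrier holds without a condition on the position.\<close>

definition tv :: "nat \<Rightarrow> nat" where
  "tv k = (if k < prod_list ns then map T (product_lists (map (\<lambda>n. [0..<n]) ns)) ! k else 0)"

text \<open>All factor matrices, stacked and read row by row, are the base-\<open>q\<close> digits
  of one number, in the layout of the output array.\<close>

definition fac :: "nat \<Rightarrow> nat \<Rightarrow> nat \<Rightarrow> nat \<Rightarrow> nat" where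
  "fac A r d j = dg A ((off d + j) * R + r)"

definition tens :: "nat \<Rightarrow> nat \<Rightarrow> nat \<Rightarrow> nat" where
  "tens A r = rk1 1 D \<pi> (fac A r)"

text \<open>
  The frame after \<open>i\<close> slices have been replaced. The rows of \<open>A\<close> below \<open>n0\<close> contain the coefficients
  of the slices with respect to it.
\<close>

definition fv :: "nat \<Rightarrow> nat \<Rightarrow> nat \<Rightarrow> nat \<Rightarrow> nat" where
  "fv A i r p = (if r < n0 \<and> i \<le> r then tv (r * m + p) else tens A r p)"

text \<open>\<open>w\<close> codes a single column from which the rows of the axes 0 and 1 have been
  removed.\<close>

definition wfac :: "nat \<Rightarrow> nat \<Rightarrow> nat \<Rightarrow> nat" where
  "wfac w d j = dg w (off d + j - n0 - n1)"

definition wt :: "nat \<Rightarrow> nat \<Rightarrow> nat" where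
  "wt w = rk1 2 D \<pi> (wfac w)"

text \<open>
  The generators of the linear system: the current frame, followed by the tensors with a unit vector
  in axis 1 and the factors \<open>w\<close> in the remaining axes.
\<close>

definition gen :: "nat \<Rightarrow> nat \<Rightarrow> nat \<Rightarrow> nat \<Rightarrow> nat \<Rightarrow> nat" where
  "gen A i w k p = (if k < R then fv A i k p else if \<pi> 1 p = k - R then wt w p else \<zero>)"

text \<open>\<open>Y\<close> codes an \<open>N\<close> by \<open>N\<close> matrix. Each position
  \<open>p\<close> of a slice is one equation of the system, and it is evaluated here at row
  \<open>k\<close> of \<open>Y\<close>.\<close>

definition ell :: "nat \<Rightarrow> nat \<Rightarrow> nat \<Rightarrow> nat \<Rightarrow> nat \<Rightarrow> nat \<Rightarrow> nat" where
  "ell A i w Y k p = lc N (\<lambda>j. dg Y (k * N + j)) (gen A i w) p"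

text \<open>A linear equation is solved by trying all field elements, because the input has tables
  for neither negation nor inversion. For \<open>a = \<one>\<close> the solution is the
  \<open>\<mu>\<close> of \<open>exchange\<close>.\<close>

definition mu :: "nat \<Rightarrow> nat \<Rightarrow> nat" where
  "mu a b = find (\<lambda>x. a \<oplus> x \<otimes> b = \<zero>) q 0"

definition piv :: "nat \<Rightarrow> nat \<Rightarrow> nat \<Rightarrow> nat \<Rightarrow> nat \<Rightarrow> nat" where
  "piv A i w Y p = find (\<lambda>k. ell A i w Y k p \<noteq> \<zero>) N N"

definition step :: "nat \<Rightarrow> nat \<Rightarrow> nat \<Rightarrow> nat \<Rightarrow> nat \<Rightarrow> nat" where
  "step A i w p Y = (let k = piv A i w Y p in
     if k < N then code q (N * N) (\<lambda>h.
       dg Y h \<oplus> mu (ell A i w Y (h div N) p) (ell A i w Y k p) \<otimes> dg Y (k * N + h mod N))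
     else Y)"

definition solve :: "nat \<Rightarrow> nat \<Rightarrow> nat \<Rightarrow> nat \<Rightarrow> nat" where
  "solve A i w n = itr (step A i w) n (code q (N * N) (\<lambda>h. if h div N = h mod N then \<one> else \<zero>))"

text \<open>The rows below \<open>n0\<close> follow \<open>exchange\<close>. In the other rows,
  column \<open>i\<close> receives the new rank-one tensor: \<open>v\<close> is the final part of
  row \<open>k\<close> of \<open>Y\<close>, and the rest is copied from \<open>w\<close>. In the
  relation that is solved, a combination of the frame plus the new tensor is zero, so
  \<open>v\<close> is taken without a sign.\<close>

definition update :: "nat \<Rightarrow> nat \<Rightarrow> nat \<Rightarrow> nat \<Rightarrow> nat \<Rightarrow> nat" where
  "update A i w Y k = code q H (\<lambda>h.
     if h div R < n0 then
       let a = dg A (h div R * R + i) \<otimes> mu \<one> (dg Y (k * N + i)) in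
       if h mod R = i then a else dg A h \<oplus> a \<otimes> dg Y (k * N + h mod R)
     else if h mod R = i then
       if h div R < n0 + n1 then dg Y (k * N + (R + (h div R - n0)))
       else dg w (h div R - n0 - n1)
     else dg A h)"

text \<open>In the following functions 0 stands for failure and \<open>A + 1\<close> for the result \<open>A\<close>.\<close>

definition attempt :: "nat \<Rightarrow> nat \<Rightarrow> nat \<Rightarrow> nat" where
  "attempt A i w = (let Y = solve A i w m; k = find (\<lambda>k. dg Y (k * N + i) \<noteq> \<zero>) N N in
     if k < N then update A i w Y k + 1 else 0)"

definition xval :: "nat \<Rightarrow> nat \<Rightarrow> nat \<Rightarrow> nat \<Rightarrow> nat" where
  "xval A i z p = lc R (dg z) (fv A i) p"

definition dof :: "nat \<Rightarrow> nat" where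
  "dof row = (\<Sum>d<D. of_bool (off (Suc d) \<le> row))"

definition wlen :: nat where "wlen = off D - n0 - n1"

text \<open>Both kinds of candidates are numbered by some \<open>z\<close> below
  \<open>q ^ min R wlen\<close>. Fibers have to pass through a nonzero entry whose position is not
  known; \<open>inner\<close> tries all \<open>m\<close> positions, at the price of a polynomial
  factor.\<close>

definition cand :: "nat \<Rightarrow> nat \<Rightarrow> nat \<Rightarrow> nat \<Rightarrow> nat" where
  "cand A i z p = code q wlen (\<lambda>h.
     if wlen \<le> R then dg z h
     else let d = dof (h + n0 + n1) in xval A i z (upd ns p d (h + n0 + n1 - off d)))"

definition inner :: "nat \<Rightarrow> nat \<Rightarrow> nat" where
  "inner A i = first (\<lambda>z. first (\<lambda>p. attempt A i (cand A i z p)) m) (q ^ min R wlen)"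

text \<open>At the start slice \<open>t\<close> is itself member \<open>t\<close> of the frame, so
  its coefficients form row \<open>t\<close> of an identity matrix padded with zero columns. In the
  other factors the columns from \<open>n0\<close> on are the guess, and those below
  \<open>n0\<close> are placeholders until their stage.\<close>

definition init :: "nat \<Rightarrow> nat" where
  "init z = code q H (\<lambda>h.
     if h div R < n0 then if h div R = h mod R then \<one> else \<zero>
     else if h mod R < n0 then \<zero>
     else dg z ((h div R - n0) * (R - n0) + (h mod R - n0)))"

definition stages :: "nat \<Rightarrow> nat \<Rightarrow> nat" where
  "stages z n = itr (\<lambda>i S. if S \<noteq> 0 then inner (S - 1) i else 0) n (init z + 1)"

definition outer :: nat where
  "outer = first (\<lambda>z. stages z n0) (q ^ ((R - n0) * (off D - n0)))"

section \<open>Field elements as numbers below \<open>q\<close>, and the layout of rows and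
  codes\<close>

lemma q2: "2 \<le> q"
proof -
  have "finite {..<q}" by simp
  moreover have "{\<zero>, \<one>} \<subseteq> {..<q}" using zero_closed one_closed unfolding carrier_eq q_def by auto
  ultimately have "card {\<zero>, \<one>} \<le> card {..<q}" by (rule card_mono)
  then show ?thesis by simp
qed

lemma in_carrier [simp]: "x \<in> carrier F \<longleftrightarrow> x < q"
  by (simp add: carrier_eq q_def)

lemma F_less [simp]: "\<zero> < q" "\<one> < q" "x < q \<Longrightarrow> y < q \<Longrightarrow> x \<oplus> y < q" "x < q \<Longrightarrow> y < q \<Longrightarrow> x \<otimes> y < q"
  using zero_closed one_closed a_closed[of x y] m_closed[of x y] by simp_all

lemma dg_less [simp]: "dg x k < q"
  using q2 by (simp add: digit_less)

lemma pos': "0 < n0" "0 < n1" "0 < R" "0 < N"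
proof -
  have "0 < D" "1 < D" using D by linarith+
  from pos[OF this(1)] pos[OF this(2)] show "0 < n0" "0 < n1" "0 < R" "0 < N"
    using R by (simp_all add: n0_def n1_def N_def)
qed

lemma ns_eq: "ns = n0 # tl ns"
proof -
  have "ns \<noteq> []" using D by auto
  then show ?thesis using hd_conv_nth[of ns] list.collapse[of ns] by (simp add: n0_def)
qed

lemma m_tl: "m = prod_list (tl ns)"
  by (simp add: m_def stride_def drop_Suc)

lemma prod_ns: "prod_list ns = n0 * m"
  by (subst ns_eq) (simp add: m_tl)

lemma indices_ns: "js \<in> indices ns \<longleftrightarrow> (\<exists>t js'. js = t # js' \<and> t < n0 \<and> js' \<in> indices (tl ns))"
  by (subst ns_eq) (rule indices_Cons)

lemma enc_ns: "enc ns (t # js) = t * m + enc (tl ns) js"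
  by (subst ns_eq) (simp add: m_tl)

lemma stride_pos: "0 < stride ns d"
proof -
  have "0 \<notin> set (drop (Suc d) ns)"
    using pos by (metis in_set_conv_nth in_set_dropD not_one_le_zero)
  then show ?thesis by (auto simp: stride_def prod_list_zero_iff intro!: gr0I)
qed

lemma m_pos: "0 < m"
  using stride_pos by (simp add: m_def)

lemma tv_enc: "js \<in> indices ns \<Longrightarrow> tv (enc ns js) = T js"
  using enc_less[of js ns] product_lists_upt(1)[of ns] product_lists_upt(2)[of js ns] by (simp add: tv_def)

lemma tv_less [simp]: "tv k < q"
proof (cases "k < prod_list ns")
  case True
  then obtain js where "js \<in> indices ns" "enc ns js = k" using enc_surj by blast
  then show ?thesis using T tv_enc[of js] by (auto simp: Pi_def)
qed (use q2 in \<open>simp add: tv_def\<close>)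

lemma coord_less [simp]: "d < D \<Longrightarrow> \<pi> d p < ns ! d"
  using pos[of d] by (simp add: coord_def)

lemma sm_less [simp]: "(\<And>k. k < n \<Longrightarrow> f k < q) \<Longrightarrow> (\<Oplus>k\<in>{..<n::nat}. f k) < q"
  using sm_closed[of n f] by simp

lemma fp_less [simp]: "(\<And>k. k \<in> S \<Longrightarrow> f k < q) \<Longrightarrow> (\<Otimes>k\<in>S. f k) < q"
  using finprod_closed[of f S] by (simp add: Pi_def)

lemma rk1_less [simp]: "(\<And>d j. v d j < q) \<Longrightarrow> rk1 d0 D' \<rho> v p < q"
  using rk1_closed[of v] by simp

lemma rk1_cong:
  assumes "\<And>d j. d0 \<le> d \<Longrightarrow> d < D \<Longrightarrow> j < ns ! d \<Longrightarrow> v d j = v' d j" "\<And>d j. v' d j < q"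
  shows "rk1 d0 D \<pi> v p = rk1 d0 D \<pi> v' p"
  unfolding rk1_def by (rule finprod_cong') (use assms in auto)

lemma fac_less [simp]: "fac A r d j < q" and wfac_less [simp]: "wfac w d j < q"
  by (simp_all add: fac_def wfac_def)

lemma values_less [simp]: "tens A r p < q" "fv A i r p < q" "wt w p < q" "gen A i w k p < q"
  by (simp_all add: tens_def fv_def wt_def gen_def)

lemma ell_less [simp]: "ell A i w Y k p < q" and xval_less [simp]: "xval A i z p < q"
  by (simp_all add: ell_def xval_def)

lemma mu_less [simp]: "mu a b < q"
  using find_cases[of q "\<lambda>x. a \<oplus> x \<otimes> b = \<zero>" 0] q2 by (auto simp: mu_def)

lemma mu: "a < q \<Longrightarrow> b < q \<Longrightarrow> b \<noteq> \<zero> \<Longrightarrow> a \<oplus> mu a b \<otimes> b = \<zero>"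
proof -
  assume a: "a < q" "b < q" "b \<noteq> \<zero>"
  then have U: "b \<in> Units F" by (simp add: field_Units)
  have i: "m_inv F b \<in> carrier F" "m_inv F b \<otimes> b = \<one>"
    using Units_inv_closed[OF U] Units_l_inv[OF U] by auto
  let ?x = "\<ominus> (a \<otimes> m_inv F b)"
  have "?x \<otimes> b = \<ominus> (a \<otimes> (m_inv F b \<otimes> b))" using a i by (simp add: l_minus m_assoc del: in_carrier flip: in_carrier)
  then have "a \<oplus> ?x \<otimes> b = \<zero>" using a i by (simp add: r_neg del: in_carrier flip: in_carrier)
  moreover have "?x < q" using a i by (simp del: in_carrier flip: in_carrier)
  ultimately show ?thesis
    using find_cases[of q "\<lambda>x. a \<oplus> x \<otimes> b = \<zero>" 0] by (auto simp: mu_def)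
qed

lemma off_0 [simp]: "off 0 = 0" and off_1: "off (Suc 0) = n0" and off_2: "off 2 = n0 + n1"
  by (simp_all add: off_def n0_def n1_def numeral_2_eq_2)

lemma off_Suc: "off (Suc d) = off d + ns ! d"
  by (simp add: off_def)

lemma off_mono: "d \<le> d' \<Longrightarrow> off d \<le> off d'"
  unfolding off_def by (rule sum_mono2) auto

lemma off_sum_list: "off D = sum_list ns"
  by (simp add: off_def sum_list_sum_nth atLeast0LessThan)

lemma off_less: "d < d' \<Longrightarrow> j < ns ! d \<Longrightarrow> off d + j < off d'"
  using off_mono[of "Suc d" d'] by (simp add: off_Suc)

lemma row:
  assumes "1 \<le> d" "d < D" "j < ns ! d"
  shows "n0 \<le> off d + j" "off d + j < off D" "d = 1 \<Longrightarrow> off d + j = n0 + j \<and> j < n1"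
    "2 \<le> d \<Longrightarrow> n0 + n1 \<le> off d + j"
proof -
  show "n0 \<le> off d + j" using off_mono[of "Suc 0" d] assms by (simp add: off_1)
  show "off d + j < off D" using assms by (intro off_less)
  show "d = 1 \<Longrightarrow> off d + j = n0 + j \<and> j < n1" using assms by (simp add: off_1 n1_def)
  show "2 \<le> d \<Longrightarrow> n0 + n1 \<le> off d + j" using off_mono[of 2 d] by (simp add: off_2)
qed

lemma dof:
  assumes "d < D" "j < ns ! d"
  shows "dof (off d + j) = d"
proof -
  have "off (Suc e) \<le> off d + j \<longleftrightarrow> e < d" for e
  proof
    assume "e < d"
    then show "off (Suc e) \<le> off d + j" using off_mono[of "Suc e" d] by simp
  next
    assume "off (Suc e) \<le> off d + j"
    then show "e < d" using off_mono[of "Suc d" "Suc e"] assms(2) off_Suc[of d] by fastforce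
  qed
  then have "dof (off d + j) = (\<Sum>e\<in>{..<D}. if e < d then 1 else 0)"
    by (simp add: dof_def of_bool_def)
  also have "\<dots> = card ({..<D} \<inter> {e. e < d})" by (subst sum.If_cases) auto
  also have "{..<D} \<inter> {e. e < d} = {..<d}" using assms(1) by auto
  finally show ?thesis by simp
qed

lemma index_HR:
  assumes "t < off D" "r < R"
  shows "t * R + r < H" "(t * R + r) div R = t" "(t * R + r) mod R = r"
proof -
  have "(t + 1) * R \<le> off D * R" using assms by (intro mult_le_mono1) simp
  then show "t * R + r < H" using assms by (simp add: H_def)
qed (use assms in auto)

lemma index_N:
  assumes "k < N" "j < N"
  shows "k * N + j < N * N" "(k * N + j) div N = k" "(k * N + j) mod N = j"
proof -
  have "(k + 1) * N \<le> N * N" using assms by (intro mult_le_mono1) simp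
  then show "k * N + j < N * N" using assms by simp
qed (use assms in auto)

lemma n0_off: "t < n0 \<Longrightarrow> t < off D"
  using off_mono[of "Suc 0" D] D by (simp add: off_1)

subsection \<open>Solving the linear systems\<close>

lemma sm_append:
  "(\<And>k. f k \<in> carrier F) \<Longrightarrow>
    (\<Oplus>k\<in>{..<a + (b::nat)}. f k) = (\<Oplus>k\<in>{..<a}. f k) \<oplus> (\<Oplus>k\<in>{..<b}. f (a + k))"
proof (induction b)
  case 0
  then show ?case using sm_closed[of a f] by simp
next
  case (Suc b)
  have "(\<Oplus>k\<in>{..<a}. f k) \<in> carrier F" "(\<Oplus>k\<in>{..<b}. f (a + k)) \<in> carrier F"
    using Suc.prems sm_closed[of a f] sm_closed[of b "\<lambda>k. f (a + k)"] by blast+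
  then show ?case using Suc sm_Suc[of "a + b" f] sm_Suc[of b "\<lambda>k. f (a + k)"]
    by (simp add: a_assoc del: in_carrier lessThan_Suc)
qed

text \<open>At position \<open>p\<close> exactly one of the unit vectors in axis 1 does not
  vanish.\<close>

lemma lc_gen:
  assumes "\<And>k. y k < q"
  shows "lc N y (gen A i w) p = lc R y (fv A i) p \<oplus> y (R + \<pi> 1 p) \<otimes> wt w p"
proof -
  have "\<pi> 1 p < n1" using coord_less[of 1] D by (simp add: n1_def)
  have "lc R y (gen A i w) p = lc R y (fv A i) p"
    by (rule sm_cong) (use assms in \<open>auto simp: gen_def\<close>)
  moreover have "(\<Oplus>k\<in>{..<n1}. y (R + k) \<otimes> gen A i w (R + k) p)
      = (\<Oplus>k\<in>{..<n1}. if k = \<pi> 1 p then y (R + \<pi> 1 p) \<otimes> wt w p else \<zero>)"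
    by (rule sm_cong) (use assms in \<open>auto simp: gen_def\<close>)
  moreover have "\<dots> = y (R + \<pi> 1 p) \<otimes> wt w p"
    using \<open>\<pi> 1 p < n1\<close> assms by (intro sm_delta) auto
  ultimately show ?thesis unfolding N_def by (subst sm_append) (use assms in auto)
qed

lemma solve_nproj:
  "nproj N (gen A i w) n (\<lambda>k j. dg (solve A i w n) (k * N + j))"
proof (induction n)
  case 0
  show ?case
    by (rule nproj_0) (auto simp: solve_def digit_code index_N)
next
  case (Suc n)
  define Y where "Y = solve A i w n"
  have S: "solve A i w (Suc n) = step A i w n Y" by (simp add: solve_def Y_def)
  let ?k = "piv A i w Y n"
  consider "?k < N" "ell A i w Y ?k n \<noteq> \<zero>" | "?k = N" "\<forall>k<N. ell A i w Y k n = \<zero>"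
    using find_cases[of N "\<lambda>k. ell A i w Y k n \<noteq> \<zero>" N] unfolding piv_def by blast
  then show ?case
  proof cases
    case 1
    show ?thesis unfolding S
    proof (rule nproj_step[OF Suc.IH[folded Y_def], where ?k0.0 = ?k and
          \<mu> = "\<lambda>k. mu (ell A i w Y k n) (ell A i w Y ?k n)"])
      show "lc N (\<lambda>j. dg Y (?k * N + j)) (gen A i w) n \<noteq> \<zero>" using 1 by (simp add: ell_def)
    next
      fix k assume "k < N"
      show "lc N (\<lambda>j. dg Y (k * N + j)) (gen A i w) n \<oplus>
          mu (ell A i w Y k n) (ell A i w Y ?k n) \<otimes>
          lc N (\<lambda>j. dg Y (?k * N + j)) (gen A i w) n = \<zero>"
        using mu[of "ell A i w Y k n" "ell A i w Y ?k n"] 1 by (simp add: ell_def)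
    next
      fix k j assume "k < N" "j < N"
      then show "dg (step A i w n Y) (k * N + j) = dg Y (k * N + j) \<oplus>
          mu (ell A i w Y k n) (ell A i w Y ?k n) \<otimes> dg Y (?k * N + j)"
        using 1(1) index_N[of k j] by (simp add: step_def digit_code Let_def)
    qed (use 1 in auto)
  next
    case 2
    then have "step A i w n Y = Y" by (simp add: step_def Let_def)
    then show ?thesis unfolding S
      using nproj_skip[OF Suc.IH[folded Y_def]] 2 by (simp add: ell_def)
  qed
qed

text \<open>Every row of the projection lies in the kernel, which yields the relation; the choice of
  the row makes its coefficient at the slice nonzero. So a success is sound for every
  \<open>w\<close>, wherever it comes from.\<close>

lemma attempt_Suc:
  assumes "attempt A i w = Suc A'" "i < n0"
  obtains y where "\<And>k. y k < q" "y i \<noteq> \<zero>"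
    "\<And>p. p < m \<Longrightarrow> lc R y (fv A i) p \<oplus> tens A' i p = \<zero>"
    "\<And>t. t < n0 \<Longrightarrow> dg A' (t * R + i) = dg A (t * R + i) \<otimes> mu \<one> (y i)"
    "\<And>t r. t < n0 \<Longrightarrow> r < R \<Longrightarrow> r \<noteq> i \<Longrightarrow>
       dg A' (t * R + r) = dg A (t * R + r) \<oplus> dg A (t * R + i) \<otimes> mu \<one> (y i) \<otimes> y r"
    "\<And>r p. r < R \<Longrightarrow> r \<noteq> i \<Longrightarrow> tens A' r p = tens A r p"
proof -
  define Y where "Y = solve A i w m"
  define k where "k = find (\<lambda>k. dg Y (k * N + i) \<noteq> \<zero>) N N"
  have k: "k < N" and A': "A' = update A i w Y k"
    using assms(1) by (auto simp: attempt_def Let_def Y_def[symmetric] k_def[symmetric] split: if_splits)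
  have ki: "dg Y (k * N + i) \<noteq> \<zero>"
    using find_cases[of N "\<lambda>k. dg Y (k * N + i) \<noteq> \<zero>" N] k unfolding k_def by auto
  define y where "y = (\<lambda>j. dg Y (k * N + j))"
  have iR: "i < R" using assms(2) R by (simp add: n0_def)
  have dA': "dg A' (t * R + r) = (if t < n0 then
       let a = dg A (t * R + i) \<otimes> mu \<one> (y i) in
       if r = i then a else dg A (t * R + r) \<oplus> a \<otimes> y r
     else if r = i then
       if t < n0 + n1 then y (R + (t - n0)) else dg w (t - n0 - n1)
     else dg A (t * R + r))" if "t < off D" "r < R" for t r
    unfolding A' update_def using index_HR[OF that]
    by (subst digit_code) (auto simp: Let_def y_def)
  have "tens A' r p = tens A r p" if "r < R" "r \<noteq> i" for r p
    unfolding tens_def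
  proof (rule rk1_cong)
    fix d j assume "1 \<le> d" "d < D" "j < ns ! d"
    from row[OF this] show "fac A' r d j = fac A r d j"
      unfolding fac_def using that by (subst dA') auto
  qed simp
  moreover have x: "tens A' i p = y (R + \<pi> 1 p) \<otimes> wt w p" for p
  proof -
    have "fac A' i 1 (\<pi> 1 p) = y (R + \<pi> 1 p)"
      unfolding fac_def using row[of 1 "\<pi> 1 p"] D iR coord_less[of 1 p] by (subst dA') auto
    moreover have "rk1 2 D \<pi> (fac A' i) p = wt w p" unfolding wt_def
    proof (rule rk1_cong)
      fix d j assume d: "2 \<le> d" "d < D" "j < ns ! d"
      then have "1 \<le> d" by simp
      from row[OF this d(2,3)] show "fac A' i d j = wfac w d j"
        unfolding fac_def wfac_def using iR d by (subst dA') auto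
    qed simp
    ultimately show ?thesis
      unfolding tens_def using D by (subst rk1_split) (auto simp: numeral_2_eq_2)
  qed
  moreover have "lc R y (fv A i) p \<oplus> tens A' i p = \<zero>" if "p < m" for p
  proof -
    have "lc N y (gen A i w) p = \<zero>"
      using solve_nproj[of A i w m] k that unfolding nproj_def null_def y_def Y_def by blast
    then show ?thesis unfolding x by (subst (asm) lc_gen) (auto simp: y_def)
  qed
  moreover have "y j < q" for j by (simp add: y_def)
  moreover have "y i \<noteq> \<zero>" using ki by (simp add: y_def)
  moreover have "dg A' (t * R + i) = dg A (t * R + i) \<otimes> mu \<one> (y i)" if "t < n0" for t
    using dA'[OF n0_off[OF that] iR] that by simp
  moreover have "dg A' (t * R + r) = dg A (t * R + r) \<oplus> dg A (t * R + i) \<otimes> mu \<one> (y i) \<otimes> y r"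
    if "t < n0" "r < R" "r \<noteq> i" for t r
    using dA'[OF n0_off[OF that(1)] that(2)] that by simp
  ultimately show thesis using that by blast
qed

text \<open>The vector composed of \<open>a\<close> and the negative of \<open>v\<close> solves the
  system and is reproduced by the projection: its entry at \<open>i\<close> is a combination of
  column \<open>i\<close> of \<open>Y\<close>. As this entry is nonzero, some row is nonzero there.
  The relation found in this way may differ from the given one.\<close>

lemma attempt_complete:
  assumes a: "\<And>k. a k < q" "\<And>l. v l < q" "a i \<noteq> \<zero>" and i: "i < R"
    and rel: "\<And>p. p < m \<Longrightarrow> lc R a (fv A i) p = v (\<pi> 1 p) \<otimes> wt w p"
  shows "attempt A i w \<noteq> 0"
proof -
  define Y where "Y = solve A i w m"
  define z where "z = (\<lambda>k. if k < R then a k else \<ominus> v (k - R))"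
  have mv: "\<ominus> v l < q" for l using a a_inv_closed[of "v l"] by simp
  have z: "z k < q" for k using a mv by (simp add: z_def)
  have "null N (gen A i w) m z" unfolding null_def
  proof (intro allI impI)
    fix p assume p: "p < m"
    have "lc R z (fv A i) p = lc R a (fv A i) p"
      by (rule sm_cong) (use a in \<open>auto simp: z_def\<close>)
    then have "lc N z (gen A i w) p = v (\<pi> 1 p) \<otimes> wt w p \<oplus> \<ominus> v (\<pi> 1 p) \<otimes> wt w p"
      using z by (subst lc_gen) (auto simp: z_def rel[OF p])
    also have "\<dots> = \<zero>" using a by (simp add: l_minus r_neg)
    finally show "lc N z (gen A i w) p = \<zero>" .
  qed
  then have s: "(\<Oplus>k\<in>{..<N}. z k \<otimes> dg Y (k * N + i)) = z i"
    using solve_nproj[of A i w m] z i unfolding nproj_def Y_def N_def by auto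
  have "\<exists>k<N. dg Y (k * N + i) \<noteq> \<zero>"
  proof (rule ccontr)
    assume "\<not> ?thesis"
    then have "(\<Oplus>k\<in>{..<N}. z k \<otimes> dg Y (k * N + i)) = \<zero>"
      using z by (intro sm_zero) auto
    then show False using s a i by (simp add: z_def)
  qed
  then show ?thesis
    using find_cases[of N "\<lambda>k. dg Y (k * N + i) \<noteq> \<zero>" N]
    by (auto simp: attempt_def Let_def Y_def[symmetric])
qed

subsection \<open>Soundness\<close>

text \<open>The first two conditions put the initial frame into the span of the current one, the
  third is the converse. Nothing refers to the particular tensors that were inserted.\<close>

definition frame :: "nat \<Rightarrow> nat \<Rightarrow> nat \<Rightarrow> bool" where
  "frame z i A \<longleftrightarrow>
     (\<forall>r p. n0 \<le> r \<longrightarrow> r < R \<longrightarrow> fv A i r p = fv (init z) 0 r p) \<and>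
     (\<forall>t<n0. \<forall>p<m. tv (t * m + p) = lc R (\<lambda>r. dg A (t * R + r)) (fv A i) p) \<and>
     (\<forall>r<R. inspan R (fv (init z) 0) m (fv A i r))"

lemma frame_init: "frame z 0 (init z)"
proof -
  have "lc R (\<lambda>r. dg (init z) (t * R + r)) (fv (init z) 0) p = tv (t * m + p)" if "t < n0" for t p
  proof -
    have "lc R (\<lambda>r. dg (init z) (t * R + r)) (fv (init z) 0) p
        = (\<Oplus>r\<in>{..<R}. if r = t then tv (t * m + p) else \<zero>)"
    proof (rule sm_cong)
      fix r assume r: "r < R"
      have "dg (init z) (t * R + r) = (if t = r then \<one> else \<zero>)"
        unfolding init_def using index_HR[OF n0_off[OF that] r] that by (subst digit_code) auto
      then show "dg (init z) (t * R + r) \<otimes> fv (init z) 0 r p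
          = (if r = t then tv (t * m + p) else \<zero>)"
        using that by (auto simp: fv_def)
    qed auto
    also have "\<dots> = tv (t * m + p)" using that R by (intro sm_delta) (auto simp: n0_def)
    finally show ?thesis .
  qed
  then show ?thesis by (auto simp: frame_def intro: inspan_base)
qed

lemma frame_attempt:
  assumes f: "frame z i A" and i: "i < n0" and t: "attempt A i w = Suc A'"
  shows "frame z (Suc i) A'"
proof -
  from attempt_Suc[OF t i] obtain y where y: "\<And>k. y k < q" "y i \<noteq> \<zero>"
    and rel: "\<And>p. p < m \<Longrightarrow> lc R y (fv A i) p \<oplus> tens A' i p = \<zero>"
    and di: "\<And>t. t < n0 \<Longrightarrow> dg A' (t * R + i) = dg A (t * R + i) \<otimes> mu \<one> (y i)"
    and dr: "\<And>t r. t < n0 \<Longrightarrow> r < R \<Longrightarrow> r \<noteq> i \<Longrightarrow>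
       dg A' (t * R + r) = dg A (t * R + r) \<oplus> dg A (t * R + i) \<otimes> mu \<one> (y i) \<otimes> y r"
    and tr: "\<And>r p. r < R \<Longrightarrow> r \<noteq> i \<Longrightarrow> tens A' r p = tens A r p" by blast
  have iR: "i < R" using i R by (simp add: n0_def)
  let ?x = "tens A' i"
  have fv': "fv A' (Suc i) r p = ((fv A i)(i := ?x)) r p" if "r < R" for r p
    using that tr[of r p] i by (auto simp: fv_def)
  have "\<one> \<oplus> mu \<one> (y i) \<otimes> y i = \<zero>" using y by (intro mu) auto
  then have mu1: "\<one> \<oplus> y i \<otimes> mu \<one> (y i) = \<zero>"
    using m_comm[of "y i" "mu \<one> (y i)"] y by simp
  have 1: "lc R (\<lambda>r. dg A' (t * R + r)) (fv A' (Suc i)) p = lc R (\<lambda>r. dg A (t * R + r)) (fv A i) p"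
    if t: "t < n0" and p: "p < m" for t p
  proof -
    let ?a = "\<lambda>r. dg A (t * R + r)"
    let ?b = "\<lambda>r. if r = i then ?a i \<otimes> mu \<one> (y i) else ?a r \<oplus> ?a i \<otimes> mu \<one> (y i) \<otimes> y r"
    have "lc R (\<lambda>r. dg A' (t * R + r)) (fv A' (Suc i)) p = lc R ?b ((fv A i)(i := ?x)) p"
      by (rule sm_cong) (use y in \<open>auto simp: fv' di[OF t] dr[OF t]\<close>)
    also have "\<dots> = lc R ?a (fv A i) p"
      by (rule exchange) (use y mu1 rel[OF p] iR in auto)
    finally show ?thesis .
  qed
  have my: "\<ominus> y k < q" for k using y a_inv_closed[of "y k"] by simp
  have "?x p = lc R (\<lambda>k. \<ominus> y k) (fv A i) p" if "p < m" for p
  proof -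
    have c: "lc R y (fv A i) p \<in> carrier F" "?x p \<in> carrier F" using y by auto
    have "lc R (\<lambda>k. \<ominus> y k) (fv A i) p \<oplus> lc R y (fv A i) p
        = (\<Oplus>k\<in>{..<R}. \<ominus> y k \<otimes> fv A i k p \<oplus> y k \<otimes> fv A i k p)"
      by (subst sm_add) (use y my in auto)
    also have "\<dots> = \<zero>" by (rule sm_zero) (use y in \<open>auto simp: l_minus l_neg\<close>)
    finally have "\<ominus> lc R y (fv A i) p = lc R (\<lambda>k. \<ominus> y k) (fv A i) p"
      using c my by (intro minus_equality) auto
    moreover have "\<ominus> lc R y (fv A i) p = ?x p"
      using c rel[OF that] a_comm[OF c] by (intro minus_equality) simp_all
    ultimately show ?thesis by simp
  qed
  then have x: "inspan R (fv A i) m ?x"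
    unfolding inspan_def using my by (intro exI[of _ "\<lambda>k. \<ominus> y k"]) auto
  have "inspan R (fv (init z) 0) m (fv A' (Suc i) r)" if r: "r < R" for r
  proof (cases "r = i")
    case True
    have "fv A' (Suc i) r = ?x" using fv'[OF r] True by auto
    moreover have "inspan R (fv (init z) 0) m ?x"
      by (rule inspan_trans[OF x]) (use f in \<open>auto simp: frame_def\<close>)
    ultimately show ?thesis by simp
  next
    case False
    then have "fv A' (Suc i) r = fv A i r" using fv'[OF r] by auto
    then show ?thesis using f r by (simp add: frame_def)
  qed
  moreover have "fv A' (Suc i) r p = fv (init z) 0 r p" if "n0 \<le> r" "r < R" for r p
    using f fv'[of r p] that i by (auto simp: frame_def)
  ultimately show ?thesis using f 1 by (simp add: frame_def)
qed

lemma frame_inner: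
  assumes "frame z i A" "i < n0" "inner A i = Suc A'"
  shows "frame z (Suc i) A'"
proof -
  obtain z' p where "inner A i = attempt A i (cand A i z' p)"
    using assms(3) first_cases[of "\<lambda>z. first (\<lambda>p. attempt A i (cand A i z p)) m" "q ^ min R wlen"]
      first_cases[of "\<lambda>p. attempt A i (cand A i _ p)" m]
    unfolding inner_def by (metis nat.distinct(1))
  then show ?thesis using frame_attempt assms by simp
qed

lemma frame_stages: "n \<le> n0 \<Longrightarrow> stages z n = Suc A \<Longrightarrow> frame z n A"
proof (induction n arbitrary: A)
  case 0
  then show ?case by (auto simp: stages_def intro: frame_init)
next
  case (Suc n)
  then obtain A0 where "stages z n = Suc A0" by (cases "stages z n") (auto simp: stages_def)
  then show ?case using Suc frame_inner[of z n A0 A] by (simp add: stages_def)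
qed

lemma coord_tl: "js \<in> indices (tl ns) \<Longrightarrow> 1 \<le> d \<Longrightarrow> d < D \<Longrightarrow> \<pi> d (enc (tl ns) js) = js ! (d - 1)"
proof -
  assume a: "js \<in> indices (tl ns)" "1 \<le> d" "d < D"
  then have "0 # js \<in> indices ns" using pos' by (auto simp: indices_ns)
  from coord_enc[OF this a(3)] have "\<pi> d (enc ns (0 # js)) = (0 # js) ! d" .
  then show ?thesis using a by (simp add: enc_ns nth_Cons')
qed

lemma tv_Cons:
  "t < n0 \<Longrightarrow> js \<in> indices (tl ns) \<Longrightarrow> tv (t * m + enc (tl ns) js) = T (t # js)"
  using tv_enc[of "t # js"] by (simp add: indices_ns enc_ns)

text \<open>Axis 0 is split off: row \<open>t\<close> of the first factor holds the coefficients of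
  slice \<open>t\<close> in the rank-one tensors of the other axes. This is the form that
  \<open>frame\<close> maintains.\<close>

lemma is_cpd_iff:
  assumes A: "\<And>d j r. A d j r < q"
  shows "is_cpd F ns T R A \<longleftrightarrow>
    (\<forall>t<n0. \<forall>p<m. tv (t * m + p) = lc R (A 0 t) (\<lambda>r. rk1 1 D \<pi> (\<lambda>d j. A d j r)) p)"
proof -
  have *: "(\<Oplus>r\<in>{..<R}. \<Otimes>d\<in>{..<D}. A d ((t # js) ! d) r)
      = lc R (A 0 t) (\<lambda>r. rk1 1 D \<pi> (\<lambda>d j. A d j r)) (enc (tl ns) js)"
    if "js \<in> indices (tl ns)" for t js
  proof (rule sm_cong)
    fix r
    have "{..<D} = insert 0 {1..<D}" using D by auto
    then have "(\<Otimes>d\<in>{..<D}. A d ((t # js) ! d) r) = A 0 t r \<otimes> (\<Otimes>d\<in>{1..<D}. A d ((t # js) ! d) r)"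
      using A by (simp add: finprod_insert Pi_def)
    also have "(\<Otimes>d\<in>{1..<D}. A d ((t # js) ! d) r) = rk1 1 D \<pi> (\<lambda>d j. A d j r) (enc (tl ns) js)"
      unfolding rk1_def
      by (rule finprod_cong') (use A coord_tl[OF that] in \<open>auto simp: nth_Cons'\<close>)
    finally show "(\<Otimes>d\<in>{..<D}. A d ((t # js) ! d) r)
      = A 0 t r \<otimes> rk1 1 D \<pi> (\<lambda>d j. A d j r) (enc (tl ns) js)" .
  qed (use A in auto)
  have ind: "indices ns = {t # js |t js. t < n0 \<and> js \<in> indices (tl ns)}"
    by (auto simp: indices_ns)
  have "is_cpd F ns T R A \<longleftrightarrow> (\<forall>t<n0. \<forall>js\<in>indices (tl ns). tv (t * m + enc (tl ns) js)
     = lc R (A 0 t) (\<lambda>r. rk1 1 D \<pi> (\<lambda>d j. A d j r)) (enc (tl ns) js))"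
    unfolding is_cpd_def ind using A by (auto simp: * tv_Cons)
  moreover have "(\<forall>js\<in>indices (tl ns). Q (enc (tl ns) js)) \<longleftrightarrow> (\<forall>p<m. Q p)" for Q
    using enc_less[of _ "tl ns"] enc_surj[of _ "tl ns"] unfolding m_tl by blast
  note this[of "\<lambda>p. tv (_ * m + p) = lc R (A 0 _) (\<lambda>r. rk1 1 D \<pi> (\<lambda>d j. A d j r)) p"]
  ultimately show ?thesis by simp
qed

text \<open>At stage \<open>n0\<close> no slice is left in the frame, and the second condition of
  \<open>frame\<close> is the decomposition itself.\<close>

lemma outer_sound:
  assumes "outer = Suc A"
  shows "is_cpd F ns T R (\<lambda>d j r. dg A ((off d + j) * R + r))"
proof -
  obtain z where "stages z n0 = Suc A"
    using first_cases[of "\<lambda>z. stages z n0" "q ^ ((R - n0) * (off D - n0))"] assms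
    unfolding outer_def by auto
  then have "frame z n0 A" by (rule frame_stages[OF order_refl])
  moreover have "fv A n0 r = rk1 1 D \<pi> (\<lambda>d j. dg A ((off d + j) * R + r))" for r
  proof -
    have "fv A n0 r = tens A r" by (rule ext) (simp add: fv_def)
    moreover have "fac A r = (\<lambda>d j. dg A ((off d + j) * R + r))" by (intro ext) (simp add: fac_def)
    ultimately show ?thesis by (simp add: tens_def)
  qed
  ultimately show ?thesis by (subst is_cpd_iff) (auto simp: frame_def)
qed

end

context cpd_instance
begin

subsection \<open>Completeness\<close>

lemma inspan_cong:
  assumes "\<And>k p. k < n \<Longrightarrow> p < l \<Longrightarrow> f k p = g k p" "\<And>p. p < l \<Longrightarrow> x p = y p"
    "\<And>k p. g k p \<in> carrier F" "inspan n f l x"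
  shows "inspan n g l y"
proof -
  obtain c where c: "\<forall>k. c k \<in> carrier F" "\<forall>p<l. x p = lc n c f p"
    using assms(4) by (auto simp: inspan_def)
  have "lc n c f p = lc n c g p" if "p < l" for p
    by (rule sm_cong) (use assms that c in auto)
  then show ?thesis using c assms by (auto simp: inspan_def)
qed

lemma wfac_cand:
  assumes "2 \<le> d" "d < D" "j < ns ! d"
  shows "wfac (cand A i z p) d j =
    (if wlen \<le> R then dg z (off d + j - n0 - n1) else xval A i z (upd ns p d j))"
proof -
  have d: "1 \<le> d" using assms by simp
  note r = row[OF d assms(2,3)]
  let ?h = "off d + j - n0 - n1"
  have "?h < wlen" "?h + n0 + n1 = off d + j" using r assms by (auto simp: wlen_def)
  then show ?thesis
    unfolding wfac_def cand_def using dof[OF assms(2,3)]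
    by (subst digit_code) (auto simp: Let_def)
qed

lemma inner_complete:
  assumes a: "\<And>k. a k < q" "a i \<noteq> \<zero>" and i: "i < R" and v: "\<And>d j. v d j < q"
    and x: "\<And>p. p < m \<Longrightarrow> lc R a (fv A i) p = x p"
    and cases: "(\<forall>p. x p = \<zero>) \<or> x = rk1 1 D \<pi> v"
  shows "inner A i \<noteq> 0"
proof -
  have "\<exists>z<q ^ min R wlen. \<exists>p<m. attempt A i (cand A i z p) \<noteq> 0"
  proof (cases "\<forall>p<m. x p = \<zero>")
    case True
    \<comment> \<open>The zero tensor arises from any candidate with \<open>v = 0\<close>, so the
      very first one serves.\<close>
    have "0 < q ^ min R wlen" using q2 by simp
    moreover have "attempt A i (cand A i 0 0) \<noteq> 0"
      by (rule attempt_complete[of a "\<lambda>_. \<zero>"]) (use a i x True in auto)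
    ultimately show ?thesis using m_pos by blast
  next
    case False
    then obtain p0 where p0: "p0 < m" "x p0 \<noteq> \<zero>" by blast
    then have xv: "x = rk1 1 D \<pi> v" using cases by auto
    show ?thesis
    proof (cases "wlen \<le> R")
      case True
      \<comment> \<open>\<open>z\<close> spells out the factors of the axes from 2 on.\<close>
      define z where "z = code q wlen (\<lambda>h. v (dof (h + n0 + n1)) (h + n0 + n1 - off (dof (h + n0 + n1))))"
      have z: "z < q ^ min R wlen" using True code_less[of wlen _ q] v by (simp add: z_def min_def)
      have "wfac (cand A i z p0) d j = v d j" if "2 \<le> d" "d < D" "j < ns ! d" for d j
      proof -
        have d: "1 \<le> d" using that by simp
        note r = row[OF d that(2,3)]
        let ?h = "off d + j - n0 - n1"
        have "?h < wlen" "?h + n0 + n1 = off d + j" using r that by (auto simp: wlen_def)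
        then have "dg z ?h = v d j"
          unfolding z_def using dof[OF that(2,3)] v by (subst digit_code) auto
        then show ?thesis using wfac_cand[OF that] True by simp
      qed
      then have "wt (cand A i z p0) p = rk1 2 D \<pi> v p" for p
        unfolding wt_def by (intro rk1_cong) (use v in auto)
      then have "x p = v 1 (\<pi> 1 p) \<otimes> wt (cand A i z p0) p" for p
        unfolding xv using D v by (subst rk1_split) (auto simp: numeral_2_eq_2)
      then have "attempt A i (cand A i z p0) \<noteq> 0"
        by (intro attempt_complete[of a "v 1"]) (use a i x v in auto)
      then show ?thesis using z p0 by blast
    next
      case False
      \<comment> \<open>\<open>z\<close> lists the coefficients of \<open>x\<close> in the frame,
        and \<open>p0\<close>, where \<open>x\<close> does not vanish, is the base point of the
        fibers.\<close>
      define z where "z = code q R a"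
      have z: "z < q ^ min R wlen" using False code_less[of R a q] a by (simp add: z_def min_def)
      have xz: "xval A i z p = x p" if "p < m" for p
      proof -
        have "xval A i z p = lc R a (fv A i) p" unfolding xval_def
          by (rule sm_cong) (use a in \<open>auto simp: z_def digit_code\<close>)
        then show ?thesis using x that by simp
      qed
      let ?w = "wfac (cand A i z p0)"
      have u: "upd ns p0 d j < m" if "2 \<le> d" "d < D" "j < ns ! d" for d j
        using upd_less[of ns d j p0] pos that p0 by (auto simp: m_def)
      have "\<exists>v1. (\<forall>l. v1 l \<in> carrier F) \<and> (\<forall>p<m. x p = v1 (\<pi> 1 p) \<otimes> rk1 2 D \<pi> ?w p)"
      proof (rule rk1_fibers[of v D m x \<pi> "\<lambda>d. ns ! d" "upd ns" p0 ?w])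
        fix d j d' assume "2 \<le> d" "d < D" "j < ns ! d" "1 \<le> d'" "d' < D"
        then show "\<pi> d' (upd ns p0 d j) = (if d' = d then j else \<pi> d' p0)"
          by (intro upd_coord pos) auto
      next
        fix d j assume d: "2 \<le> d" "d < D" "j < ns ! d"
        then show "?w d j = x (upd ns p0 d j)"
          using wfac_cand[OF d, of A i z p0] False xz u by auto
      qed (use v D xv p0 u in auto)
      then obtain v1 where v1: "\<And>l. v1 l < q" "\<And>p. p < m \<Longrightarrow> x p = v1 (\<pi> 1 p) \<otimes> wt (cand A i z p0) p"
        by (auto simp: wt_def)
      have "attempt A i (cand A i z p0) \<noteq> 0"
        by (rule attempt_complete[of a v1]) (use a i x v1 in auto)
      then show ?thesis using z p0 by blast
    qed
  qed
  then show ?thesis unfolding inner_def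
    using first_cases[of "\<lambda>z. first (\<lambda>p. attempt A i (cand A i z p)) m" "q ^ min R wlen"]
      first_cases[of "\<lambda>p. attempt A i (cand A i _ p)" m] by metis
qed

lemma outer_complete:
  assumes concise: "axis_concise F ns T 0" and cpd: "is_cpd F ns T R A0"
  shows "outer \<noteq> 0"
proof -
  \<comment> \<open>\<open>is_cpd\<close> leaves the entries outside the matrices arbitrary; zeros
    turn all of them into field elements.\<close>
  define A where "A = (\<lambda>d j r. if A0 d j r < q then A0 d j r else \<zero>)"
  have A: "A d j r < q" for d j r by (simp add: A_def)
  have "is_cpd F ns T R A"
    by (rule is_cpd_cong[OF field_axioms cpd]) (use cpd in \<open>auto simp: is_cpd_def A_def\<close>)
  then have TA: "tv (t * m + p) = lc R (A 0 t) (\<lambda>r. rk1 1 D \<pi> (\<lambda>d j. A d j r)) p"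
    if "t < n0" "p < m" for t p
    using that is_cpd_iff[of A] A by blast
  define u where "u = (\<lambda>r. rk1 1 D \<pi> (\<lambda>d j. A d j r))"
  have u: "u r p < q" for r p unfolding u_def using A by simp
  define S where "S = (\<lambda>t p. tv (t * m + p))"
  have S: "S t p < q" for t p by (simp add: S_def)
  have Su: "inspan R u m (S t)" if "t < n0" for t
    unfolding inspan_def S_def using TA[OF that] A by (intro exI[of _ "A 0 t"]) (auto simp: u_def)
  have "\<exists>\<sigma>. bij_betw \<sigma> {..<R} {..<R} \<and>
    (\<forall>r<R. inspan R (\<lambda>r. if r < n0 then S r else u (\<sigma> r)) m (u r))"
  proof (rule steinitz[where u = u and T = S and ?n0.0 = n0 and n = R and m = m])
    show "n0 \<le> R" using R by (simp add: n0_def)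
  next
    fix a k assume a: "\<And>k. a k \<in> carrier F" "\<And>p. p < m \<Longrightarrow> lc n0 a S p = \<zero>" and k: "k < n0"
    have "(\<Oplus>i\<in>{..<n0}. a i \<otimes> slice T 0 i js) = \<zero>" if "js \<in> indices (tl ns)" for js
    proof -
      have "T (i # js) < q" if "i < n0" for i
        using tv_Cons[OF that \<open>js \<in> indices (tl ns)\<close>] tv_less by metis
      note Tq = this
      have "(\<Oplus>i\<in>{..<n0}. a i \<otimes> slice T 0 i js) = lc n0 a S (enc (tl ns) js)"
        by (rule sm_cong) (use a S Tq in \<open>auto simp: slice_def S_def tv_Cons[OF _ that]\<close>)
      then show ?thesis using a(2) enc_less[OF that] by (simp add: m_tl)
    qed
    then show "a k = \<zero>"
      using concise a(1) k unfolding axis_concise_def lin_indep_family_def n0_def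
      by (auto simp: drop_Suc)
  qed (use u S Su in auto)
  then obtain \<sigma> where sp: "\<And>r. r < R \<Longrightarrow> inspan R (\<lambda>r. if r < n0 then S r else u (\<sigma> r)) m (u r)"
    and bij: "bij_betw \<sigma> {..<R} {..<R}"
    by blast
  define K where "K = R - n0"
  \<comment> \<open>The guess that succeeds: the columns \<open>\<sigma> r\<close> with
    \<open>r \<ge> n0\<close> of all factors but the first, in the layout read by
    \<open>init\<close>.\<close>
  define z where "z = code q (K * (off D - n0)) (\<lambda>h.
    let d = dof (n0 + h div K) in A d (n0 + h div K - off d) (\<sigma> (n0 + h mod K)))"
  have z: "z < q ^ (K * (off D - n0))" unfolding z_def by (rule code_less) (simp add: A Let_def)
  have fu: "fv (init z) 0 r p = (if r < n0 then S r p else u (\<sigma> r) p)" if r: "r < R" for r p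
  proof (cases "r < n0")
    case False
    have "tens (init z) r p = u (\<sigma> r) p" unfolding tens_def u_def
    proof (rule rk1_cong)
      fix d j assume d: "1 \<le> d" "d < D" "j < ns ! d"
      note rw = row[OF d]
      let ?t = "off d + j"
      let ?h = "(?t - n0) * K + (r - n0)"
      have K: "r - n0 < K" using False r by (simp add: K_def)
      then have "(?t - n0 + 1) * K \<le> (off D - n0) * K" using rw by (intro mult_le_mono1) auto
      then have h: "?h < K * (off D - n0)" using K by (simp add: mult.commute)
      have hd: "?h div K = ?t - n0" "?h mod K = r - n0" using K by auto
      have "fac (init z) r d j = dg z ?h"
        unfolding fac_def init_def using index_HR[OF rw(2) r] rw False
        by (subst digit_code) (auto simp: K_def)
      also have "\<dots> = A d j (\<sigma> r)"
        unfolding z_def using h hd rw False dof[OF d(2,3)] A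
        by (subst digit_code) (auto simp: Let_def)
      finally show "fac (init z) r d j = A d j (\<sigma> r)" .
    qed (use A in auto)
    then show ?thesis using False by (simp add: fv_def)
  qed (simp add: fv_def S_def)
  have stage: "stages z n \<noteq> 0" if "n \<le> n0" for n
    using that
  proof (induction n)
    case (Suc n)
    then obtain A' where A': "stages z n = Suc A'" by (cases "stages z n") auto
    then have fr: "frame z n A'" using Suc.prems by (intro frame_stages) auto
    \<comment> \<open>\<open>A'\<close> is whatever the previous stages happened to produce. The
      initial frame \<open>?g\<close>, the current frame \<open>?f\<close> and the terms
      \<open>u\<close> of the assumed decomposition still span the same space, and
      \<open>exists_exchange\<close> depends on nothing more.\<close>
    let ?g = "fv (init z) 0" and ?f = "fv A' n"
    have gf: "inspan R ?f m (?g r)" if "r < R" for r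
    proof (cases "r < n0")
      case True
      have "inspan R ?f m (S r)" using fr True unfolding inspan_def S_def frame_def
        by (intro exI[of _ "\<lambda>k. dg A' (r * R + k)"]) auto
      then show ?thesis using fu[OF that] True by (rule_tac inspan_cong[where f = ?f and x = "S r"]) auto
    next
      case False
      then have "?g r = ?f r" using fr that by (auto simp: frame_def)
      then show ?thesis using inspan_base[OF that, of ?f m] by simp
    qed
    have gu: "inspan R u m (?g r)" if "r < R" for r
    proof (cases "r < n0")
      case True
      then show ?thesis using fu[OF that] Su u by (rule_tac inspan_cong[where f = u and x = "S r"]) auto
    next
      case False
      have "\<sigma> r < R" using bij that by (auto simp: bij_betw_def)
      then have "inspan R u m (u (\<sigma> r))" using u by (intro inspan_base) auto
      then show ?thesis using fu[OF that] u False by (rule_tac inspan_cong[where f = u and x = "u (\<sigma> r)"]) auto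
    qed
    have ug: "inspan R ?g m (u r)" if "r < R" for r
      by (rule inspan_cong[OF _ _ _ sp[OF that]]) (use fu in auto)
    have nR: "n < R" using Suc.prems R by (simp add: n0_def)
    have fg: "inspan R ?g m (?f n)" using fr nR by (simp add: frame_def)
    have "\<exists>a x. (\<forall>k. a k \<in> carrier F) \<and> a n \<noteq> \<zero> \<and> (\<forall>p<m. lc R a ?f p = x p) \<and>
        ((\<forall>p. x p = \<zero>) \<or> (\<exists>r<R. x = u r))"
    proof (rule exists_exchange[where u = u and f = ?f and i = n and n = R and m = m])
      show "inspan R u m (?f n)" by (rule inspan_trans[OF fg gu]) (use u in auto)
      show "inspan R ?f m (u r)" if "r < R" for r
        by (rule inspan_trans[OF ug[OF that] gf]) auto
    qed (use u nR in auto)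
    then obtain a x where a: "\<And>k. a k < q" "a n \<noteq> \<zero>" "\<And>p. p < m \<Longrightarrow> lc R a ?f p = x p"
      "(\<forall>p. x p = \<zero>) \<or> (\<exists>r<R. x = u r)" by auto
    then obtain r where "(\<forall>p. x p = \<zero>) \<or> x = u r" by blast
    then have "inner A' n \<noteq> 0"
      using a nR A by (intro inner_complete[where v = "\<lambda>d j. A d j r" and x = x and a = a]) (auto simp: u_def)
    then show ?case using A' by (simp add: stages_def)
  qed (simp add: stages_def)
  then show ?thesis
    using first_cases[of "\<lambda>z. stages z n0" "q ^ ((R - n0) * (off D - n0))"] z
    unfolding outer_def K_def by blast
qed

end

section \<open>The program\<close>

definition "Qx = get 0 (lit 0)"
definition "Zerox = get 0 (lit 1)"
definition "Onex = get 0 (lit 2)"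
definition "Dx = get 0 (lit 3)"
definition "Rx = get 0 (lit 4)"
definition "NSx = get 1"
definition "addx a b = get 2 (a [*] Qx [+] b)"
definition "mulx a b = get 3 (a [*] Qx [+] b)"
definition "powx k = xfold 0 k (lit 1) (\<lambda>X I. X [*] Qx)"
definition "digx a k = (a [div] powx k) [mod] Qx"
definition "sumx n f = xfold 0 n (lit 0) (\<lambda>X I. X [+] f I)"
definition "codex n f = xfold 0 n (lit 0) (\<lambda>X I. X [+] f I [*] powx I)"
definition "fsumx n f = xfold 0 n Zerox (\<lambda>X I. addx X (f I))"
definition "fprodx n f = xfold 0 n Onex (\<lambda>X I. mulx X (f I))"
definition "findx n d P = xfold 0 n d (\<lambda>X I. ite (P I) I X)"
definition "firstx k n f = xfold k n (lit 0) (\<lambda>X I. ite X X (f I))"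
definition "offx d = sumx d NSx"
definition "stridex d = xfold 0 (Dx [-] (d [+] lit 1)) (lit 1) (\<lambda>X I. X [*] NSx (d [+] lit 1 [+] I))"
definition "coordx d p = (p [div] stridex d) [mod] NSx d"
definition "n0x = NSx (lit 0)"
definition "n1x = NSx (lit 1)"
definition "mx = stridex (lit 0)"
definition "Nx = Rx [+] n1x"
definition "Hx = offx Dx [*] Rx"
definition "wlenx = offx Dx [-] n0x [-] n1x"
definition "tensx A r p = fprodx (Dx [-] lit 1)
  (\<lambda>I. digx A ((offx (I [+] lit 1) [+] coordx (I [+] lit 1) p) [*] Rx [+] r))"
text \<open>The language has no conjunction and no \<open>\<le>\<close>; a product of truth values
  and an added 1 on the right replace them. Negation below is subtraction from 1.\<close>

definition "fvx A i r p = ite ((r [<] n0x) [*] (i [<] r [+] lit 1)) (get 4 (r [*] mx [+] p)) (tensx A r p)"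
definition "wtx w p = fprodx (Dx [-] lit 2)
  (\<lambda>I. digx w (offx (I [+] lit 2) [+] coordx (I [+] lit 2) p [-] n0x [-] n1x))"
definition "genx A i w k p =
  ite (k [<] Rx) (fvx A i k p) (ite (coordx (lit 1) p [=] k [-] Rx) (wtx w p) Zerox)"
definition "ellx A i w Y k p = fsumx Nx (\<lambda>J. mulx (digx Y (k [*] Nx [+] J)) (genx A i w J p))"
definition "mux a b = findx Qx (lit 0) (\<lambda>X. addx a (mulx X b) [=] Zerox)"
definition "pivx A i w Y p = findx Nx Nx (\<lambda>K. lit 1 [-] (ellx A i w Y K p [=] Zerox))"
definition "stepx A i w p Y = bind (pivx A i w Y p) (\<lambda>K.
  ite (K [<] Nx) (codex (Nx [*] Nx) (\<lambda>h.
    addx (digx Y h) (mulx (mux (ellx A i w Y (h [div] Nx) p) (ellx A i w Y K p))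
      (digx Y (K [*] Nx [+] h [mod] Nx))))) Y)"
definition "solvex A i w = xfold 0 mx
  (codex (Nx [*] Nx) (\<lambda>h. ite (h [div] Nx [=] h [mod] Nx) Onex Zerox)) (\<lambda>Y p. stepx A i w p Y)"
definition "updatex A i w Y k = codex Hx (\<lambda>h.
  ite (h [div] Rx [<] n0x)
    (bind (mulx (digx A (h [div] Rx [*] Rx [+] i)) (mux Onex (digx Y (k [*] Nx [+] i)))) (\<lambda>a.
      ite (h [mod] Rx [=] i) a (addx (digx A h) (mulx a (digx Y (k [*] Nx [+] h [mod] Rx))))))
    (ite (h [mod] Rx [=] i)
      (ite (h [div] Rx [<] n0x [+] n1x) (digx Y (k [*] Nx [+] (Rx [+] (h [div] Rx [-] n0x))))
        (digx w (h [div] Rx [-] n0x [-] n1x)))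
      (digx A h)))"
definition "attemptx A i w = bind (solvex A i w) (\<lambda>Y.
  bind (findx Nx Nx (\<lambda>K. lit 1 [-] (digx Y (K [*] Nx [+] i) [=] Zerox)))
    (\<lambda>K. ite (K [<] Nx) (updatex A i w Y K [+] lit 1) (lit 0)))"
definition "xvalx A i z p = fsumx Rx (\<lambda>r. mulx (digx z r) (fvx A i r p))"
definition "dofx row = sumx Dx (\<lambda>d. offx (d [+] lit 1) [<] row [+] lit 1)"
definition "updx p d j = p [-] coordx d p [*] stridex d [+] j [*] stridex d"
definition "candx A i z p = codex wlenx (\<lambda>h.
  ite (Rx [<] wlenx)
    (bind (dofx (h [+] n0x [+] n1x)) (\<lambda>d.
      xvalx A i z (updx p d (h [+] n0x [+] n1x [-] offx d))))
    (digx z h))"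
definition "minx a b = ite (a [<] b) a b"
definition "innerx A i = firstx 2 (powx (minx Rx wlenx))
  (\<lambda>z. firstx 0 mx (\<lambda>p. bind (candx A i z p) (\<lambda>w. attemptx A i w)))"
definition "initx z = codex Hx (\<lambda>h.
  ite (h [div] Rx [<] n0x) (ite (h [div] Rx [=] h [mod] Rx) Onex Zerox)
    (ite (h [mod] Rx [<] n0x) Zerox
      (digx z ((h [div] Rx [-] n0x) [*] (Rx [-] n0x) [+] (h [mod] Rx [-] n0x)))))"
definition "stagesx z = xfold 0 n0x (initx z [+] lit 1)
  (\<lambda>S i. ite S (bind (S [-] lit 1) (\<lambda>A. innerx A i)) (lit 0))"
text \<open>The only loop with tag 1. Through \<open>innerx\<close> it encloses the only loop with
  tag 2, and the stages in between are a loop with tag 0.\<close>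

definition "outerx = firstx 1 (powx ((Rx [-] n0x) [*] (offx Dx [-] n0x))) stagesx"
definition "solutionx = ite (Dx [=] lit 1)
  (codex Hx (\<lambda>h. ite (h [mod] Rx [=] lit 0) (get 4 (h [div] Rx)) Zerox) [+] lit 1) outerx"
definition "mainx = ite (n0x [=] lit 0) (lit 1) solutionx"

section \<open>Size bounds and evaluation of the basic expressions\<close>

lemma nat_pow_less: "n \<le> Z ^ 4 \<Longrightarrow> 1 < Z \<Longrightarrow> n < 2 ^ (Z ^ 5)" for n Z :: nat
proof -
  assume a: "n \<le> Z ^ 4" "1 < Z"
  have "Z ^ 4 < 2 ^ (Z ^ 4)" by (rule less_exp)
  also have "\<dots> \<le> 2 ^ (Z ^ 5)" using a by (intro power_increasing) auto
  finally show ?thesis using a by simp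
qed

locale machine = field F for F :: "nat ring" (structure) +
  fixes ns :: "nat list" and T :: "nat list \<Rightarrow> nat" and R :: nat
  assumes carrier_eq: "carrier F = {..<order F}"
    and D1: "1 \<le> length ns"
    and T: "T \<in> indices ns \<rightarrow> carrier F" and R: "ns ! 0 \<le> R"
begin

definition Z :: nat where "Z = params F ns R"
text \<open>The loops with tag 0 have length at most \<open>Z ^ 2\<close>, so \<open>Z ^ 3\<close>
  leaves room. The other two values count the guesses and the candidates; their product is the
  exponential factor of the theorem.\<close>

definition Nb :: "nat \<Rightarrow> nat" where
  "Nb k = (if k = 0 then Z ^ 3
     else if k = 1 then order F ^ ((R - ns ! 0) * (\<Sum>d=1..<length ns. ns ! d))
     else order F ^ min R (\<Sum>d=2..<length ns. ns ! d))"

sublocale evaluation "input F ns T R" Nb "Z ^ 5" .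

lemma card2: "2 \<le> order F"
proof -
  have "finite {..<order F}" by simp
  moreover have "{\<zero>, \<one>} \<subseteq> {..<order F}" using zero_closed one_closed unfolding carrier_eq by auto
  ultimately have "card {\<zero>, \<one>} \<le> card {..<order F}" by (rule card_mono)
  then show ?thesis by simp
qed

lemma Z_bounds: "order F + R + length ns + sum_list ns + prod_list ns \<le> Z" "3 \<le> Z"
  using card2 D1 by (simp_all add: Z_def params_def)

lemma le_Z: "order F \<le> Z" "R \<le> Z" "length ns \<le> Z" "sum_list ns \<le> Z" "prod_list ns \<le> Z"
  using Z_bounds(1) by linarith+

lemma small: "n \<le> Z ^ 4 \<Longrightarrow> n < 2 ^ (Z ^ 5)"
  using Z_bounds(2) by (intro nat_pow_less) auto

lemma Z4: "n \<le> Z \<Longrightarrow> n \<le> Z ^ 4" "n \<le> Z ^ 2 \<Longrightarrow> n \<le> Z ^ 4" "n \<le> Z ^ 3 \<Longrightarrow> n \<le> Z ^ 4"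
    "n \<le> Z \<Longrightarrow> n \<le> Z ^ 3" "n \<le> Z ^ 2 \<Longrightarrow> n \<le> Z ^ 3" "n \<le> Z \<Longrightarrow> n \<le> Z ^ 2"
proof -
  have "Z ^ i \<le> Z ^ j" if "i \<le> j" for i j using that Z_bounds(2) by (intro power_increasing) auto
  from this[of 1 4] this[of 2 4] this[of 3 4] this[of 1 3] this[of 2 3] this[of 1 2]
  have "Z \<le> Z ^ 4" "Z ^ 2 \<le> Z ^ 4" "Z ^ 3 \<le> Z ^ 4" "Z \<le> Z ^ 3" "Z ^ 2 \<le> Z ^ 3" "Z \<le> Z ^ 2"
    by simp_all
  then show "n \<le> Z \<Longrightarrow> n \<le> Z ^ 4" "n \<le> Z ^ 2 \<Longrightarrow> n \<le> Z ^ 4" "n \<le> Z ^ 3 \<Longrightarrow> n \<le> Z ^ 4"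
    "n \<le> Z \<Longrightarrow> n \<le> Z ^ 3" "n \<le> Z ^ 2 \<Longrightarrow> n \<le> Z ^ 3" "n \<le> Z \<Longrightarrow> n \<le> Z ^ 2"
    by linarith+
qed

text \<open>The origin of the bit length \<open>Z ^ 5\<close>: a code has polynomially many digits,
  and since every number is below the power of 2 with that exponent, a power of the field order is
  bounded by a power of 2 whose exponent is at most \<open>Z * (Z ^ 3 + 1)\<close>.\<close>

lemma pow_small: "k \<le> Z ^ 3 + 1 \<Longrightarrow> order F ^ k < 2 ^ (Z ^ 5)"
proof -
  assume k: "k \<le> Z ^ 3 + 1"
  have "order F < 2 ^ order F" by (rule less_exp)
  then have "order F ^ k \<le> (2 ^ order F) ^ k" by (intro power_mono) auto
  also have "\<dots> = 2 ^ (order F * k)" by (simp add: power_mult)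
  also have "\<dots> < 2 ^ (Z ^ 5)"
  proof (rule power_strict_increasing)
    have "order F * k \<le> Z * (Z ^ 3 + 1)" using k le_Z by (intro mult_le_mono) auto
    also have "\<dots> < Z ^ 5"
    proof -
      have "Z * (Z ^ 3 + 1) < Z * (2 * Z ^ 3)"
        using Z_bounds(2) one_less_power[of Z 3] by simp
      also have "\<dots> \<le> Z * (Z * Z ^ 3)" using Z_bounds(2) by (intro mult_le_mono) auto
      also have "\<dots> = Z ^ 5" by (simp flip: power_Suc)
      finally show ?thesis .
    qed
    finally show "order F * k < Z ^ 5" .
  qed simp
  finally show ?thesis .
qed

lemma small_num: "n \<le> 3 \<Longrightarrow> n < 2 ^ (Z ^ 5)" for n :: nat
  using Z_bounds(2) by (intro small Z4(1)) auto

lemma Nb0: "Nb 0 = Z ^ 3"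
  by (simp add: Nb_def)

lemma EV_num [intro]: "n \<le> 3 \<Longrightarrow> EV E (lit n) n"
  by (intro EV_lit small_num)

lemma EV_4: "EV E (lit 4) 4"
  using Z_bounds(2) power_mono[of 3 Z 4] by (intro EV_lit small) simp

lemma EV_consts:
  "EV E Qx (order F)" "EV E Zerox \<zero>" "EV E Onex \<one>" "EV E Dx (length ns)" "EV E Rx R"
proof -
  have e: "EV E (get 0 (lit n)) (input F ns T R 0 n)" if "n \<le> 4" for n
    using that EV_num[of n E] EV_4 by (intro EV_get) (auto simp: le_Suc_eq numeral_eq_Suc)
  show "EV E Qx (order F)" using e[of 0] by (simp add: Qx_def input_def mem_of_def)
  show "EV E Zerox \<zero>" using e[of 1] by (simp add: Zerox_def input_def mem_of_def)
  show "EV E Onex \<one>" using e[of 2] by (simp add: Onex_def input_def mem_of_def)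
  show "EV E Dx (length ns)" using e[of 3] by (simp add: Dx_def input_def mem_of_def)
  show "EV E Rx R" using e[of 4] by (simp add: Rx_def input_def mem_of_def)
qed

lemma EV_NS: "EV E d v \<Longrightarrow> v < length ns \<Longrightarrow> EV E (NSx d) (ns ! v)"
  using EV_get[of 1 E d v] by (simp add: NSx_def input_def mem_of_def)

lemma nth_table:
  assumes "x < n" "y < k"
  shows "[f x y. x \<leftarrow> [0..<n], y \<leftarrow> [0..<k]] ! (x * k + y) = f x y"
proof -
  have len: "length [f x y. x \<leftarrow> [0..<j], y \<leftarrow> [0..<k]] = j * k" for j
    by (induction j) auto
  have "[0..<n] = [0..<x] @ x # [Suc x..<n]"
    using assms(1) by (metis upt_conv_Cons upt_add_eq_append zero_le less_imp_le_nat le_add_diff_inverse)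
  then show ?thesis using len[of x] assms(2) by (simp add: nth_append)
qed

lemma length_table: "length [f x y. x \<leftarrow> [0..<n], y \<leftarrow> [0..<k]] = n * k" for n k :: nat
  by (induction n) auto

lemma table_index:
  assumes "x < order F" "y < order F"
  shows "x * order F + y < order F * order F" "x * order F + y < 2 ^ (Z ^ 5)" "x * order F < 2 ^ (Z ^ 5)"
proof -
  have "(x + 1) * order F \<le> order F * order F" using assms by (intro mult_le_mono1) simp
  then show *: "x * order F + y < order F * order F" using assms by simp
  have "order F * order F \<le> Z ^ 2" using le_Z by (simp add: power2_eq_square mult_le_mono)
  then show "x * order F + y < 2 ^ (Z ^ 5)" "x * order F < 2 ^ (Z ^ 5)"
    using * by (intro small Z4(2); linarith)+
qed

lemma EV_addx:
  assumes "EV E a x" "EV E b y" "x < order F" "y < order F"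
  shows "EV E (addx a b) (x \<oplus> y)"
proof -
  have "EV E (addx a b) (input F ns T R 2 (x * order F + y))"
    unfolding addx_def by (intro EV_get EV_add EV_mul assms EV_consts table_index(2,3)[OF assms(3,4)]) auto
  moreover have "input F ns T R 2 (x * order F + y) = x \<oplus> y"
    using table_index(1)[OF assms(3,4)] nth_table[OF assms(3,4)]
    by (simp add: input_def mem_of_def length_table)
  ultimately show ?thesis by (simp only:)
qed

lemma EV_mulx:
  assumes "EV E a x" "EV E b y" "x < order F" "y < order F"
  shows "EV E (mulx a b) (x \<otimes> y)"
proof -
  have "EV E (mulx a b) (input F ns T R 3 (x * order F + y))"
    unfolding mulx_def by (intro EV_get EV_add EV_mul assms EV_consts table_index(2,3)[OF assms(3,4)]) auto
  moreover have "input F ns T R 3 (x * order F + y) = x \<otimes> y"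
    using table_index(1)[OF assms(3,4)] nth_table[OF assms(3,4)]
    by (simp add: input_def mem_of_def length_table)
  ultimately show ?thesis by (simp only:)
qed

lemma EV_pow:
  assumes "EV E a k" "k \<le> Z ^ 3"
  shows "EV E (powx a) (order F ^ k)"
proof -
  have p: "itr (\<lambda>i x. x * order F) i 1 = order F ^ i" for i by (induction i) auto
  have "EV E (powx a) (itr (\<lambda>i x. x * order F) k 1)" unfolding powx_def
  proof (rule EV_xfold)
    fix E' X I i x assume a: "EV E' X x" "i < k" "x = itr (\<lambda>i x. x * order F) i 1"
    have "x * order F = order F ^ Suc i" using a p by simp
    also have "\<dots> < 2 ^ (Z ^ 5)" using a assms by (intro pow_small) auto
    finally show "EV E' (X [*] Qx) (x * order F)" using a by (intro EV_mul EV_consts)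
  qed (use assms Nb0 in auto)
  then show ?thesis by (simp only: p)
qed

lemma EV_dig: "EV E a x \<Longrightarrow> EV E b k \<Longrightarrow> k \<le> Z ^ 3 \<Longrightarrow> EV E (digx a b) (digit (order F) x k)"
  unfolding digx_def digit_def by (intro EV_mod EV_div EV_pow EV_consts)

lemma EV_sum:
  assumes "EV E n k" "k \<le> Z ^ 3"
    and "\<And>E' I i. prefix E E' \<Longrightarrow> EV E' I i \<Longrightarrow> i < k \<Longrightarrow> EV E' (f I) (g i)"
    and "(\<Sum>i<k. g i) < 2 ^ (Z ^ 5)"
  shows "EV E (sumx n f) (\<Sum>i<k. g i)"
proof -
  have p: "itr (\<lambda>i x. x + g i) i 0 = (\<Sum>i<i. g i)" for i by (induction i) auto
  have "EV E (sumx n f) (itr (\<lambda>i x. x + g i) k 0)" unfolding sumx_def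
  proof (rule EV_xfold)
    fix E' X I i x assume a: "prefix E E'" "EV E' X x" "EV E' I i" "i < k"
      "x = itr (\<lambda>i x. x + g i) i 0"
    have "x + g i = (\<Sum>i<Suc i. g i)" using a p by simp
    also have "\<dots> \<le> (\<Sum>i<k. g i)" using a by (intro sum_mono2) auto
    finally show "EV E' (X [+] f I) (x + g i)" using a assms by (intro EV_add assms) auto
  qed (use assms Nb0 in auto)
  then show ?thesis by (simp only: p)
qed

lemma EV_code:
  assumes "EV E n k" "k \<le> Z ^ 3"
    and "\<And>E' I i. prefix E E' \<Longrightarrow> EV E' I i \<Longrightarrow> i < k \<Longrightarrow> EV E' (f I) (g i)"
    and g: "\<And>i. i < k \<Longrightarrow> g i < order F"
  shows "EV E (codex n f) (code (order F) k g)"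
proof -
  let ?h = "\<lambda>i x. x + g i * order F ^ i"
  have p: "itr ?h i 0 = code (order F) i g" for i by (induction i) (auto simp: code_def)
  have "EV E (codex n f) (itr ?h k 0)" unfolding codex_def
  proof (rule EV_xfold)
    fix E' X I i x assume a: "prefix E E'" "EV E' X x" "EV E' I i" "i < k"
      "x = itr ?h i 0"
    have "?h i x = code (order F) (Suc i) g" using a p by (simp add: code_def)
    also have "\<dots> < order F ^ Suc i" using a g by (intro code_less) auto
    also have "\<dots> < 2 ^ (Z ^ 5)" using a assms by (intro pow_small) auto
    finally have l: "?h i x < 2 ^ (Z ^ 5)" .
    then have "g i * order F ^ i < 2 ^ (Z ^ 5)" by linarith
    then show "EV E' (X [+] f I [*] powx I) (?h i x)"
      using a assms l by (intro EV_add EV_mul EV_pow assms) auto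
  qed (use assms Nb0 in auto)
  then show ?thesis by (simp only: p)
qed

lemma EV_find:
  assumes "EV E n k" "k \<le> Z ^ 3" "EV E d x"
    and "\<And>E' I i. prefix E E' \<Longrightarrow> EV E' I i \<Longrightarrow> i < k \<Longrightarrow> EV E' (f I) (of_bool (P i))"
  shows "EV E (findx n d f) (find P k x)"
  unfolding findx_def find_def
proof (rule EV_xfold[OF assms(1,3)])
  fix E' X I i y assume "prefix E E'" "EV E' X y" "EV E' I i" "i < k"
  then show "EV E' (ite (f I) I X) (if P i then i else y)"
    by (intro EV_ite assms) auto
qed (use assms(2) Nb0 in simp)

lemma EV_first:
  assumes "EV E n v" "v \<le> Nb k"
    and "\<And>E' I i. prefix E E' \<Longrightarrow> EV E' I i \<Longrightarrow> i < v \<Longrightarrow> EV E' (f I) (g i)"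
  shows "EV E (firstx k n f) (first g v)"
  unfolding firstx_def first_def
proof (rule EV_xfold[OF assms(1) EV_num])
  fix E' X I i y assume "prefix E E'" "EV E' X y" "EV E' I i" "i < v"
  then show "EV E' (ite X X (f I)) (if y \<noteq> 0 then y else g i)"
    by (intro EV_ite_pos assms) auto
qed (use assms(2) in simp_all)

lemma EV_let:
  assumes "EV E e v" "\<And>E' X. prefix E E' \<Longrightarrow> EV E' X v \<Longrightarrow> EV E' (b X) w"
  shows "EV E (bind e b) w"
proof (rule EV_bind[OF assms(1) _ _ assms(2)])
  show "1 \<le> Nb 0" "1 \<le> Z ^ 5" using Z_bounds(2) by (auto simp: Nb0 Suc_le_eq)
qed

lemma EV_off:
  assumes "EV E e d" "d \<le> length ns"
  shows "EV E (offx e) (\<Sum>i<d. ns ! i)"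
  unfolding offx_def
proof (rule EV_sum[OF assms(1)])
  have "(\<Sum>i<d. ns ! i) \<le> (\<Sum>i<length ns. ns ! i)" using assms by (intro sum_mono2) auto
  also have "\<dots> = sum_list ns" by (simp add: sum_list_sum_nth atLeast0LessThan)
  finally show "(\<Sum>i<d. ns ! i) < 2 ^ (Z ^ 5)" using le_Z by (intro small Z4(1)) linarith
  show "d \<le> Z ^ 3" using assms le_Z by (intro Z4(4)) linarith
qed (use assms in \<open>auto intro: EV_NS\<close>)

end

section \<open>Evaluation of the expressions of the algorithm\<close>

context cpd_instance
begin

sublocale machine F ns T R
  using D T R carrier_eq by unfold_locales auto

lemma EV_num': "EV E (lit 0) 0" "EV E (lit 1) 1" "EV E (lit 2) 2"
  by (intro EV_num; simp)+

lemma small2: "n \<le> Z ^ 2 \<Longrightarrow> n < 2 ^ (Z ^ 5)"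
  by (intro small Z4(2))

lemmas EV_const = EV_consts[folded q_def]
lemmas EV_digit = EV_dig[folded q_def]
lemmas EV_codes = EV_code[folded q_def]
lemmas EV_power = EV_pow[folded q_def]
lemmas EV_plus = EV_addx[folded q_def]
lemmas EV_times = EV_mulx[folded q_def]
lemmas EV_offs = EV_off[folded off_def]

lemma nth_bounds: "d < D \<Longrightarrow> ns ! d \<le> Z"
  using le_Z(4) member_le_sum_list[of "ns ! d" ns] by fastforce

lemma size_bounds: "n0 \<le> Z" "n1 \<le> Z" "m \<le> Z" "off D \<le> Z" "N \<le> Z" "H \<le> Z ^ 2" "N * N \<le> Z ^ 2" "R \<le> Z" "q \<le> Z"
  "d \<le> D \<Longrightarrow> off d \<le> Z" "wlen \<le> Z" "(R - n0) * (off D - n0) \<le> Z ^ 2" "D \<le> Z"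
proof -
  show q: "R \<le> Z" "q \<le> Z" "D \<le> Z" using le_Z by (auto simp: q_def)
  show o: "off D \<le> Z" using le_Z by (simp add: off_sum_list)
  show n: "n0 \<le> Z" "n1 \<le> Z"
    unfolding n0_def n1_def by (rule nth_bounds; use D in linarith)+
  have "m \<le> n0 * m" using pos' by simp
  then show "m \<le> Z" using le_Z(5) prod_ns by linarith
  have "n0 + n1 \<le> off D" using off_mono[of 2 D] D by (simp add: off_2)
  then have "n1 \<le> sum_list ns" by (simp add: off_sum_list)
  then show N: "N \<le> Z" unfolding N_def using Z_bounds(1) by linarith
  show "N * N \<le> Z ^ 2" using N by (simp add: power2_eq_square mult_le_mono)
  show "H \<le> Z ^ 2" unfolding H_def using o q by (simp add: power2_eq_square mult_le_mono)
  show "d \<le> D \<Longrightarrow> off d \<le> Z" using off_mono[of d D] o by simp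
  show "wlen \<le> Z" using o by (simp add: wlen_def)
  have "(R - n0) * (off D - n0) \<le> Z * Z" using o q by (intro mult_le_mono) auto
  then show "(R - n0) * (off D - n0) \<le> Z ^ 2" by (simp add: power2_eq_square)
qed

lemma input_4: "input F ns T R 4 k = tv k"
  using product_lists_upt(1)[of ns] by (simp add: input_def mem_of_def tv_def)

lemma EV_stride:
  assumes "EV E e d" "d < D"
  shows "EV E (stridex e) (stride ns d)"
proof -
  let ?f = "\<lambda>i x. x * ns ! (d + 1 + i)"
  let ?P = "\<lambda>k. prod_list (take k (drop (Suc d) ns))"
  have p: "itr ?f k 1 = ?P k" if "k \<le> D - (d + 1)" for k
    using that by (induction k) (auto simp: take_Suc_conv_app_nth)
  \<comment> \<open>The partial products divide \<open>prod_list ns\<close>, and all dimensions are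
    positive.\<close>
  have le: "?P k \<le> Z" for k
  proof -
    have pp: "1 \<le> prod_list xs" if "set xs \<subseteq> set ns" for xs
      using that pos by (induction xs) (auto simp: in_set_conv_nth Suc_le_eq)
    have "ns = take (Suc d) ns @ take k (drop (Suc d) ns) @ drop k (drop (Suc d) ns)"
      by (metis append_take_drop_id)
    then have "prod_list ns = prod_list (take (Suc d) ns) * ?P k * prod_list (drop k (drop (Suc d) ns))"
      by (metis prod_list.append mult.assoc)
    moreover have "1 \<le> prod_list (take (Suc d) ns)" "1 \<le> prod_list (drop k (drop (Suc d) ns))"
      by (rule pp; meson set_take_subset set_drop_subset subset_trans)+
    then have "1 * ?P k * 1 \<le> prod_list (take (Suc d) ns) * ?P k * prod_list (drop k (drop (Suc d) ns))"
      by (intro mult_le_mono) auto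
    ultimately show ?thesis using le_Z(5) by linarith
  qed
  have "EV E (stridex e) (itr ?f (D - (d + 1)) 1)" unfolding stridex_def
  proof (rule EV_xfold)
    have "d + 1 \<le> Z" using assms le_Z by simp
    then have s: "d + 1 < 2 ^ (Z ^ 5)" by (intro small Z4(1))
    then show "EV E (Dx [-] (e [+] lit 1)) (D - (d + 1))"
      by (intro EV_sub EV_add EV_consts EV_num' assms)
    fix E' X I i x assume a: "prefix E E'" "EV E' X x" "EV E' I i" "i < D - (d + 1)" "x = itr ?f i 1"
    have "d + 1 + i \<le> Z" using a assms le_Z by simp
    then have s2: "d + 1 + i < 2 ^ (Z ^ 5)" by (intro small Z4(1))
    have "?f i x = ?P (Suc i)" using a p[of i] by (simp add: take_Suc_conv_app_nth)
    then have "?f i x < 2 ^ (Z ^ 5)" using le[of "Suc i"] by (intro small Z4(1)) simp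
    then show "EV E' (X [*] NSx (e [+] lit 1 [+] I)) (?f i x)"
      using a s s2 by (intro EV_mul EV_NS EV_add EV_num' EV_mono[OF assms(1)]) auto
  next
    show "D - (d + 1) \<le> Nb 0" unfolding Nb0 using le_Z by (intro Z4(4)) simp
  qed (rule EV_num')
  moreover have "itr ?f (D - (d + 1)) 1 = stride ns d"
    using p[OF order_refl] by (simp add: stride_def)
  ultimately show ?thesis by (simp only:)
qed

lemma EV_coord: "EV E e d \<Longrightarrow> EV E a p \<Longrightarrow> d < D \<Longrightarrow> EV E (coordx e a) (\<pi> d p)"
  unfolding coordx_def coord_def by (intro EV_mod EV_div EV_stride EV_NS)

lemma EV_sizes:
  "EV E n0x n0" "EV E n1x n1" "EV E mx m" "EV E Nx N" "EV E Hx H" "EV E wlenx wlen"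
proof -
  show n: "EV E n0x n0" "EV E n1x n1"
    using D unfolding n0x_def n0_def n1x_def n1_def by (intro EV_NS EV_num'; linarith)+
  show "EV E mx m" unfolding mx_def m_def using D by (intro EV_stride EV_num') linarith
  show "EV E Nx N" unfolding Nx_def N_def
    using size_bounds(5) by (intro EV_add EV_consts n small Z4(1)) (simp add: N_def)
  show "EV E Hx H" unfolding Hx_def H_def
    using size_bounds(6) by (intro EV_mul EV_offs EV_consts small Z4(2)) (simp_all add: H_def)
  show "EV E wlenx wlen" unfolding wlenx_def wlen_def
    by (intro EV_sub EV_offs EV_consts n) simp
qed

lemma EV_rk1:
  assumes "EV E n (D - d0)" "d0 \<le> D" and v: "\<And>d j. v d j < q"
    and f: "\<And>E' I i. prefix E E' \<Longrightarrow> EV E' I i \<Longrightarrow> i < D - d0 \<Longrightarrow>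
      EV E' (f I) (v (i + d0) (\<pi> (i + d0) p))"
  shows "EV E (fprodx n f) (rk1 d0 D \<pi> v p)"
proof -
  let ?g = "\<lambda>i. v (i + d0) (\<pi> (i + d0) p)"
  have p: "itr (\<lambda>i x. x \<otimes> ?g i) k \<one> = (\<Otimes>d\<in>{d0..<d0 + k}. v d (\<pi> d p))" for k
  proof (induction k)
    case (Suc k)
    have "{d0..<d0 + Suc k} = insert (d0 + k) {d0..<d0 + k}" by auto
    then show ?case using Suc v
      by (simp add: finprod_insert Pi_def m_comm add.commute)
  qed simp
  have "EV E (fprodx n f) (itr (\<lambda>i x. x \<otimes> ?g i) (D - d0) \<one>)" unfolding fprodx_def
  proof (rule EV_xfold[OF assms(1) EV_const(3)])
    show "D - d0 \<le> Nb 0" unfolding Nb0 using le_Z by (intro Z4(4)) simp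
    fix E' X I i x assume a: "prefix E E'" "EV E' X x" "EV E' I i" "i < D - d0"
      "x = itr (\<lambda>i x. x \<otimes> ?g i) i \<one>"
    have "x < q" unfolding a(5) p using v by simp
    then show "EV E' (mulx X (f I)) (x \<otimes> ?g i)" using a v by (intro EV_times f) auto
  qed
  then show ?thesis using p[of "D - d0"] assms(2) by (simp add: rk1_def)
qed

lemma EV_lc:
  assumes "EV E n k" "k \<le> Z" and g: "\<And>i. g i < q"
    and f: "\<And>E' I i. prefix E E' \<Longrightarrow> EV E' I i \<Longrightarrow> i < k \<Longrightarrow> EV E' (f I) (g i)"
  shows "EV E (fsumx n f) (\<Oplus>i\<in>{..<k}. g i)"
proof -
  have p: "itr (\<lambda>i x. x \<oplus> g i) k \<zero> = (\<Oplus>i\<in>{..<k}. g i)" for k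
    by (induction k) (use g in \<open>auto simp: sm_Suc simp del: lessThan_Suc\<close>)
  have "EV E (fsumx n f) (itr (\<lambda>i x. x \<oplus> g i) k \<zero>)" unfolding fsumx_def
  proof (rule EV_xfold[OF assms(1) EV_const(2)])
    show "k \<le> Nb 0" unfolding Nb0 using assms(2) by (rule Z4(4))
    fix E' X I i x assume a: "prefix E E'" "EV E' X x" "EV E' I i" "i < k"
      "x = itr (\<lambda>i x. x \<oplus> g i) i \<zero>"
    have "x < q" unfolding a(5) p using g by simp
    then show "EV E' (addx X (f I)) (x \<oplus> g i)" using a g by (intro EV_plus f) auto
  qed
  then show ?thesis by (simp only: p)
qed

lemma EV_tens:
  assumes "EV E A a" "EV E r k" "EV E p x" "k < R"
  shows "EV E (tensx A r p) (tens a k x)"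
  unfolding tensx_def tens_def
proof (rule EV_rk1[OF EV_sub[OF EV_const(4) EV_num'(2)]])
  fix E' I i assume e: "prefix E E'" "EV E' I i" "i < D - 1"
  note e' = assms(1-3)[THEN EV_mono, OF e(1)]
  have d: "i + 1 < D" using e by simp
  then have row: "off (i + 1) + \<pi> (i + 1) x < off D" by (intro off_less) auto
  have b: "(off (i + 1) + \<pi> (i + 1) x) * R + k \<le> Z ^ 2"
    using index_HR(1)[OF row assms(4)] size_bounds(6) by simp
  then have b': "(off (i + 1) + \<pi> (i + 1) x) * R \<le> Z ^ 2" by simp
  have "off (i + 1) + \<pi> (i + 1) x \<le> Z ^ 2" "i + 1 \<le> Z ^ 2"
    using row size_bounds(4) d le_Z by (intro Z4(6); linarith)+
  then show "EV E' (digx A ((offx (I [+] lit 1) [+] coordx (I [+] lit 1) p) [*] Rx [+] r))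
      (fac a k (i + 1) (\<pi> (i + 1) x))"
    unfolding fac_def using b b' d
    by (intro EV_digit EV_add EV_mul EV_offs EV_coord EV_consts EV_num' e e' small2 Z4(5)) simp_all
qed (use D in simp_all)

lemma EV_fv:
  assumes "EV E A a" "EV E i j" "EV E r k" "EV E p x" "k < R" "x < m"
  shows "EV E (fvx A i r p) (fv a j k x)"
  unfolding fvx_def fv_def
proof (rule EV_ite)
  have "EV E ((r [<] n0x) [*] (i [<] r [+] lit 1)) (of_bool (k < n0) * of_bool (j < k + 1))"
    using assms(5) size_bounds(8)
    by (intro EV_mul EV_less EV_sizes EV_add assms EV_num' small Z4(1) small_num) auto
  then show "EV E ((r [<] n0x) [*] (i [<] r [+] lit 1)) (of_bool (k < n0 \<and> j \<le> k))"
    by (simp add: less_Suc_eq_le of_bool_conj)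
next
  assume a: "k < n0 \<and> j \<le> k"
  then have "(k + 1) * m \<le> n0 * m" by (intro mult_le_mono1) simp
  then have "k * m + x < prod_list ns" using assms(6) prod_ns by simp
  then have "k * m + x \<le> Z" "k * m \<le> Z" using le_Z(5) by simp_all
  then have "EV E (get 4 (r [*] mx [+] p)) (input F ns T R 4 (k * m + x))"
    by (intro EV_get EV_add EV_mul EV_sizes assms Z4(1)[THEN small]) simp_all
  then show "EV E (get 4 (r [*] mx [+] p)) (tv (k * m + x))" by (simp only: input_4)
qed (rule EV_tens[OF assms(1,3,4,5)])

lemma EV_wt:
  assumes "EV E w a" "EV E p x"
  shows "EV E (wtx w p) (wt a x)"
  unfolding wtx_def wt_def
proof (rule EV_rk1[OF EV_sub[OF EV_const(4) EV_num'(3)]])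
  fix E' I i assume e: "prefix E E'" "EV E' I i" "i < D - 2"
  note e' = assms[THEN EV_mono, OF e(1)]
  have d: "i + 2 < D" using e by simp
  then have row: "off (i + 2) + \<pi> (i + 2) x < off D" by (intro off_less) auto
  have "off (i + 2) + \<pi> (i + 2) x \<le> Z" "i + 2 \<le> Z" using row size_bounds(4) d le_Z by simp_all
  then show "EV E' (digx w (offx (I [+] lit 2) [+] coordx (I [+] lit 2) p [-] n0x [-] n1x))
      (wfac a (i + 2) (\<pi> (i + 2) x))"
    unfolding wfac_def using d
    by (intro EV_digit EV_sub EV_add EV_mul EV_offs EV_coord EV_sizes EV_num' e e' Z4(4)
        Z4(1)[THEN small]) simp_all
qed (use D in simp_all)

lemma EV_gen:
  assumes "EV E A a" "EV E i j" "EV E w b" "EV E K k" "EV E p x" "x < m"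
  shows "EV E (genx A i w K p) (gen a j b k x)"
  unfolding genx_def gen_def using D
  by (intro EV_ite EV_less EV_equal EV_sub EV_fv EV_wt EV_consts EV_coord EV_num' assms) auto

lemma EV_ell:
  assumes "EV E A a" "EV E i j" "EV E w b" "EV E Y y" "EV E K k" "EV E p x" "x < m" "k < N"
  shows "EV E (ellx A i w Y K p) (ell a j b y k x)"
  unfolding ellx_def ell_def
proof (rule EV_lc[OF EV_sizes(4) size_bounds(5)])
  fix E' I l assume e: "prefix E E'" "EV E' I l" "l < N"
  note e' = assms(1-6)[THEN EV_mono, OF e(1)]
  have "k * N + l \<le> Z ^ 2" "k * N \<le> Z ^ 2" using index_N(1)[OF assms(8) e(3)] size_bounds(7) by simp_all
  then show "EV E' (mulx (digx Y (K [*] Nx [+] I)) (genx A i w I p)) (dg y (k * N + l) \<otimes> gen a j b l x)"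
    by (intro EV_times EV_digit EV_gen EV_add EV_mul EV_sizes e e' Z4(5) Z4(2)[THEN small] assms(7)) simp_all
qed simp

lemma EV_mu:
  assumes "EV E a x" "EV E b y" "x < q" "y < q"
  shows "EV E (mux a b) (mu x y)"
  unfolding mux_def mu_def
proof (rule EV_find[OF EV_const(1) Z4(4)[OF size_bounds(9)] EV_num'(1)])
  fix E' I i assume e: "prefix E E'" "EV E' I i" "i < q"
  note e' = assms(1-2)[THEN EV_mono, OF e(1)]
  show "EV E' (addx a (mulx I b) [=] Zerox) (of_bool (x \<oplus> i \<otimes> y = \<zero>))"
    using e assms by (intro EV_equal EV_plus EV_times EV_const e e') simp_all
qed

lemma EV_neq: "EV E a x \<Longrightarrow> EV E b y \<Longrightarrow> EV E (lit 1 [-] (a [=] b)) (of_bool (x \<noteq> y))"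
  by (rule EV_eq[OF EV_sub[OF EV_num'(2) EV_equal]]) auto

lemma EV_piv:
  assumes "EV E A a" "EV E i j" "EV E w b" "EV E Y y" "EV E p x" "x < m"
  shows "EV E (pivx A i w Y p) (piv a j b y x)"
  unfolding pivx_def piv_def
proof (rule EV_find[OF EV_sizes(4) Z4(4)[OF size_bounds(5)] EV_sizes(4)])
  fix E' I k assume e: "prefix E E'" "EV E' I k" "k < N"
  note e' = assms(1-5)[THEN EV_mono, OF e(1)]
  show "EV E' (lit 1 [-] (ellx A i w Y I p [=] Zerox)) (of_bool (ell a j b y k x \<noteq> \<zero>))"
    by (intro EV_neq EV_ell EV_const e e' assms(6))
qed

lemma EV_step:
  assumes "EV E A a" "EV E i j" "EV E w b" "EV E p x" "EV E Y y" "x < m"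
  shows "EV E (stepx A i w p Y) (step a j b x y)"
  unfolding stepx_def step_def Let_def
proof (rule EV_let[OF EV_piv[OF assms(1-3,5,4,6)]], rule EV_ite, goal_cases)
  case (1 E' K)
  then show ?case by (intro EV_less EV_sizes)
next
  case (2 E' K)
  note e = 2 and e' = assms(1-5)[THEN EV_mono, OF 2(1)]
  show ?case
  proof (rule EV_codes, goal_cases)
    case (3 E'' I h)
    note f' = e'[THEN EV_mono, OF 3(1)] e(2)[THEN EV_mono, OF 3(1)]
    let ?k = "piv a j b y x"
    have h: "h div N < N" "h mod N < N" using 3(3) by (simp_all add: div_less_iff_less_mult pos')
    have "?k * N + h mod N \<le> Z ^ 2" "?k * N \<le> Z ^ 2" "h \<le> Z ^ 2"
      using index_N(1)[OF e(3) h(2)] size_bounds(7) 3(3) by simp_all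
    then show ?case using h e(3)
      by (intro EV_plus EV_times EV_mu EV_ell EV_digit EV_add EV_mul EV_div EV_mod EV_sizes 3 f'
          Z4(5) small2 assms(6)) simp_all
  qed (use size_bounds(7) in \<open>auto intro!: EV_mul EV_sizes small2 Z4(5)\<close>)
next
  case (3 E' K)
  then show ?case using assms(5) EV_mono by blast
qed

lemma EV_solve:
  assumes "EV E A a" "EV E i j" "EV E w b"
  shows "EV E (solvex A i w) (solve a j b m)"
  unfolding solvex_def solve_def
proof (rule EV_xfold)
  show "m \<le> Nb 0" unfolding Nb0 by (rule Z4(4)[OF size_bounds(3)])
  show "EV E (codex (Nx [*] Nx) (\<lambda>h. ite (h [div] Nx [=] h [mod] Nx) Onex Zerox))
      (code q (N * N) (\<lambda>h. if h div N = h mod N then \<one> else \<zero>))"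
    using size_bounds(7)
    by (intro EV_codes EV_mul EV_sizes EV_ite EV_equal EV_div EV_mod EV_const Z4(5)) (auto intro!: small Z4(2))
  fix E' X I p x assume e: "prefix E E'" "EV E' X x" "EV E' I p" "p < m"
  then show "EV E' (stepx A i w I X) (step a j b p x)"
    by (intro EV_step assms[THEN EV_mono])
qed (rule EV_sizes)

lemma EV_update:
  assumes "EV E A a" "EV E i j" "EV E w b" "EV E Y y" "EV E K k" "j < n0" "k < N"
  shows "EV E (updatex A i w Y K) (update a j b y k)"
  unfolding updatex_def update_def Let_def
proof (rule EV_codes[OF EV_sizes(5) Z4(5)[OF size_bounds(6)]], goal_cases)
  case (1 E' I h)
  note e = 1 and e' = assms(1-5)[THEN EV_mono, OF 1(1)]
  have h: "h div R < off D" "h mod R < R" "j < R"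
    using e(3) assms(6) R pos' by (auto simp: H_def div_less_iff_less_mult n0_def)
  have jN: "j < N" "h mod R < N" unfolding N_def using h by linarith+
  have hj: "h div R * R + j \<le> Z ^ 2" "h div R * R \<le> Z ^ 2" "h \<le> Z ^ 2"
    using index_HR(1)[OF h(1,3)] size_bounds(6) e(3) by simp_all
  have kj: "k * N + j \<le> Z ^ 2" "k * N + h mod R \<le> Z ^ 2" "k * N \<le> Z ^ 2"
    using index_N(1)[OF assms(7) jN(1)] index_N(1)[OF assms(7) jN(2)] size_bounds(7) by simp_all
  show ?case
  proof (intro EV_ite, goal_cases)
    case 2
    have "EV E' (mulx (digx A (I [div] Rx [*] Rx [+] i)) (mux Onex (digx Y (K [*] Nx [+] i))))
        (dg a (h div R * R + j) \<otimes> mu \<one> (dg y (k * N + j)))"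
      using hj kj
      by (intro EV_times EV_mu EV_digit EV_add EV_mul EV_div EV_sizes EV_const e e' Z4(5) small2)
        simp_all
    then show ?case
    proof (rule EV_let, goal_cases)
      case (1 E'' X)
      note f' = e'[THEN EV_mono, OF 1(1)] e(2)[THEN EV_mono, OF 1(1)]
      show ?case using hj kj
        by (intro EV_ite EV_equal EV_mod EV_plus EV_times EV_digit EV_add EV_mul EV_sizes EV_const
            1 f' Z4(5) small2) simp_all
    qed
  next
    case 4
    have "n0 + n1 \<le> Z" using off_mono[of 2 D] D size_bounds(4) by (simp add: off_2)
    then show ?case by (intro EV_less EV_div EV_add EV_sizes EV_const e small Z4(1))
  next
    case 5
    then have "R + (h div R - n0) < N" by (simp add: N_def)
    from index_N(1)[OF assms(7) this] this
    have "k * N + (R + (h div R - n0)) \<le> Z ^ 2" "R + (h div R - n0) \<le> Z ^ 2"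
      using size_bounds(5,7) Z4(6) by simp_all
    then show ?case using kj
      by (intro EV_digit EV_add EV_mul EV_sub EV_div EV_sizes EV_const e e' Z4(5) small2)
  next
    case 6
    have "h div R - n0 - n1 \<le> Z" using h(1) size_bounds(4) by simp
    then show ?case by (intro EV_digit EV_sub EV_div EV_sizes EV_const e e' Z4(4))
  qed (intro EV_less EV_equal EV_mod EV_div EV_sizes EV_const EV_digit e e' Z4(5)[OF hj(3)])+
qed auto

end

context cpd_instance
begin

lemma update_less: "update A i w Y k < q ^ H"
  unfolding update_def by (rule code_less) (simp add: Let_def)

lemma init_less: "init z < q ^ H"
  unfolding init_def by (rule code_less) simp

text \<open>Results are shifted by one to leave 0 for failure; a code with \<open>H\<close> digits
  stays far enough below the value bound.\<close>

lemma EV_Suc: "EV E e v \<Longrightarrow> v < q ^ H \<Longrightarrow> EV E (e [+] lit 1) (v + 1)"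
proof (intro EV_add EV_num')
  assume "v < q ^ H"
  moreover have "q ^ H < 2 ^ (Z ^ 5)"
    unfolding q_def using Z4(5)[OF size_bounds(6)] by (intro pow_small) simp
  ultimately show "v + 1 < 2 ^ (Z ^ 5)" by simp
qed

lemma EV_attempt:
  assumes "EV E A a" "EV E i j" "EV E w b" "j < n0"
  shows "EV E (attemptx A i w) (attempt a j b)"
  unfolding attemptx_def attempt_def Let_def
proof (rule EV_let[OF EV_solve[OF assms(1-3)]], rule EV_let)
  let ?y = "solve a j b m"
  fix E' Y assume e: "prefix E E'" "EV E' Y ?y"
  note e' = assms(1-3)[THEN EV_mono, OF e(1)]
  show "EV E' (findx Nx Nx (\<lambda>K. lit 1 [-] (digx Y (K [*] Nx [+] i) [=] Zerox)))
    (find (\<lambda>k. dg ?y (k * N + j) \<noteq> \<zero>) N N)"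
  proof (rule EV_find[OF EV_sizes(4) Z4(4)[OF size_bounds(5)] EV_sizes(4)], goal_cases)
    case (1 E'' I k)
    have "j < N" using assms(4) R by (simp add: N_def n0_def)
    then have "k * N + j \<le> Z ^ 2" "k * N \<le> Z ^ 2"
      using index_N(1)[OF 1(3)] size_bounds(7) by (metis less_imp_le order_trans add_leD1)+
    then show ?case
      by (intro EV_neq EV_digit EV_add EV_mul EV_sizes EV_const 1 Z4(5) small2
          e(2)[THEN EV_mono] e'(2)[THEN EV_mono])
  qed
  let ?k = "find (\<lambda>k. dg ?y (k * N + j) \<noteq> \<zero>) N N"
  fix E'' K assume f: "prefix E' E''" "EV E'' K ?k"
  show "EV E'' (ite (K [<] Nx) (updatex A i w Y K [+] lit 1) (lit 0))
    (if ?k < N then update a j b ?y ?k + 1 else 0)"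
    by (intro EV_ite EV_less EV_sizes EV_Suc EV_update EV_num' f(2) e'[THEN EV_mono, OF f(1)]
        EV_mono[OF e(2) f(1)] assms(4) update_less)
qed

lemma EV_xval:
  assumes "EV E A a" "EV E i j" "EV E w z" "EV E p x" "x < m"
  shows "EV E (xvalx A i w p) (xval a j z x)"
  unfolding xvalx_def xval_def
proof (rule EV_lc[OF EV_const(5) size_bounds(8)])
  fix E' I r assume e: "prefix E E'" "EV E' I r" "r < R"
  note e' = assms(1-4)[THEN EV_mono, OF e(1)]
  have "r \<le> Z" using e(3) size_bounds(8) by simp
  then show "EV E' (mulx (digx w I) (fvx A i I p)) (dg z r \<otimes> fv a j r x)"
    by (intro EV_times EV_digit EV_fv e e' Z4(4) assms(5)) simp_all
qed simp

lemma row_dof: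
  assumes "row < off D"
  shows "dof row < D" "off (dof row) \<le> row" "row - off (dof row) < ns ! dof row"
proof -
  have "\<exists>d<k. \<exists>j<ns ! d. row = off d + j" if "row < off k" for k
    using that
  proof (induction k)
    case (Suc k)
    show ?case
    proof (cases "row < off k")
      case False
      then show ?thesis using Suc.prems
        by (intro exI[of _ k] exI[of _ "row - off k"] conjI) (auto simp: off_Suc)
    qed (use Suc in \<open>meson less_SucI\<close>)
  qed simp
  then obtain d j where "d < D" "j < ns ! d" "row = off d + j" using assms by blast
  then show "dof row < D" "off (dof row) \<le> row" "row - off (dof row) < ns ! dof row"
    using dof[of d j] by simp_all
qed

lemma EV_dof:
  assumes "EV E e row" "row < off D"
  shows "EV E (dofx e) (dof row)"
  unfolding dofx_def dof_def
proof (rule EV_sum[OF EV_const(4) Z4(4)[OF size_bounds(13)]])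
  have "dof row \<le> Z" using row_dof(1)[OF assms(2)] size_bounds(13) by simp
  then show "(\<Sum>d<D. of_bool (off (Suc d) \<le> row)) < (2 :: nat) ^ Z ^ 5"
    unfolding dof_def by (intro small Z4(1))
  fix E' I d assume e: "prefix E E'" "EV E' I d" "d < D"
  have "d + 1 \<le> Z" "row + 1 \<le> Z" using e(3) size_bounds(4,13) assms(2) by simp_all
  then have "EV E' (offx (I [+] lit 1) [<] e [+] lit 1) (of_bool (off (d + 1) < row + 1))"
    using e(3) by (intro EV_less EV_offs EV_add EV_num' e assms(1)[THEN EV_mono, OF e(1)] small Z4(1)) simp_all
  then show "EV E' (offx (I [+] lit 1) [<] e [+] lit 1) (of_bool (off (Suc d) \<le> row))"
    by (simp add: less_Suc_eq_le)
qed

lemma EV_upd: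
  assumes "EV E p x" "EV E e d" "EV E b j" "0 < d" "d < D" "j < ns ! d" "x < m"
  shows "EV E (updx p e b) (upd ns x d j)"
proof -
  have "upd ns x d j < m"
    using upd_less[of ns d j x] pos assms by (simp add: m_def)
  then have 1: "x - \<pi> d x * stride ns d + j * stride ns d \<le> Z" using size_bounds(3) by (simp add: upd_def)
  then have 2: "j * stride ns d \<le> Z" by simp
  have "\<pi> d x * stride ns d \<le> x div stride ns d * stride ns d"
    unfolding coord_def by (intro mult_le_mono1) simp
  also have "\<dots> \<le> x" by simp
  finally have 3: "\<pi> d x * stride ns d \<le> Z" using assms(7) size_bounds(3) by simp
  show ?thesis unfolding updx_def upd_def using 1 2 3
    by (intro EV_add EV_sub EV_mul EV_coord EV_stride assms(1-3,5) small Z4(1))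
qed

lemma EV_cand:
  assumes "EV E A a" "EV E i j" "EV E c z" "EV E p x" "x < m"
  shows "EV E (candx A i c p) (cand a j z x)"
  unfolding candx_def cand_def Let_def
proof (rule EV_codes[OF EV_sizes(6) Z4(4)[OF size_bounds(11)]], goal_cases)
  case (1 E' I h)
  note e = 1 and e' = assms(1-4)[THEN EV_mono, OF 1(1)]
  let ?row = "h + n0 + n1"
  let ?d = "dof ?row"
  have row: "?row < off D" using e(3) unfolding wlen_def by linarith
  note rd = row_dof[OF row]
  \<comment> \<open>\<open>upd\<close> stays inside a slice only for the axes other than 0; a row
    from \<open>n0\<close> on does not belong to axis 0.\<close>
  have d0: "0 < ?d"
  proof (rule gr0I)
    assume "?d = 0"
    with rd(3) have "?row < ns ! 0" by simp
    then show False by (simp add: n0_def)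
  qed
  have "h + n0 \<le> Z" "?row \<le> Z" using row size_bounds(4) by simp_all
  then have r: "EV E' (I [+] n0x [+] n1x) ?row"
    by (intro EV_add EV_sizes e small Z4(1))
  have "(if wlen \<le> R then dg z h else xval a j z (upd ns x ?d (?row - off ?d))) =
     (if R < wlen then xval a j z (upd ns x ?d (?row - off ?d)) else dg z h)" by auto
  then show ?case
  proof (simp only:, intro EV_ite EV_less EV_sizes EV_const EV_digit e e')
    show "h \<le> Z ^ 3" using e(3) size_bounds(11) by (intro Z4(4)) simp
  next
    show "EV E' (bind (dofx (I [+] n0x [+] n1x)) (\<lambda>d. xvalx A i c (updx p d (I [+] n0x [+] n1x [-] offx d))))
      (xval a j z (upd ns x ?d (?row - off ?d)))"
    proof (rule EV_let[OF EV_dof[OF r row]], goal_cases)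
      case (1 E'' X)
      note f' = e'[THEN EV_mono, OF 1(1)] r[THEN EV_mono, OF 1(1)]
      have "upd ns x ?d (?row - off ?d) < m"
        using upd_less[of ns ?d _ x] pos assms(5) d0 rd by (simp add: m_def)
      then show ?case
        using rd(1) by (intro EV_xval EV_upd EV_sub EV_offs 1 f' d0 rd assms(5)) simp_all
    qed
  qed
qed simp

text \<open>Translates the lengths of a candidate and of a guessed column into the sums that appear
  in the exponent of the theorem.\<close>

lemma wlen_sum: "wlen = (\<Sum>d=2..<D. ns ! d)" and W1_sum: "off D - n0 = (\<Sum>d=1..<D. ns ! d)"
proof -
  have "off D = off k + (\<Sum>d=k..<D. ns ! d)" if "k \<le> D" for k
    unfolding off_def lessThan_atLeast0 using that by (simp add: sum.atLeastLessThan_concat)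
  from this[of 2] this[of 1] show "wlen = (\<Sum>d=2..<D. ns ! d)" "off D - n0 = (\<Sum>d=1..<D. ns ! d)"
    using D off_1 off_2 by (simp_all add: wlen_def)
qed

lemma EV_inner:
  assumes "EV E A a" "EV E i j" "j < n0"
  shows "EV E (innerx A i) (inner a j)"
  unfolding innerx_def inner_def
proof (rule EV_first)
  have "EV E (minx Rx wlenx) (min R wlen)"
    unfolding minx_def
    by (rule EV_eq[OF EV_ite[OF EV_less[OF EV_const(5) EV_sizes(6)] EV_const(5) EV_sizes(6)]]) auto
  moreover have "min R wlen \<le> Z" using size_bounds(8) by simp
  ultimately show "EV E (powx (minx Rx wlenx)) (q ^ min R wlen)"
    by (intro EV_power Z4(4))
  show "q ^ min R wlen \<le> Nb 2" by (simp add: Nb_def q_def wlen_sum)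
  fix E' I z assume e: "prefix E E'" "EV E' I z"
  note e' = assms(1-2)[THEN EV_mono, OF e(1)]
  show "EV E' (firstx 0 mx (\<lambda>p. bind (candx A i I p) (\<lambda>w. attemptx A i w)))
    (first (\<lambda>p. attempt a j (cand a j z p)) m)"
  proof (rule EV_first[OF EV_sizes(3)], goal_cases)
    case 1
    show ?case unfolding Nb0 by (rule Z4(4)[OF size_bounds(3)])
  next
    case (2 E'' P p)
    note f' = e'[THEN EV_mono, OF 2(1)] e(2)[THEN EV_mono, OF 2(1)]
    show ?case
      by (rule EV_let[OF EV_cand[OF f'(1,2,3) 2(2,3)]])
        (intro EV_attempt f'[THEN EV_mono] assms(3))
  qed
qed

lemma EV_init:
  assumes "EV E e z"
  shows "EV E (initx e) (init z)"
  unfolding initx_def init_def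
proof (rule EV_codes[OF EV_sizes(5) Z4(5)[OF size_bounds(6)]], goal_cases)
  case (1 E' I h)
  note e = 1 and e' = assms[THEN EV_mono, OF 1(1)]
  have h: "h div R < off D" "h mod R < R"
    using e(3) pos' by (auto simp: H_def div_less_iff_less_mult)
  let ?i = "(h div R - n0) * (R - n0) + (h mod R - n0)"
  have i: "?i \<le> Z ^ 2" "(h div R - n0) * (R - n0) \<le> Z ^ 2" if "\<not> h div R < n0" "\<not> h mod R < n0"
  proof -
    define K a where "K = R - n0" and "a = h div R - n0"
    have "(a + 1) * K \<le> (off D - n0) * K"
      using h that unfolding a_def by (intro mult_le_mono1) linarith
    then have "a * K + K \<le> K * (off D - n0)" by (simp add: mult.commute)
    moreover have "h mod R - n0 \<le> K" unfolding K_def using h by simp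
    ultimately have "a * K + (h mod R - n0) \<le> K * (off D - n0)" by linarith
    then have "?i \<le> (R - n0) * (off D - n0)" unfolding K_def a_def .
    then show "?i \<le> Z ^ 2" "(h div R - n0) * (R - n0) \<le> Z ^ 2" using size_bounds(12) by linarith+
  qed
  show ?case
    using i by (intro EV_ite EV_less EV_equal EV_digit EV_add EV_mul EV_sub EV_div EV_mod EV_sizes
        EV_const e e' Z4(5) small2)
qed auto

lemma EV_stages:
  assumes "EV E e z"
  shows "EV E (stagesx e) (stages z n0)"
  unfolding stagesx_def stages_def
proof (rule EV_xfold[OF EV_sizes(1) EV_Suc[OF EV_init[OF assms] init_less]])
  show "n0 \<le> Nb 0" unfolding Nb0 by (rule Z4(4)[OF size_bounds(1)])
  fix E' X I i x assume e: "prefix E E'" "EV E' X x" "EV E' I i" "i < n0"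
  show "EV E' (ite X (bind (X [-] lit 1) (\<lambda>A. innerx A I)) (lit 0)) (if x \<noteq> 0 then inner (x - 1) i else 0)"
    by (intro EV_ite_pos EV_let[OF EV_sub[OF e(2) EV_num'(2)]] EV_inner e EV_num' e(3)[THEN EV_mono])
qed

lemma EV_outer: "EV E outerx outer"
  unfolding outerx_def outer_def
proof (rule EV_first)
  have "R - n0 \<le> Z" "off D - n0 \<le> Z" using size_bounds(4,8) by simp_all
  then show "EV E (powx ((Rx [-] n0x) [*] (offx Dx [-] n0x))) (q ^ ((R - n0) * (off D - n0)))"
    using size_bounds(12)
    by (intro EV_power EV_mul EV_sub EV_offs EV_const EV_sizes Z4(5) small2) auto
  show "q ^ ((R - n0) * (off D - n0)) \<le> Nb 1" unfolding W1_sum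
    unfolding Nb_def q_def n0_def by simp
qed (rule EV_stages)

end

subsection \<open>Loop nesting\<close>

lemmas program_defs = mainx_def solutionx_def outerx_def stagesx_def initx_def innerx_def minx_def
  candx_def updx_def dofx_def xvalx_def attemptx_def updatex_def solvex_def stepx_def pivx_def
  mux_def ellx_def genx_def wtx_def fvx_def tensx_def wlenx_def Hx_def Nx_def mx_def n1x_def n0x_def
  coordx_def stridex_def offx_def firstx_def findx_def fprodx_def fsumx_def codex_def sumx_def
  digx_def powx_def mulx_def addx_def NSx_def Rx_def Dx_def Onex_def Zerox_def Qx_def
  bind_def xfold_def ite_def bin_def get_def lit_def

text \<open>Neither exponential loop is nested in a loop with its own tag, so both bounds enter the
  running time with exponent one. This is read off from the fully unfolded program.\<close>

lemma kinds_main: "kinds (mainx L)"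
  and deg_main: "deg (Suc 0) (mainx L) = 1" "deg 2 (mainx L) = 1"
  by (simp_all add: program_defs)

section \<open>The complete program\<close>

context machine
begin

lemma EV_H: "EV E Hx (sum_list ns * R)" and H_le: "sum_list ns * R \<le> Z ^ 2"
proof -
  show h: "sum_list ns * R \<le> Z ^ 2" unfolding power2_eq_square using le_Z by (intro mult_le_mono)
  have "EV E Hx ((\<Sum>i<length ns. ns ! i) * R)"
    unfolding Hx_def using h
    by (intro EV_mul EV_off EV_consts small Z4(2)) (simp_all add: sum_list_sum_nth atLeast0LessThan)
  then show "EV E Hx (sum_list ns * R)" by (simp add: sum_list_sum_nth atLeast0LessThan)
qed

lemma input_4_enc: "js \<in> indices ns \<Longrightarrow> input F ns T R 4 (enc ns js) = T js"
  using product_lists_upt(1)[of ns] product_lists_upt(2)[of js ns] enc_less[of js ns]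
  by (simp add: input_def mem_of_def)

abbreviation decoded :: "nat \<Rightarrow> nat \<Rightarrow> nat \<Rightarrow> nat \<Rightarrow> nat" where
  "decoded v d i r \<equiv> digit (order F) v ((sum_list (take d ns) + i) * R + r)"

lemma main_correct:
  assumes sorted: "sorted_wrt (\<ge>) ns" and concise: "concise F ns T"
  shows "\<exists>v. EV E mainx v \<and> (v = 0 \<longrightarrow> (\<nexists>A. is_cpd F ns T R A)) \<and>
    (v \<noteq> 0 \<longrightarrow> is_cpd F ns T R (decoded (v - 1)))"
proof -
  have n0: "EV E n0x (ns ! 0)" for E unfolding n0x_def using D1 by (intro EV_NS EV_num) auto
  have e0: "EV E (lit 0) 0" "EV E (lit 1) 1" for E by (intro EV_num; simp)+
  have "\<exists>v. (ns ! 0 \<noteq> 0 \<longrightarrow> EV E solutionx v) \<and>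
    (ns ! 0 = 0 \<longrightarrow> v = 1) \<and> (v = 0 \<longrightarrow> (\<nexists>A. is_cpd F ns T R A)) \<and>
    (v \<noteq> 0 \<longrightarrow> is_cpd F ns T R (decoded (v - 1)))"
  proof -
    consider "ns ! 0 = 0" | "ns ! 0 \<noteq> 0" "length ns = 1" | "ns ! 0 \<noteq> 0" "2 \<le> length ns"
      using D1 by linarith
    then show ?thesis
    proof cases
      case 1
      \<comment> \<open>Sortedness makes all dimensions vanish. Then there are no indices, any
        matrices form a decomposition, and the value 1 stands for the code 0.\<close>
      have "ns ! d = 0" if "d < length ns" for d
        using sorted_wrt_nth_less[OF sorted, of 0 d] 1 that by (cases "d = 0") auto
      then have "is_cpd F ns T R (decoded 0)"
        using D1 by (force simp: is_cpd_def indices_def)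
      then show ?thesis using 1 by (intro exI[of _ 1]) simp
    next
      case 2
      then obtain n where ns: "ns = [n]" by (auto simp: length_Suc_conv)
      have R0: "0 < R" "0 < n" using R 2 ns by auto
      have Tc: "T [t] \<in> carrier F" if "t < n" for t
        using T that by (auto simp: ns indices_Cons Pi_def)
      have i4: "input F ns T R 4 t = T [t]" if "t < n" for t
        using input_4_enc[of "[t]"] that by (simp add: ns indices_Cons)
      \<comment> \<open>A tensor with one axis is its own first column; the other columns are zero.
        There is a first column because \<open>R\<close> is at least \<open>n > 0\<close>.\<close>
      define g where "g = (\<lambda>h. if h mod R = 0 then input F ns T R 4 (h div R) else \<zero>)"
      have hd: "h div R < n" if "h < n * R" for h
        using that R0 by (simp add: div_less_iff_less_mult)
      have g: "g h < order F" if "h < n * R" for h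
        using Tc[OF hd[OF that]] i4[OF hd[OF that]] zero_closed unfolding g_def carrier_eq by auto
      define v where "v = code (order F) (n * R) g"
      have nR: "n * R \<le> Z ^ 2" using H_le by (simp add: ns)
      have v: "v < order F ^ (n * R)" unfolding v_def using g by (intro code_less) auto
      moreover have "order F ^ (n * R) < 2 ^ (Z ^ 5)" using Z4(5)[OF nR] by (intro pow_small) simp
      ultimately have "v + 1 < 2 ^ (Z ^ 5)" by linarith
      moreover have "EV E (codex Hx (\<lambda>h. ite (h [mod] Rx [=] lit 0) (get 4 (h [div] Rx)) Zerox)) v"
        unfolding v_def
      proof (rule EV_code)
        show "EV E Hx (n * R)" using EV_H[of E] by (simp add: ns)
      next
        fix E' I h assume "EV E' I h"
        then show "EV E' (ite (I [mod] Rx [=] lit 0) (get 4 (I [div] Rx)) Zerox) (g h)"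
          unfolding g_def by (intro EV_ite EV_equal EV_mod EV_get EV_div EV_consts e0) simp_all
      qed (use Z4(5)[OF nR] g in auto)
      ultimately have "EV E solutionx (if length ns = 1 then v + 1 else 0)"
        unfolding solutionx_def using 2 by (intro EV_ite EV_equal EV_add EV_consts e0) auto
      then have "EV E solutionx (v + 1)"
        using 2 by simp
      moreover have "is_cpd F ns T R (decoded v)"
      proof -
        have d: "decoded v 0 t r = (if r = 0 then T [t] else \<zero>)" if "t < n" "r < R" for t r
        proof -
          have "(t + 1) * R \<le> n * R" using that by (intro mult_le_mono1) simp
          then have "t * R + r < n * R" using that by simp
          then show ?thesis unfolding v_def using g that i4
            by (subst digit_code) (auto simp: g_def)
        qed
        have c: "decoded v 0 t r \<in> carrier F" if "t < n" "r < R" for t r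
          using d[OF that] Tc[OF that(1)] by simp
        have "T [t] = (\<Oplus>r\<in>{..<R}. \<Otimes>d\<in>{..<1}. decoded v d ([t] ! d) r)" if t: "t < n" for t
        proof -
          have "(\<Oplus>r\<in>{..<R}. \<Otimes>d\<in>{..<1}. decoded v d ([t] ! d) r)
              = (\<Oplus>r\<in>{..<R}. if r = 0 then T [t] else \<zero>)"
          proof (rule sm_cong)
            fix r assume r: "r < R"
            have "{..<1} = insert 0 ({} :: nat set)" by auto
            then have "(\<Otimes>d\<in>{..<1}. decoded v d ([t] ! d) r) = decoded v 0 t r"
              using c[OF t r] by (simp add: finprod_insert Pi_def)
            then show "(\<Otimes>d\<in>{..<1}. decoded v d ([t] ! d) r) = (if r = 0 then T [t] else \<zero>)"
              using d[OF t r] by simp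
          qed (use Tc[OF t] in auto)
          also have "\<dots> = T [t]" by (rule sm_delta) (use R0 Tc[OF t] in auto)
          finally show ?thesis by simp
        qed
        then show ?thesis using c by (auto simp: is_cpd_def ns indices_Cons)
      qed
      ultimately show ?thesis using 2 by (intro exI[of _ "v + 1"]) simp
    next
      case 3
      have "0 < length ns" using D1 by linarith
      then have ac: "axis_concise F ns T 0" using concise unfolding concise_def by blast
      \<comment> \<open>Without any position the slices would be vacuously dependent, as
        \<open>ns ! 0\<close> is nonzero. A position in turn forces every dimension to be
        positive.\<close>
      have "indices (tl ns) \<noteq> {}"
      proof
        assume e: "indices (tl ns) = {}"
        have "\<forall>a\<in>{..<ns ! 0} \<rightarrow> carrier F. \<forall>i<ns ! 0. a i = \<zero>"
          using ac e unfolding axis_concise_def lin_indep_family_def by (simp add: drop_Suc)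
        from bspec[OF this, of "\<lambda>_. \<one>"] show False using 3 by auto
      qed
      then obtain js where js: "js \<in> indices (tl ns)" by blast
      have pos: "1 \<le> ns ! d" if "d < length ns" for d
      proof (cases d)
        case (Suc d')
        then have "js ! d' < tl ns ! d'" using js that by (auto simp: indices_def)
        then show ?thesis using Suc that by (simp add: nth_tl)
      qed (use 3 in simp)
      interpret C: cpd_instance F ns T R
        by unfold_locales (use 3 pos carrier_eq T R in auto)
      have off: "C.off d = sum_list (take d ns)" if "d \<le> length ns" for d
        using that by (simp add: C.off_def sum_list_sum_nth atLeast0LessThan)
      have "EV E solutionx (if length ns = 1 then 0 else C.outer)"
        unfolding solutionx_def using 3 by (intro EV_ite EV_equal EV_consts e0 C.EV_outer) auto
      then have ev: "EV E solutionx C.outer" using 3 by simp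
      have cpd: "is_cpd F ns T R (decoded (C.outer - 1))" if "C.outer \<noteq> 0"
      proof -
        obtain a where a: "C.outer = Suc a" using \<open>C.outer \<noteq> 0\<close> by (cases C.outer) auto
        show ?thesis
          by (rule is_cpd_cong[OF field_axioms C.outer_sound[OF a]]) (use off in \<open>simp add: a C.q_def\<close>)
      qed
      show ?thesis
      proof (rule exI[of _ C.outer], intro conjI impI)
        show "\<nexists>A. is_cpd F ns T R A" if "C.outer = 0"
          using C.outer_complete[OF ac] that by blast
        show "EV E solutionx C.outer" by (rule ev)
        show "is_cpd F ns T R (decoded (C.outer - 1))" if "C.outer \<noteq> 0" by (rule cpd[OF that])
      qed (use 3 in simp)
    qed
  qed
  then obtain v where v: "ns ! 0 \<noteq> 0 \<longrightarrow> EV E solutionx v"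
    "ns ! 0 = 0 \<longrightarrow> v = 1" "v = 0 \<longrightarrow> (\<nexists>A. is_cpd F ns T R A)"
    "v \<noteq> 0 \<longrightarrow> is_cpd F ns T R (decoded (v - 1))" by (elim exE conjE) (rule that)
  have "EV E mainx (if ns ! 0 = 0 then 1 else v)"
    unfolding mainx_def using v(1) by (intro EV_ite EV_equal n0 e0) auto
  then show ?thesis using v by (intro exI[of _ v]) (auto split: if_splits)
qed

end

text \<open>
  After the code of the solution has been computed, its digits are written to array 6. Cells 0
  and 1 of array 7 hold the remaining digits and the position, cell 0 of array 8 the number of digits.
\<close>

definition digit_loop :: com where
  "digit_loop = While (Bin OpLess (Get 7 (Lit 1)) (Get 8 (Lit 0)))
     (Seq (Put 6 (Get 7 (Lit 1)) (Bin OpMod (Get 7 (Lit 0)) (Get 0 (Lit 0))))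
     (Seq (Put 7 (Lit 0) (Bin OpDiv (Get 7 (Lit 0)) (Get 0 (Lit 0))))
          (Put 7 (Lit 1) (Bin OpAdd (Get 7 (Lit 1)) (Lit 1)))))"

text \<open>The number of digits is computed below one bound variable, so that the code of the
  solution survives in cell 0 of array 7. The answer is written before the shift by one is
  undone.\<close>

definition cpd_program :: com where
  "cpd_program =
     Seq (compile (mainx 0) 0 0)
     (Seq (Put 7 (Lit 0) (Get 8 (Lit 0)))
     (Seq (compile (Hx 1) 1 0)
     (Seq (Put 5 (Lit 0) (Bin OpLess (Lit 0) (Get 7 (Lit 0))))
     (Seq (Put 7 (Lit 0) (Bin OpSub (Get 7 (Lit 0)) (Lit 1)))
     (Seq (Put 7 (Lit 1) (Lit 0))
          digit_loop)))))"

context space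
begin

lemma cost_small:
  assumes "fits s" "8 \<le> S" "1 \<le> B"
  shows "n \<le> 7 \<Longrightarrow> cost s (Lit n) \<le> 8" "n \<le> 7 \<Longrightarrow> cost s (Get a (Lit n)) \<le> 9 + B"
  using cost_Lit[of s n] cost_Get[OF assms(1), of a n] by simp_all

lemma digit_loop:
  assumes "fits s" "8 \<le> S" "1 \<le> B" "H \<le> S" "H < 2 ^ B" "s 7 1 = 0" "s 8 0 = H" "s 0 0 = q"
  shows "\<exists>s'. runs digit_loop s (H * 4 + 1) s' \<and> s' 5 = s 5 \<and> (\<forall>h<H. s' 6 h = digit q (s 7 0) h)"
proof -
  define I where "I = (\<lambda>i t. fits t \<and> t 7 0 = s 7 0 div q ^ i \<and> t 7 1 = i \<and> t 8 0 = H \<and> t 0 0 = q \<and>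
    t 5 = s 5 \<and> (\<forall>h<i. t 6 h = digit q (s 7 0) h))"
  have b1: "bits (of_bool P) \<le> 1" for P using bits_le_self[of "of_bool P"] by (auto split: if_splits)
  have c: "1 + cost t (Bin OpLess (Get 7 (Lit 1)) (Get 8 (Lit 0))) \<le> U" if "fits t" for t
    using cost_small(2)[OF that assms(2,3), of 1 7] cost_small(2)[OF that assms(2,3), of 0 8]
      b1[of "t 7 1 < t 8 0"] assms(2,3)
    by (simp add: U_def)
  have "\<exists>s'. runs digit_loop s (H * (3 + 1) + 1) s' \<and> I H s'"
    unfolding digit_loop_def
  proof (rule runs_While)
    show "I 0 s" using assms by (simp add: I_def)
  next
    fix t assume "I H t"
    then show "fits t \<and> 1 + cost t (Bin OpLess (Get 7 (Lit 1)) (Get 8 (Lit 0))) \<le> U \<and>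
        val t (Bin OpLess (Get 7 (Lit 1)) (Get 8 (Lit 0))) = 0"
      using c[of t] by (auto simp: I_def)
  next
    fix i t assume i: "i < H" and I: "I i t"
    have f: "fits t" and t: "t 7 0 = s 7 0 div q ^ i" "t 7 1 = i" "t 8 0 = H" "t 0 0 = q" "t 5 = s 5"
      "\<And>h. h < i \<Longrightarrow> t 6 h = digit q (s 7 0) h" using I by (auto simp: I_def)
    have t': "t 7 (Suc 0) = i" using t(2) by simp
    define t1 where "t1 = t(6 := (t 6)(i := t 7 0 mod q))"
    have m: "t 7 0 mod q < 2 ^ B" using fits_val[OF f, of 7 0] by (rule le_less_trans[OF mod_less_eq_dividend])
    have r1: "runs (Put 6 (Get 7 (Lit 1)) (Bin OpMod (Get 7 (Lit 0)) (Get 0 (Lit 0)))) t 1 t1"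
    proof -
      have "1 + cost t (Get 7 (Lit 1)) + cost t (Bin OpMod (Get 7 (Lit 0)) (Get 0 (Lit 0))) \<le> U"
        using cost_small(2)[OF f assms(2,3), of 1 7] cost_small(2)[OF f assms(2,3), of 0 7]
          cost_small(2)[OF f assms(2,3), of 0 0] bits_le[OF m] assms(2,3) t(4)
        by (simp add: U_def)
      from runs_Put[OF f this, of 6] show ?thesis by (simp add: t1_def t t')
    qed
    have f1: "fits t1" unfolding t1_def by (rule fits_put) (use f m i assms in auto)
    define t2 where "t2 = t1(7 := (t1 7)(0 := t 7 0 div q))"
    have d: "t 7 0 div q < 2 ^ B" using fits_val[OF f, of 7 0] by (rule le_less_trans[OF div_le_dividend])
    have r2: "runs (Put 7 (Lit 0) (Bin OpDiv (Get 7 (Lit 0)) (Get 0 (Lit 0)))) t1 1 t2"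
    proof -
      have "1 + cost t1 (Lit 0) + cost t1 (Bin OpDiv (Get 7 (Lit 0)) (Get 0 (Lit 0))) \<le> U"
        using cost_small(1)[OF f1 assms(2,3), of 0] cost_small(2)[OF f1 assms(2,3), of 0 7]
          cost_small(2)[OF f1 assms(2,3), of 0 0] bits_le[OF d] assms(2,3) t(4)
        by (simp add: U_def t1_def)
      from runs_Put[OF f1 this, of 7] show ?thesis by (simp add: t2_def t1_def t)
    qed
    have f2: "fits t2" unfolding t2_def by (rule fits_put) (use f1 d assms in auto)
    define t3 where "t3 = t2(7 := (t2 7)(1 := Suc i))"
    have si: "Suc i < 2 ^ B" using i assms by simp
    have r3: "runs (Put 7 (Lit 1) (Bin OpAdd (Get 7 (Lit 1)) (Lit 1))) t2 1 t3"
    proof -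
      have "1 + cost t2 (Lit 1) + cost t2 (Bin OpAdd (Get 7 (Lit 1)) (Lit 1)) \<le> U"
        using cost_small(1)[OF f2 assms(2,3), of 1] cost_small(2)[OF f2 assms(2,3), of 1 7]
          bits_le[OF si] assms(2,3) t(2)
        by (simp add: U_def t1_def t2_def)
      from runs_Put[OF f2 this, of 7] show ?thesis by (simp add: t3_def t2_def t1_def t t')
    qed
    have f3: "fits t3" unfolding t3_def by (rule fits_put) (use f2 si assms in auto)
    have "I (Suc i) t3" unfolding I_def
      using f3 t by (auto simp: t3_def t2_def t1_def less_Suc_eq digit_def div_mult2_eq power_Suc2 simp del: power_Suc)
    then show "fits t \<and> 1 + cost t (Bin OpLess (Get 7 (Lit 1)) (Get 8 (Lit 0))) \<le> U \<and>
        val t (Bin OpLess (Get 7 (Lit 1)) (Get 8 (Lit 0))) \<noteq> 0 \<and>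
        (\<exists>s'. runs (Seq (Put 6 (Get 7 (Lit 1)) (Bin OpMod (Get 7 (Lit 0)) (Get 0 (Lit 0))))
           (Seq (Put 7 (Lit 0) (Bin OpDiv (Get 7 (Lit 0)) (Get 0 (Lit 0))))
           (Put 7 (Lit 1) (Bin OpAdd (Get 7 (Lit 1)) (Lit 1))))) t 3 s' \<and> I (Suc i) s')"
      using c[OF f] f t i runs_Seq[OF r1 runs_Seq[OF r2 r3]] by (auto simp: eval_nat_numeral)
  qed
  then show ?thesis by (auto simp: I_def)
qed

lemma cpd_program:
  assumes "fits s" "8 \<le> S" "1 \<le> B" "H \<le> S" "H < 2 ^ B" "s 0 0 = q"
    and main: "good s Nb B (mainx 0) []" "den s (mainx 0) [] = v"
    and H: "\<And>x. good s Nb B (Hx 1) [x]" "\<And>x. den s (Hx 1) [x] = H"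
    and S: "4 * sz (mainx 0) + 4 * sz (Hx 1) + 8 \<le> S"
  shows "\<exists>s'. runs cpd_program s (tb Nb (mainx 0) + tb Nb (Hx 1) + H * 4 + 5) s' \<and>
    s' 5 0 = of_bool (0 < v) \<and> (\<forall>h<H. s' 6 h = digit q (v - 1) h)"
proof -
  note c1 = cost_small(1)[OF _ assms(2,3)] and c2 = cost_small(2)[OF _ assms(2,3)]
  have b1: "bits (of_bool P) \<le> 1" for P using bits_le_self[of "of_bool P"] by (auto split: if_splits)
  obtain s1 where r1: "runs (compile (mainx 0) 0 0) s (tb Nb (mainx 0)) s1" and f1: "fits s1"
    and s1: "\<And>a. a \<noteq> 7 \<Longrightarrow> a \<noteq> 8 \<Longrightarrow> s1 a = s a" "s1 8 0 = v"
    using compile_correct[OF main(1) assms(1), of 0] S assms(3) main(2) by auto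
  define s2 where "s2 = s1(7 := (s1 7)(0 := v))"
  have r2: "runs (Put 7 (Lit 0) (Get 8 (Lit 0))) s1 1 s2"
  proof -
    have "1 + cost s1 (Lit 0) + cost s1 (Get 8 (Lit 0)) \<le> U"
      using c1[OF f1, of 0] c2[OF f1, of 0 8] assms(2,3) by (simp add: U_def)
    from runs_Put[OF f1 this, of 7] show ?thesis by (simp add: s2_def s1)
  qed
  have f2: "fits s2" unfolding s2_def s1(2)[symmetric]
    by (rule fits_put) (use f1 assms fits_val in auto)
  have gH: "good s Nb B (Hx 1) [v]" by (rule H)
  obtain s3 where r3: "runs (compile (Hx 1) 1 0) s2 (tb Nb (Hx 1)) s3" and f3: "fits s3"
    and s3: "\<And>a. a \<noteq> 7 \<Longrightarrow> a \<noteq> 8 \<Longrightarrow> s3 a = s a" "s3 7 0 = v" "s3 8 0 = H"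
    using compile_correct[OF gH f2, of 0] S assms(3) s1 H(2) by (auto simp: s2_def)
  define s4 where "s4 = s3(5 := (s3 5)(0 := of_bool (0 < v)))"
  have r4: "runs (Put 5 (Lit 0) (Bin OpLess (Lit 0) (Get 7 (Lit 0)))) s3 1 s4"
  proof -
    have "1 + cost s3 (Lit 0) + cost s3 (Bin OpLess (Lit 0) (Get 7 (Lit 0))) \<le> U"
      using c1[OF f3, of 0] c2[OF f3, of 0 7] b1[of "0 < s3 7 0"] assms(2,3) by (simp add: U_def)
    from runs_Put[OF f3 this, of 5] show ?thesis by (simp add: s4_def s3)
  qed
  have "of_bool (0 < v) < (2 :: nat) ^ B"
    using assms(3) one_less_power[of "2 :: nat" B] by simp
  then have f4: "fits s4" unfolding s4_def by (intro fits_put f3) (use assms in auto)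
  have v: "v - 1 < 2 ^ B" using fits_val[OF f1, of 8 0] s1(2) by simp
  \<comment> \<open>The subtraction is truncated: after a negative answer the digits of 0 are
    written.\<close>
  define s5 where "s5 = s4(7 := (s4 7)(0 := v - 1))"
  have r5: "runs (Put 7 (Lit 0) (Bin OpSub (Get 7 (Lit 0)) (Lit 1))) s4 1 s5"
  proof -
    have "1 + cost s4 (Lit 0) + cost s4 (Bin OpSub (Get 7 (Lit 0)) (Lit 1)) \<le> U"
      using c1[OF f4, of 0] c1[OF f4, of 1] c2[OF f4, of 0 7] bits_le[OF v] assms(2,3) s3(2)
      by (simp add: U_def s4_def)
    from runs_Put[OF f4 this, of 7] show ?thesis by (simp add: s5_def s4_def s3)
  qed
  have f5: "fits s5" unfolding s5_def by (intro fits_put f4) (use assms v in auto)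
  define s6 where "s6 = s5(7 := (s5 7)(1 := 0))"
  have r6: "runs (Put 7 (Lit 1) (Lit 0)) s5 1 s6"
  proof -
    have "1 + cost s5 (Lit 1) + cost s5 (Lit 0) \<le> U"
      using c1[OF f5, of 0] c1[OF f5, of 1] assms(2,3) by (simp add: U_def)
    from runs_Put[OF f5 this, of 7] show ?thesis by (simp add: s6_def)
  qed
  have f6: "fits s6" unfolding s6_def by (intro fits_put f5) (use assms in auto)
  have "s6 7 1 = 0" "s6 8 0 = H" "s6 0 0 = q" "s6 7 0 = v - 1" "s6 5 0 = of_bool (0 < v)"
    using s3 assms(6) by (simp_all add: s6_def s5_def s4_def)
  with digit_loop[OF f6 assms(2-5)] obtain s7 where
    r7: "runs digit_loop s6 (H * 4 + 1) s7" and s7: "s7 5 0 = of_bool (0 < v)"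
      "\<forall>h<H. s7 6 h = digit q (v - 1) h" by force
  have "runs cpd_program s (tb Nb (mainx 0) + (1 + (tb Nb (Hx 1) + (1 + (1 + (1 + (H * 4 + 1))))))) s7"
    unfolding cpd_program_def
    by (rule runs_Seq[OF r1 runs_Seq[OF r2 runs_Seq[OF r3 runs_Seq[OF r4 runs_Seq[OF r5
          runs_Seq[OF r6 r7]]]]]])
  then have "runs cpd_program s (tb Nb (mainx 0) + tb Nb (Hx 1) + H * 4 + 5) s7"
    by (rule runs_mono) simp
  then show ?thesis using s7 by blast
qed

end

lemma kinds_H: "kinds (Hx L)"
  and deg_H: "deg (Suc 0) (Hx L) = 0" "deg 2 (Hx L) = 0"
  by (simp_all add: program_defs)

text \<open>The multiples of \<open>sz\<close> are the room demanded by
  \<open>compile_correct\<close> and the factor of \<open>tb_le\<close>; the summand 8 covers the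
  fixed cells, and 9 is 4 for each output digit plus 5 single steps. In the degree, 3 comes from
  \<open>Nb 0 = Z ^ 3\<close> and 2 from the at most \<open>Z ^ 2\<close> output digits.
  \<open>cost_const\<close> dominates the constants of both time and space.\<close>

definition addr_const :: nat where "addr_const = 4 * sz (mainx 0) + 4 * sz (Hx 1) + 8"
definition step_const :: nat where "step_const = 8 * sz (mainx 0) + 8 * sz (Hx 1) + 9"
definition step_deg :: nat where "step_deg = 3 * deg 0 (mainx 0) + 3 * deg 0 (Hx 1) + 2"
definition cost_const :: nat where
  "cost_const = (9 * (1 + addr_const) + 10 * step_const + 10) * (3 + addr_const)"

context machine
begin

text \<open>\<open>Z ^ 2\<close> cells suffice for the operation tables of the field as well as for
  the output matrices.\<close>

definition S :: nat where "S = Z ^ 2 + addr_const"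

sublocale space S "Z ^ 5" .

lemma fits_input: "fits (input F ns T R)"
  unfolding fits_def
proof (intro allI impI)
  fix a i assume nz: "input F ns T R a i \<noteq> 0"
  define xss where "xss = [[order F, \<zero>, \<one>, length ns, R], ns,
      [x \<oplus> y. x \<leftarrow> [0..<order F], y \<leftarrow> [0..<order F]],
      [x \<otimes> y. x \<leftarrow> [0..<order F], y \<leftarrow> [0..<order F]],
      map T (product_lists (map (\<lambda>n. [0..<n]) ns))]"
  have inp: "input F ns T R = mem_of xss" by (simp add: input_def xss_def)
  have a: "a < 5" "i < length (xss ! a)" and v: "input F ns T R a i = xss ! a ! i"
    using nz unfolding inp mem_of_def by (auto simp: xss_def split: if_splits)
  have qq: "order F * order F \<le> Z ^ 2" using le_Z by (simp add: power2_eq_square mult_le_mono)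
  have c: "x < order F \<Longrightarrow> x \<le> Z" for x using le_Z(1) by linarith
  have z1: "\<zero> < order F" "\<one> < order F" using zero_closed one_closed unfolding carrier_eq by auto
  have op: "x \<oplus> y < order F" "x \<otimes> y < order F" if "x < order F" "y < order F" for x y
    using a_closed[of x y] m_closed[of x y] that unfolding carrier_eq by auto
  have Tc: "T js < order F" if "js \<in> set (product_lists (map (\<lambda>n. [0..<n]) ns))" for js
  proof -
    from that obtain k where k: "k < prod_list ns" "js = product_lists (map (\<lambda>n. [0..<n]) ns) ! k"
      unfolding in_set_conv_nth product_lists_upt(1) by blast
    then obtain js' where "js' \<in> indices ns" "enc ns js' = k" using enc_surj by blast
    then have "js \<in> indices ns" using k product_lists_upt(2)[of js' ns] by simp
    then show ?thesis using T carrier_eq by auto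
  qed
  have n: "n \<le> Z" if "n \<in> set ns" for n using member_le_sum_list[OF that] le_Z(4) by simp
  have "\<forall>x\<in>set (xss ! a). x \<le> Z" "length (xss ! a) \<le> Z ^ 2 + 5"
  proof -
    have "length ns \<le> Z ^ 2" "prod_list ns \<le> Z ^ 2" using le_Z Z4(6) by simp_all
    moreover have "a = 0 \<or> a = 1 \<or> a = 2 \<or> a = 3 \<or> a = 4" using a by linarith
    ultimately show "\<forall>x\<in>set (xss ! a). x \<le> Z" "length (xss ! a) \<le> Z ^ 2 + 5"
      using le_Z z1[THEN c] n op[THEN c] Tc[THEN c] qq
      by (auto simp: xss_def length_table product_lists_upt(1))
  qed
  moreover have "xss ! a ! i \<in> set (xss ! a)" using a by simp
  ultimately have "xss ! a ! i \<le> Z" "i < S" using a(2) by (auto simp: S_def addr_const_def)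
  then show "a < 9 \<and> i < S \<and> input F ns T R a i < 2 ^ Z ^ 5" using a v small Z4(1) by simp
qed

lemma steps_le:
  "tb Nb (mainx 0) + tb Nb (Hx 1) + (sum_list ns * R) * 4 + 5
    \<le> step_const * Z ^ step_deg * (Nb 1 * Nb 2)"
proof -
  let ?d1 = "deg 0 (mainx 0)" and ?d2 = "deg 0 (Hx 1)" and ?M = "Nb 1 * Nb 2"
  have Nb1: "1 \<le> Nb k" for k using card2 Z_bounds(2) by (simp add: Nb_def Suc_le_eq)
  then have M: "1 \<le> ?M" using mult_le_mono[OF Nb1[of 1] Nb1[of 2]] by simp
  have p3: "(\<Prod>k<3. f k) = f 0 * f 1 * f 2" for f :: "nat \<Rightarrow> nat"
    by (simp add: numeral_3_eq_3 numeral_2_eq_2)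
  have Zi: "Z ^ i \<le> Z ^ step_deg" if "i \<le> step_deg" for i
    using that Z_bounds(2) by (intro power_increasing) auto
  have ZM: "Z ^ i \<le> Z ^ step_deg * ?M" if "i \<le> step_deg" for i
    using mult_le_mono[OF Zi[OF that] M] by simp
  have "tb Nb (mainx 0) \<le> 8 * sz (mainx 0) * (Nb 0 ^ ?d1 * ?M)"
    using tb_le[of Nb "mainx 0"] Nb1 kinds_main deg_main[of 0] by (simp add: p3 mult.assoc)
  also have "Nb 0 ^ ?d1 * ?M = Z ^ (3 * ?d1) * ?M" by (simp add: Nb0 power_mult)
  also have "8 * sz (mainx 0) * \<dots> \<le> 8 * sz (mainx 0) * (Z ^ step_deg * ?M)"
    using Zi by (intro mult_le_mono) (auto simp: step_deg_def)
  finally have 1: "tb Nb (mainx 0) \<le> 8 * sz (mainx 0) * (Z ^ step_deg * ?M)" .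
  have "tb Nb (Hx 1) \<le> 8 * sz (Hx 1) * Nb 0 ^ ?d2"
    using tb_le[of Nb "Hx 1"] Nb1 kinds_H deg_H[of 1] by (simp add: p3)
  also have "Nb 0 ^ ?d2 = Z ^ (3 * ?d2)" by (simp add: Nb0 power_mult)
  also have "8 * sz (Hx 1) * \<dots> \<le> 8 * sz (Hx 1) * (Z ^ step_deg * ?M)"
    using ZM by (intro mult_le_mono) (auto simp: step_deg_def)
  finally have 2: "tb Nb (Hx 1) \<le> 8 * sz (Hx 1) * (Z ^ step_deg * ?M)" .
  have 3: "sum_list ns * R \<le> Z ^ step_deg * ?M"
    using H_le ZM[of 2] by (simp add: step_deg_def)
  have 4: "1 \<le> Z ^ step_deg * ?M" using ZM[of 0] by simp
  have "step_const * Z ^ step_deg * ?M = 8 * sz (mainx 0) * (Z ^ step_deg * ?M) +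
      8 * sz (Hx 1) * (Z ^ step_deg * ?M) + 9 * (Z ^ step_deg * ?M)"
    unfolding step_const_def by (simp only: algebra_simps)
  then show ?thesis using 1 2 3 4 by linarith
qed

text \<open>The seventh power reflects memory of order \<open>Z ^ 2\<close> cells, each charged
  order \<open>Z ^ 5\<close> bits for its address and its value.\<close>

lemma unit_le: "U \<le> 10 * (3 + addr_const) * Z ^ 5"
  and space_le: "W \<le> cost_const * Z ^ 7"
proof -
  have Zi: "Z ^ i \<le> Z ^ j" if "i \<le> j" for i j
    using that Z_bounds(2) by (intro power_increasing) auto
  from Zi[of 0] Zi[of 2 5] Zi[of 5 7] have Z: "1 \<le> Z ^ 2" "1 \<le> Z ^ 5" "Z ^ 2 \<le> Z ^ 5" "Z ^ 5 \<le> Z ^ 7"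
    by simp_all
  have a: "addr_const \<le> addr_const * Z ^ 2" "addr_const \<le> addr_const * Z ^ 5" using Z by simp_all
  have S: "S \<le> (1 + addr_const) * Z ^ 2" using a by (simp add: S_def)
  have SB: "1 + S + Z ^ 5 \<le> (3 + addr_const) * Z ^ 5"
    using a Z unfolding S_def add_mult_distrib by linarith
  have "U = 10 * (1 + S + Z ^ 5)" by (simp add: U_def)
  also have "\<dots> \<le> 10 * ((3 + addr_const) * Z ^ 5)" using SB by (rule mult_le_mono2)
  finally show u: "U \<le> 10 * (3 + addr_const) * Z ^ 5" by (simp only: mult.assoc)
  have "9 * S * (1 + S + Z ^ 5) \<le> 9 * ((1 + addr_const) * Z ^ 2) * ((3 + addr_const) * Z ^ 5)"
    using S SB by (intro mult_le_mono) auto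
  also have "\<dots> = 9 * (1 + addr_const) * (3 + addr_const) * (Z ^ 2 * Z ^ 5)" by (simp only: ac_simps)
  also have "Z ^ 2 * Z ^ 5 = Z ^ 7" by (simp flip: power_add)
  finally have w: "9 * S * (1 + S + Z ^ 5) \<le> 9 * (1 + addr_const) * (3 + addr_const) * Z ^ 7" .
  have "10 * (3 + addr_const) * Z ^ 5 \<le> 10 * (3 + addr_const) * Z ^ 7" using Z by simp
  then have "W \<le> 9 * (1 + addr_const) * (3 + addr_const) * Z ^ 7 + 10 * (3 + addr_const) * Z ^ 7"
    using u w unfolding W_def by linarith
  also have "\<dots> = (9 * (1 + addr_const) + 10) * (3 + addr_const) * Z ^ 7"
    by (simp only: add_mult_distrib add_mult_distrib2 mult.assoc)
  also have "\<dots> \<le> cost_const * Z ^ 7" unfolding cost_const_def by (intro mult_le_mono) auto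
  finally show "W \<le> cost_const * Z ^ 7" .
qed

lemma cpd_program_correct:
  assumes "sorted_wrt (\<ge>) ns" "concise F ns T"
  shows "\<exists>t w s. exec cpd_program (input F ns T R) t w s \<and> correct_output F ns T R s \<and>
    t \<le> cost_const * Z ^ (step_deg + 7) * (Nb 1 * Nb 2) \<and> w \<le> cost_const * Z ^ (step_deg + 7)"
proof -
  let ?H = "sum_list ns * R"
  obtain v where v: "EV [] mainx v" "v = 0 \<longrightarrow> (\<nexists>A. is_cpd F ns T R A)"
    "v \<noteq> 0 \<longrightarrow> is_cpd F ns T R (decoded (v - 1))" using main_correct[OF assms] by blast
  have g: "good (input F ns T R) Nb (Z ^ 5) (mainx 0) []" "den (input F ns T R) (mainx 0) [] = v"
    using v(1) by (auto simp: EV_def dest: spec[of _ "[]"])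
  have h: "good (input F ns T R) Nb (Z ^ 5) (Hx 1) [x]" "den (input F ns T R) (Hx 1) [x] = ?H" for x
    using EV_H[of "[]"] by (auto simp: EV_def dest: spec[of _ "[x]"])
  have B1: "1 \<le> Z ^ 5" using Z_bounds(2) by (simp add: Suc_le_eq)
  have "\<exists>s'. runs cpd_program (input F ns T R) (tb Nb (mainx 0) + tb Nb (Hx 1) + ?H * 4 + 5) s' \<and>
      s' 5 0 = of_bool (0 < v) \<and> (\<forall>h<?H. s' 6 h = digit (order F) (v - 1) h)"
    by (rule cpd_program[OF fits_input _ B1 _ _ _ g h])
      (use H_le in \<open>auto simp: S_def addr_const_def input_def mem_of_def intro: small Z4(2)\<close>)
  then obtain s where r: "runs cpd_program (input F ns T R) (tb Nb (mainx 0) + tb Nb (Hx 1) + ?H * 4 + 5) s"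
    and s: "s 5 0 = of_bool (0 < v)" "\<And>h. h < ?H \<Longrightarrow> s 6 h = digit (order F) (v - 1) h" by blast
  have co: "correct_output F ns T R s"
  proof (cases "v = 0")
    case False
    have "is_cpd F ns T R (out_factors ns R s)"
    proof (rule is_cpd_cong[OF field_axioms])
      show "is_cpd F ns T R (decoded (v - 1))" using v False by blast
      fix d i r assume d: "d < length ns" "i < ns ! d" "r < R"
      have "sum_list ns = sum_list (take d ns @ ns ! d # drop (Suc d) ns)"
        using d by (simp only: id_take_nth_drop[symmetric])
      then have "sum_list (take d ns) + i + 1 \<le> sum_list ns" using d by simp
      then have "(sum_list (take d ns) + i + 1) * R \<le> ?H" by (rule mult_le_mono1)
      then have "(sum_list (take d ns) + i) * R + r < ?H" using d by simp
      then show "decoded (v - 1) d i r = out_factors ns R s d i r"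
        by (simp add: out_factors_def s)
    qed
    then show ?thesis using False s by (simp add: correct_output_def)
  qed (use v s in \<open>simp add: correct_output_def\<close>)
  have Zi: "Z ^ i \<le> Z ^ j" if "i \<le> j" for i j
    using that Z_bounds(2) by (intro power_increasing) auto
  obtain t w where e: "exec cpd_program (input F ns T R) t w s"
    "t \<le> (tb Nb (mainx 0) + tb Nb (Hx 1) + ?H * 4 + 5) * U" "w \<le> W"
    using r by (auto simp: runs_def)
  have "t \<le> cost_const * Z ^ (step_deg + 7) * (Nb 1 * Nb 2)"
  proof -
    have "t \<le> step_const * Z ^ step_deg * (Nb 1 * Nb 2) * (10 * (3 + addr_const) * Z ^ 5)"
      using e(2) mult_le_mono[OF steps_le unit_le] by linarith
    also have "\<dots> = 10 * step_const * (3 + addr_const) * Z ^ (step_deg + 5) * (Nb 1 * Nb 2)"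
      by (simp only: power_add ac_simps)
    also have "\<dots> \<le> cost_const * Z ^ (step_deg + 7) * (Nb 1 * Nb 2)"
      unfolding cost_const_def by (intro mult_le_mono Zi) auto
    finally show ?thesis .
  qed
  moreover have "w \<le> cost_const * Z ^ (step_deg + 7)"
    using e(3) space_le mult_le_mono2[OF Zi[of 7 "step_deg + 7"], of cost_const] by linarith
  ultimately show ?thesis using e(1) co by blast
qed

end

theorem theorem1:
  "\<exists>(P :: com) (c :: nat) (k :: nat).
     \<forall>(F :: nat ring) (ns :: nat list) (T :: nat list \<Rightarrow> nat) (R :: nat).
       field F \<longrightarrow> carrier F = {..<order F} \<longrightarrow>
       length ns \<ge> 1 \<longrightarrow> sorted_wrt (\<ge>) ns \<longrightarrow>
       T \<in> indices ns \<rightarrow> carrier F \<longrightarrow> concise F ns T \<longrightarrow>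
       R \<ge> ns ! 0 \<longrightarrow>
       (\<exists>t w s. exec P (input F ns T R) t w s \<and>
          correct_output F ns T R s \<and>
          t \<le> c * params F ns R ^ k *
                order F ^ (min R (\<Sum>d=2..<length ns. ns ! d) +
                           (R - ns ! 0) * (\<Sum>d=1..<length ns. ns ! d)) \<and>
          w \<le> c * params F ns R ^ k)"
proof (rule exI[of _ cpd_program], rule exI[of _ cost_const], rule exI[of _ "step_deg + 7"],
    intro allI impI)
  fix F :: "nat ring" and ns :: "nat list" and T :: "nat list \<Rightarrow> nat" and R :: nat
  assume a: "field F" "carrier F = {..<order F}" "length ns \<ge> 1" "sorted_wrt (\<ge>) ns"
    "T \<in> indices ns \<rightarrow> carrier F" "concise F ns T" "R \<ge> ns ! 0"
  then interpret machine F ns T R by (intro machine.intro machine_axioms.intro)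
  have "Nb 1 * Nb 2 = order F ^ (min R (\<Sum>d=2..<length ns. ns ! d) +
      (R - ns ! 0) * (\<Sum>d=1..<length ns. ns ! d))"
    by (simp add: Nb_def power_add)
  then show "\<exists>t w s. exec cpd_program (input F ns T R) t w s \<and>
      correct_output F ns T R s \<and>
      t \<le> cost_const * params F ns R ^ (step_deg + 7) *
        order F ^ (min R (\<Sum>d=2..<length ns. ns ! d) + (R - ns ! 0) * (\<Sum>d=1..<length ns. ns ! d)) \<and>
      w \<le> cost_const * params F ns R ^ (step_deg + 7)"
    using cpd_program_correct[OF a(4,6)] by (simp add: Z_def)
qed

end
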